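(* Let $F$ be the function field of a smooth, projective, geometrically irreducible curve over a field $K$ of characteristic $p\geq 0$. Let $E$ be an elliptic curve over $K$ and $P\in E(F)\setminus E(K)$ a point of infinite order. Let $D_n=D_{nP}$ denote the terms of the elliptic divisibility sequence of $(E_F,P)$, where $E_F$ is the base change of $E$ to $F$. Let $n$ be a positive integer. 1. If $p\nmid n$ or $E$ is ordinary, then $D_n$ has a primitive valuation. 2. If $p\mid n$ and $E$ is supersingular, then $D_n=p^2D_{n/p}$ has no primitive valuation.
   Context: Let $F=K(C)$ with $C$ a smooth, projective, geometrically irreducible curve over a field $K$. A valuation $v$ of $F$ means a normalized discrete valuation of $F$ that is trivial on $K$ (equivalently, a closed point of $C$). Elliptic divisibility sequence (EDS): for an elliptic curve $E/F$ and a point $P\in E(F)$ of infinite order, $D_n=D_{nP}$ ($n\ge 1$) is the divisor on $C$ defined by $v(D_{nP})=\max\{-\tfrac12 v(x_v(nP)),0\}$ for every valuation $v$ of $F$, where $x_v$ is the $x$-coordinate function of a $v$-minimal Weierstrass equation of $E$. A valuation $v$ is a primitive valuation of $D_n$ if $v(D_n)>0$ and $v(D_m)=0$ for all $1\le m<n$. Ordinary means not supersingular; in characteristic $0$ every elliptic curve is ordinary. *)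

theory Defs
  imports
    "HOL-Analysis.Cartesian_Space"
    "HOL-Library.Poly_Mapping"
    "HOL-Library.Extended_Real"
    "HOL-Algebra.Algebraic_Closure_Type"
begin

section \<open>Polynomials in several variables\<close>

type_synonym ('i, 'a) mpolynomial = "('i \<Rightarrow>\<^sub>0 nat) \<Rightarrow>\<^sub>0 'a"

text \<open>Evaluation at the point \<open>x\<close>, where the coefficients are first transported along \<open>\<phi>\<close>.\<close>

definition mpoly_eval ::
    "('k::zero \<Rightarrow> 'a::comm_semiring_1) \<Rightarrow> ('i, 'k) mpolynomial \<Rightarrow> ('i \<Rightarrow> 'a) \<Rightarrow> 'a" where
  "mpoly_eval \<phi> f x =
     (\<Sum>m\<in>Poly_Mapping.keys f. \<phi> (Poly_Mapping.lookup f m) *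
        (\<Prod>i\<in>Poly_Mapping.keys m. x i ^ Poly_Mapping.lookup m i))"

text \<open>Subtraction of exponents is truncated, but the terms where this matters have coefficient 0.\<close>

definition mpoly_pderiv ::
    "'i \<Rightarrow> ('i, 'k::semiring_1) mpolynomial \<Rightarrow> ('i, 'k) mpolynomial" where
  "mpoly_pderiv i f =
     (\<Sum>m\<in>Poly_Mapping.keys f.
        Poly_Mapping.single (m - Poly_Mapping.single i 1)
          (of_nat (Poly_Mapping.lookup m i) * Poly_Mapping.lookup f m))"

definition mpoly_vars :: "('i, 'k::zero) mpolynomial \<Rightarrow> 'i set" where
  "mpoly_vars f = (\<Union>m\<in>Poly_Mapping.keys f. Poly_Mapping.keys m)"

definition homogeneous_of_degree :: "nat \<Rightarrow> ('i, 'k::zero) mpolynomial \<Rightarrow> bool" where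
  "homogeneous_of_degree d f \<longleftrightarrow>
     (\<forall>m\<in>Poly_Mapping.keys f. (\<Sum>i\<in>Poly_Mapping.keys m. Poly_Mapping.lookup m i) = d)"

definition homogeneous :: "('i, 'k::zero) mpolynomial \<Rightarrow> bool" where
  "homogeneous f \<longleftrightarrow> (\<exists>d. homogeneous_of_degree d f)"


section \<open>Function fields of smooth projective geometrically irreducible curves\<close>

locale field_embedding =
  fixes emb :: "'k::field \<Rightarrow> 'f::field"
  assumes emb_one: "emb 1 = 1"
    and emb_add: "emb (a + b) = emb a + emb b"
    and emb_mult: "emb (a * b) = emb a * emb b"

text \<open>The elements of \<open>S\<close> serve as the names of the variables in polynomials.\<close>

definition alg_independent :: "('k::field \<Rightarrow> 'f::field) \<Rightarrow> 'f set \<Rightarrow> bool" where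
  "alg_independent emb S \<longleftrightarrow>
     (\<forall>f :: ('f, 'k) mpolynomial. mpoly_vars f \<subseteq> S \<and> mpoly_eval emb f (\<lambda>s. s) = 0 \<longrightarrow> f = 0)"

definition transcendence_basis :: "('k::field \<Rightarrow> 'f::field) \<Rightarrow> 'f set \<Rightarrow> bool" where
  "transcendence_basis emb B \<longleftrightarrow>
     alg_independent emb B \<and> (\<forall>S. B \<subseteq> S \<and> alg_independent emb S \<longrightarrow> S = B)"

text \<open>
  An integral projective curve \<open>C\<close> over \<open>K\<close>, embedded in the projective space with homogeneous
  coordinates indexed by \<open>'i\<close>, is given by its generic point \<open>\<xi>\<close>, a vector of homogeneous
  coordinates in the function field \<open>F\<close>: the homogeneous prime ideal of \<open>C\<close> is generated by the
  homogeneous polynomials over \<open>K\<close> vanishing at \<open>\<xi>\<close>, and \<open>K(C)\<close> consists of the values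
  at \<open>\<xi>\<close> of quotients of homogeneous polynomials of equal degree.
\<close>

definition homogeneous_ideal ::
    "('k::field \<Rightarrow> 'f::field) \<Rightarrow> 'f ^ 'i \<Rightarrow> ('i, 'k) mpolynomial set" where
  "homogeneous_ideal emb \<xi> = {f. homogeneous f \<and> mpoly_eval emb f (\<lambda>i. \<xi> $ i) = 0}"

text \<open>
  Points of projective space are represented by their nonzero vectors of homogeneous coordinates;
  sets of points are thus sets of such vectors.
\<close>

definition geometric_points ::
    "('k::field \<Rightarrow> 'f::field) \<Rightarrow> 'f ^ 'i \<Rightarrow> ('k alg_closure ^ 'i) set" where
  "geometric_points emb \<xi> =
     {z. z \<noteq> 0 \<and> (\<forall>f\<in>homogeneous_ideal emb \<xi>. mpoly_eval to_ac f (\<lambda>i. z $ i) = 0)}"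

definition zariski_closed :: "('a::field ^ 'i) set \<Rightarrow> bool" where
  "zariski_closed Z \<longleftrightarrow>
     (\<exists>S :: ('i, 'a) mpolynomial set. (\<forall>f\<in>S. homogeneous f) \<and>
        Z = {z. z \<noteq> 0 \<and> (\<forall>f\<in>S. mpoly_eval (\<lambda>c. c) f (\<lambda>i. z $ i) = 0)})"

definition zariski_irreducible :: "('a::field ^ 'i) set \<Rightarrow> bool" where
  "zariski_irreducible V \<longleftrightarrow>
     V \<noteq> {} \<and>
     (\<forall>Y Z. zariski_closed Y \<and> zariski_closed Z \<and> V \<subseteq> Y \<union> Z \<longrightarrow> V \<subseteq> Y \<or> V \<subseteq> Z)"

text \<open>
  The Zariski tangent space at \<open>z\<close> of the affine cone over the curve, i.e. the kernel of the
  Jacobian matrix of the homogeneous ideal. By Euler's relation it contains the line spanned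
  by \<open>z\<close>, and modulo that line it is the tangent space of the curve.
\<close>

definition cone_tangent_space ::
    "('k::field \<Rightarrow> 'f::field) \<Rightarrow> 'f ^ 'i::finite \<Rightarrow> 'k alg_closure ^ 'i \<Rightarrow> ('k alg_closure ^ 'i) set" where
  "cone_tangent_space emb \<xi> z =
     {w. \<forall>f\<in>homogeneous_ideal emb \<xi>.
           (\<Sum>i\<in>UNIV. mpoly_eval to_ac (mpoly_pderiv i f) (\<lambda>j. z $ j) * w $ i) = 0}"

text \<open>
  Smoothness is the Jacobian criterion at all geometric points: the tangent space of the curve has
  dimension 1, equivalently that of the cone has dimension 2.
\<close>

locale smooth_projective_geom_irreducible_curve = field_embedding emb
  for emb :: "'k::field \<Rightarrow> 'f::field" +
  fixes \<xi> :: "'f ^ 'i::finite"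
  assumes generic_point_nonzero: "\<xi> \<noteq> 0"
    and function_field:
      "\<exists>d f g. homogeneous_of_degree d f \<and> homogeneous_of_degree d g \<and>
         mpoly_eval emb g (\<lambda>i. \<xi> $ i) \<noteq> 0 \<and>
         t = mpoly_eval emb f (\<lambda>i. \<xi> $ i) / mpoly_eval emb g (\<lambda>i. \<xi> $ i)"
    and dimension_one: "\<exists>B. transcendence_basis emb B \<and> card B = 1"
    and geom_irreducible: "zariski_irreducible (geometric_points emb \<xi>)"
    and smooth: "z \<in> geometric_points emb \<xi> \<Longrightarrow> vec.dim (cone_tangent_space emb \<xi> z) = 2"


section \<open>Valuations\<close>

text \<open>Normalized discrete valuations of \<open>F\<close> that are trivial on \<open>K\<close>, with \<open>v 0 = \<infinity>\<close>.\<close>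

definition is_valuation :: "('k::field \<Rightarrow> 'f::field) \<Rightarrow> ('f \<Rightarrow> ereal) \<Rightarrow> bool" where
  "is_valuation emb v \<longleftrightarrow>
     v 0 = \<infinity> \<and>
     (\<forall>a. a \<noteq> 0 \<longrightarrow> (\<exists>k::int. v a = ereal (real_of_int k))) \<and>
     (\<exists>a. v a = 1) \<and>
     (\<forall>a b. v (a * b) = v a + v b) \<and>
     (\<forall>a b. min (v a) (v b) \<le> v (a + b)) \<and>
     (\<forall>c. c \<noteq> 0 \<longrightarrow> v (emb c) = 0)"


section \<open>Elliptic curves\<close>

text \<open>\<open>y\<^sup>2 + a\<^sub>1 x y + a\<^sub>3 y = x\<^sup>3 + a\<^sub>2 x\<^sup>2 + a\<^sub>4 x + a\<^sub>6\<close>\<close>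

datatype 'a weierstrass =
  Weierstrass (wa1: 'a) (wa2: 'a) (wa3: 'a) (wa4: 'a) (wa6: 'a)

definition discriminant :: "'a::comm_ring_1 weierstrass \<Rightarrow> 'a" where
  "discriminant E =
     (let b2 = wa1 E ^ 2 + 4 * wa2 E;
          b4 = 2 * wa4 E + wa1 E * wa3 E;
          b6 = wa3 E ^ 2 + 4 * wa6 E;
          b8 = wa1 E ^ 2 * wa6 E + 4 * wa2 E * wa6 E - wa1 E * wa3 E * wa4 E
                 + wa2 E * wa3 E ^ 2 - wa4 E ^ 2
      in - (b2 ^ 2 * b8) - 8 * b4 ^ 3 - 27 * b6 ^ 2 + 9 * b2 * b4 * b6)"

definition elliptic_curve :: "'a::field weierstrass \<Rightarrow> bool" where
  "elliptic_curve E \<longleftrightarrow> discriminant E \<noteq> 0"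

datatype 'a ec_point = Infty | Affine 'a 'a

fun ec_points :: "'a::comm_ring_1 weierstrass \<Rightarrow> 'a ec_point set" where
  "ec_points (Weierstrass a1 a2 a3 a4 a6) =
     insert Infty {Affine x y | x y.
       y ^ 2 + a1 * x * y + a3 * y = x ^ 3 + a2 * x ^ 2 + a4 * x + a6}"

fun ec_add :: "'a::field weierstrass \<Rightarrow> 'a ec_point \<Rightarrow> 'a ec_point \<Rightarrow> 'a ec_point" where
  "ec_add E Infty Q = Q"
| "ec_add E P Infty = P"
| "ec_add E (Affine x1 y1) (Affine x2 y2) =
     (if x1 = x2 \<and> y1 + y2 + wa1 E * x2 + wa3 E = 0 then Infty
      else
        let l = (if x1 = x2
                 then (3 * x1 ^ 2 + 2 * wa2 E * x1 + wa4 E - wa1 E * y1)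
                        / (2 * y1 + wa1 E * x1 + wa3 E)
                 else (y2 - y1) / (x2 - x1));
            x3 = l ^ 2 + wa1 E * l - wa2 E - x1 - x2;
            y3 = - (l + wa1 E) * x3 - (y1 - l * x1) - wa3 E
        in Affine x3 y3)"

definition ec_mult :: "'a::field weierstrass \<Rightarrow> nat \<Rightarrow> 'a ec_point \<Rightarrow> 'a ec_point" where
  "ec_mult E n P = (ec_add E P ^^ n) Infty"

definition infinite_order :: "'a::field weierstrass \<Rightarrow> 'a ec_point \<Rightarrow> bool" where
  "infinite_order E P \<longleftrightarrow> (\<forall>n>0. ec_mult E n P \<noteq> Infty)"

text \<open>In characteristic \<open>p > 0\<close>: there is no nontrivial \<open>p\<close>-torsion over the algebraic closure.\<close>

definition supersingular :: "'k::field weierstrass \<Rightarrow> bool" where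
  "supersingular E \<longleftrightarrow>
     CHAR('k) > 0 \<and>
     (\<forall>Q\<in>ec_points (map_weierstrass to_ac E).
        ec_mult (map_weierstrass to_ac E) CHAR('k) Q = Infty \<longrightarrow> Q = Infty)"

definition ordinary :: "'k::field weierstrass \<Rightarrow> bool" where
  "ordinary E \<longleftrightarrow> \<not> supersingular E"


section \<open>Minimal Weierstrass equations\<close>

text \<open>
  The equation satisfied by \<open>x', y'\<close> after the substitution \<open>x = u\<^sup>2 x' + r\<close>,
  \<open>y = u\<^sup>3 y' + u\<^sup>2 s x' + t\<close>. These are all Weierstrass equations of the same elliptic curve.
\<close>

fun change_coords :: "'a::field weierstrass \<Rightarrow> 'a \<times> 'a \<times> 'a \<times> 'a \<Rightarrow> 'a weierstrass" where
  "change_coords (Weierstrass a1 a2 a3 a4 a6) (u, r, s, t) = Weierstrass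
     ((a1 + 2 * s) / u)
     ((a2 - s * a1 + 3 * r - s ^ 2) / u ^ 2)
     ((a3 + r * a1 + 2 * t) / u ^ 3)
     ((a4 - s * a3 + 2 * r * a2 - (t + r * s) * a1 + 3 * r ^ 2 - 2 * s * t) / u ^ 4)
     ((a6 + r * a4 + r ^ 2 * a2 + r ^ 3 - t * a3 - t ^ 2 - r * t * a1) / u ^ 6)"

definition integral_model :: "('f \<Rightarrow> ereal) \<Rightarrow> 'f::field weierstrass \<Rightarrow> bool" where
  "integral_model v E \<longleftrightarrow> (\<forall>a\<in>set_weierstrass E. 0 \<le> v a)"

definition minimal_change ::
    "('f \<Rightarrow> ereal) \<Rightarrow> 'f::field weierstrass \<Rightarrow> 'f \<times> 'f \<times> 'f \<times> 'f \<Rightarrow> bool" where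
  "minimal_change v E c \<longleftrightarrow>
     fst c \<noteq> 0 \<and> integral_model v (change_coords E c) \<and>
     (\<forall>c'. fst c' \<noteq> 0 \<and> integral_model v (change_coords E c') \<longrightarrow>
        v (discriminant (change_coords E c)) \<le> v (discriminant (change_coords E c')))"

text \<open>
  The coordinate \<open>x' = (x - r) / u\<^sup>2\<close> on an arbitrarily chosen \<open>v\<close>-minimal equation. Two such
  choices differ by a substitution with \<open>v u = 0\<close> and \<open>v r \<ge> 0\<close>, so that
  \<open>max (- v x' / 2) 0\<close> does not depend on the choice.
\<close>

definition minimal_x :: "('f \<Rightarrow> ereal) \<Rightarrow> 'f::field weierstrass \<Rightarrow> 'f \<Rightarrow> 'f" where
  "minimal_x v E x = (case (SOME c. minimal_change v E c) of (u, r, s, t) \<Rightarrow> (x - r) / u ^ 2)"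


section \<open>Elliptic divisibility sequences\<close>

text \<open>
  Divisors are given by their coefficients at all valuations. If \<open>nP\<close> is the point at infinity
  (which is excluded for points of infinite order and \<open>n > 0\<close>), the value is \<open>\<infinity>\<close>.
\<close>

definition point_divisor ::
    "'f::field weierstrass \<Rightarrow> 'f ec_point \<Rightarrow> ('f \<Rightarrow> ereal) \<Rightarrow> ereal" where
  "point_divisor E Q v =
     (case Q of Infty \<Rightarrow> \<infinity> | Affine x y \<Rightarrow> max (- (v (minimal_x v E x) / 2)) 0)"

definition eds :: "'f::field weierstrass \<Rightarrow> 'f ec_point \<Rightarrow> nat \<Rightarrow> ('f \<Rightarrow> ereal) \<Rightarrow> ereal" where
  "eds E P n = point_divisor E (ec_mult E n P)"

definition primitive_valuation ::
    "('k::field \<Rightarrow> 'f::field) \<Rightarrow> 'f weierstrass \<Rightarrow> 'f ec_point \<Rightarrow> nat \<Rightarrow> ('f \<Rightarrow> ereal) \<Rightarrow> bool" where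
  "primitive_valuation emb E P n v \<longleftrightarrow>
     is_valuation emb v \<and> eds E P n v > 0 \<and> (\<forall>m. 1 \<le> m \<and> m < n \<longrightarrow> eds E P m v = 0)"

end

theory Submission
  imports Defs
begin

text \<open>
  On a constant curve the coordinate \<open>x(m P)\<close> is \<open>f\<^sub>m(x) / g\<^sub>m(x)\<close> for coprime polynomials over
  \<open>K\<close> with \<open>deg f\<^sub>m = m\<^sup>2 > deg g\<^sub>m\<close>, where \<open>x = x(P)\<close>; a valuation \<open>v\<close> with \<open>v(x) \<ge> 0\<close> divides
  \<open>D\<^sub>m\<close> iff \<open>v(g\<^sub>m(x)) > 0\<close>. If \<open>E\<close> has a geometric point \<open>Q\<close> of exact order \<open>n\<close>, every
  valuation of \<open>F\<close> above the place \<open>x = x(Q)\<close> is therefore primitive for \<open>D\<^sub>n\<close>. Such a \<open>Q\<close>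
  exists in case 1: multiplication by \<open>m\<close> is surjective because \<open>deg f\<^sub>m > deg g\<^sub>m\<close>, and there is
  \<open>q\<close>-torsion for primes \<open>q \<noteq> p\<close> because \<open>g\<^sub>q\<close> has the coefficient \<open>q\<^sup>2\<close> in degree \<open>q\<^sup>2 - 1\<close>. In
  the supersingular case \<open>g\<^sub>p\<close> has no zeros, so \<open>x(p R)\<close> is a polynomial of degree \<open>p\<^sup>2\<close> in \<open>x(R)\<close>.

  That \<open>x\<close> is transcendental over \<open>K\<close> means that \<open>K\<close> is algebraically closed in \<open>F\<close>: an element
  whose minimal polynomial has two roots would split the geometric points of \<open>C\<close>, and a purely
  inseparable one would force two independent derivations of \<open>F\<close> over \<open>K\<close>, hence a tangent space of
  dimension at least 2.
\<close>

subsection \<open>The chord-tangent law\<close>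

text \<open>The coefficients of the equation are constants, so its discriminant is a unit at every
  valuation and the equation is already minimal; \<open>eds\<close> is therefore half the pole
  divisor of \<open>x(nP)\<close>, and everything happens on the x-line. The fractions for
  \<open>x(mQ)\<close> arise recursively from the sum and product of \<open>x(R + Q)\<close> and
  \<open>x(R - Q)\<close>, which depend on \<open>x(R)\<close> and \<open>x(Q)\<close> alone;
  coprimality, degrees and top coefficients are carried along the recursion. The delicate point is
  the field of constants. If \<open>x(P)\<close> were algebraic over \<open>K\<close>, no valuation
  could have a pole or a zero there. Irreducibility of the set of geometric points excludes only
  constants with several conjugates, because points over the closure of \<open>K\<close> do not see
  a purely inseparable extension; smoothness at the geometric points has to exclude those.
  Valuations come from homomorphisms into the closure of \<open>K\<close> that Zorn's lemma makes
  maximal. Discreteness then needs an argument of its own, and it rests on the finite degree of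
  \<open>F\<close> over \<open>K(t)\<close>.\<close>

lemma mem_ec_points_iff:
  "Affine x y \<in> ec_points E \<longleftrightarrow>
     y ^ 2 + wa1 E * x * y + wa3 E * y = x ^ 3 + wa2 E * x ^ 2 + wa4 E * x + wa6 E"
  by (cases E) auto

lemma Infty_in_ec_points [simp]: "Infty \<in> ec_points E"
  by (cases E) auto

fun ec_neg :: "'a::field weierstrass \<Rightarrow> 'a ec_point \<Rightarrow> 'a ec_point" where
  "ec_neg E Infty = Infty"
| "ec_neg E (Affine x y) = Affine x (- y - wa1 E * x - wa3 E)"

lemma ec_neg_neg [simp]: "ec_neg E (ec_neg E P) = P"
  by (cases P) auto

lemma ec_neg_closed: "P \<in> ec_points E \<Longrightarrow> ec_neg E P \<in> ec_points E"
  by (cases P) (auto simp: mem_ec_points_iff algebra_simps power2_eq_square)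

lemma ec_add_Infty_right [simp]: "ec_add E P Infty = P"
  by (cases P) auto

lemma ec_add_neg [simp]: "ec_add E P (ec_neg E P) = Infty"
  by (cases P) auto

lemma ec_points_same_x:
  fixes E :: "'a::field weierstrass"
  assumes "Affine x y \<in> ec_points E" "Affine x y' \<in> ec_points E"
  shows "y' = y \<or> y + y' + wa1 E * x + wa3 E = 0"
proof -
  obtain a1 a2 a3 a4 a6 where E: "E = Weierstrass a1 a2 a3 a4 a6" by (cases E)
  have "y' ^ 2 + a1 * x * y' + a3 * y' = y ^ 2 + a1 * x * y + a3 * y"
    using assms unfolding mem_ec_points_iff E weierstrass.sel by simp
  moreover have "(y' - y) * (y + y' + a1 * x + a3) =
      (y' ^ 2 + a1 * x * y' + a3 * y') - (y ^ 2 + a1 * x * y + a3 * y)"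
    by (simp add: algebra_simps power2_eq_square)
  ultimately have "y' - y = 0 \<or> y + y' + a1 * x + a3 = 0"
    by (simp only: mult_eq_0_iff[symmetric] diff_self)
  then show ?thesis by (auto simp: E)
qed

text \<open>A common zero of both partial derivatives would be a singular point. The derivative
  equations and the curve equation are linear in \<open>a3\<close>, \<open>a4\<close>,
  \<open>a6\<close>; after solving for these the discriminant is identically zero.\<close>

lemma nonsingular:
  assumes "elliptic_curve E" "Affine x y \<in> ec_points E" "2 * y + wa1 E * x + wa3 E = 0"
  shows "3 * x ^ 2 + 2 * wa2 E * x + wa4 E - wa1 E * y \<noteq> 0"
proof
  assume n: "3 * x ^ 2 + 2 * wa2 E * x + wa4 E - wa1 E * y = 0"
  obtain a1 a2 a3 a4 a6 where E: "E = Weierstrass a1 a2 a3 a4 a6" by (cases E)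
  have a3: "a3 = - 2 * y - a1 * x" using assms(3) unfolding E weierstrass.sel by Groebner_Basis.algebra
  have a4: "a4 = a1 * y - 3 * x ^ 2 - 2 * a2 * x" using n unfolding E weierstrass.sel by Groebner_Basis.algebra
  have a6: "a6 = y ^ 2 + a1 * x * y + a3 * y - x ^ 3 - a2 * x ^ 2 - a4 * x"
    using assms(2) unfolding E weierstrass.sel mem_ec_points_iff by Groebner_Basis.algebra
  have "discriminant E = 0"
    unfolding discriminant_def Let_def E weierstrass.sel a6 a4 a3 by Groebner_Basis.algebra
  then show False using assms(1) by (simp add: elliptic_curve_def)
qed

text \<open>Vieta's relations for the cubic obtained by putting \<open>y = l * x + m\<close> into
  the curve equation. They count intersections with multiplicity, so chords and tangents are treated
  alike and the three roots may be permuted.\<close>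

definition on_line :: "'a::field weierstrass \<Rightarrow> 'a \<Rightarrow> 'a \<Rightarrow> 'a \<Rightarrow> 'a \<Rightarrow> 'a \<Rightarrow> bool" where
  "on_line E l m x1 x2 x3 \<longleftrightarrow>
     x1 + x2 + x3 = l ^ 2 + wa1 E * l - wa2 E \<and>
     x1 * x2 + x1 * x3 + x2 * x3 = wa4 E - 2 * l * m - wa1 E * m - wa3 E * l \<and>
     x1 * x2 * x3 = m ^ 2 + wa3 E * m - wa6 E"

lemma on_lineD:
  assumes "on_line E l m x1 x2 x3"
  shows "x1 + x2 + x3 = l ^ 2 + wa1 E * l - wa2 E"
    "x1 * x2 + x1 * x3 + x2 * x3 = wa4 E - 2 * l * m - wa1 E * m - wa3 E * l"
    "x1 * x2 * x3 = m ^ 2 + wa3 E * m - wa6 E"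
  using assms by (auto simp: on_line_def)

lemma on_line_perm:
  "on_line E l m x1 x2 x3 \<Longrightarrow> on_line E l m x2 x1 x3"
  "on_line E l m x1 x2 x3 \<Longrightarrow> on_line E l m x3 x2 x1"
  by (auto simp: on_line_def algebra_simps)

lemma on_line_point:
  assumes "on_line E l m x1 x2 x3"
  shows "Affine x1 (l * x1 + m) \<in> ec_points E"
proof -
  obtain a1 a2 a3 a4 a6 where E: "E = Weierstrass a1 a2 a3 a4 a6" by (cases E)
  have "(l * x1 + m) ^ 2 + wa1 E * x1 * (l * x1 + m) + wa3 E * (l * x1 + m) =
    x1 ^ 3 + wa2 E * x1 ^ 2 + wa4 E * x1 + wa6 E"
    using on_lineD[OF assms] unfolding E weierstrass.sel by Groebner_Basis.algebra
  then show ?thesis by (simp add: mem_ec_points_iff)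
qed

lemma ec_add_on_line:
  assumes "elliptic_curve E" and L: "on_line E l m x1 x2 x3"
  shows "ec_add E (Affine x1 (l * x1 + m)) (Affine x2 (l * x2 + m)) =
           ec_neg E (Affine x3 (l * x3 + m))"
proof -
  obtain a1 a2 a3 a4 a6 where E: "E = Weierstrass a1 a2 a3 a4 a6" by (cases E)
  have x3: "x3 = l ^ 2 + wa1 E * l - wa2 E - x1 - x2"
    using on_lineD[OF L] unfolding E weierstrass.sel by Groebner_Basis.algebra
  have y3: "- (l + wa1 E) * x3 - (l * x1 + m - l * x1) - wa3 E = - (l * x3 + m) - wa1 E * x3 - wa3 E"
    by (simp add: algebra_simps)
  show ?thesis
  proof (cases "x1 = x2")
    case False
    then have sl: "(l * x2 + m - (l * x1 + m)) / (x2 - x1) = l"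
      by (simp add: field_simps)
    show ?thesis
      using False by (simp only: ec_add.simps sl Let_def x3[symmetric] simp_thms not_False_eq_True if_False)
        (simp add: algebra_simps)
  next
    case True
    let ?y = "l * x1 + m"
    have d: "3 * x1 ^ 2 + 2 * wa2 E * x1 + wa4 E - wa1 E * ?y = l * (2 * ?y + wa1 E * x1 + wa3 E)"
      using on_lineD[OF L] True unfolding E weierstrass.sel by Groebner_Basis.algebra
    \<comment> \<open>By \<open>d\<close>, a vanishing denominator of the tangent slope forces the
      numerator to vanish too, against nonsingularity.\<close>
    have nz: "2 * ?y + wa1 E * x1 + wa3 E \<noteq> 0"
    proof
      assume z: "2 * ?y + wa1 E * x1 + wa3 E = 0"
      then have "3 * x1 ^ 2 + 2 * wa2 E * x1 + wa4 E - wa1 E * ?y = 0"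
        using d by simp
      then show False using nonsingular[OF assms(1) on_line_point[OF L] z] by simp
    qed
    have sl: "(3 * x1 ^ 2 + 2 * wa2 E * x1 + wa4 E - wa1 E * ?y) / (2 * ?y + wa1 E * x1 + wa3 E) = l"
      unfolding d using nz by simp
    have neq: "\<not> (x1 = x2 \<and> ?y + (l * x2 + m) + wa1 E * x2 + wa3 E = 0)"
      using nz unfolding True[symmetric] mult_2 by blast
    show ?thesis
      unfolding ec_add.simps if_not_P[OF neq] if_P[OF True] sl Let_def x3[symmetric] ec_neg.simps y3
      by (rule refl)
  qed
qed

lemma ec_add_line_exists:
  assumes "Affine x1 y1 \<in> ec_points E" "Affine x2 y2 \<in> ec_points E"
    and nz: "ec_add E (Affine x1 y1) (Affine x2 y2) \<noteq> Infty"
  obtains l m x3 where "on_line E l m x1 x2 x3" "y1 = l * x1 + m" "y2 = l * x2 + m"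
proof -
  obtain a1 a2 a3 a4 a6 where E: "E = Weierstrass a1 a2 a3 a4 a6" by (cases E)
  show ?thesis
  proof (cases "x1 = x2")
    case False
    define l where "l = (y2 - y1) / (x2 - x1)"
    define m where "m = y1 - l * x1"
    define x3 where "x3 = l ^ 2 + wa1 E * l - wa2 E - x1 - x2"
    have l: "l * (x2 - x1) = y2 - y1" using False by (simp add: l_def)
    have y: "y1 = l * x1 + m" "y2 = l * x2 + m" using l by (auto simp: m_def algebra_simps)
    have 1: "x1 + x2 + x3 = l ^ 2 + wa1 E * l - wa2 E" by (simp add: x3_def)
    \<comment> \<open>The difference of the two curve equations is divisible by
      \<open>x1 - x2\<close>; cancelling it gives the second Vieta relation.\<close>
    have "(x1 - x2) * (x1 * x2 + x1 * x3 + x2 * x3 - (wa4 E - 2 * l * m - wa1 E * m - wa3 E * l)) = 0"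
      using assms(1,2) unfolding mem_ec_points_iff y x3_def E weierstrass.sel by Groebner_Basis.algebra
    then have 2: "x1 * x2 + x1 * x3 + x2 * x3 = wa4 E - 2 * l * m - wa1 E * m - wa3 E * l"
      using False by simp
    have 3: "x1 * x2 * x3 = m ^ 2 + wa3 E * m - wa6 E"
      using assms(1) 1 2 unfolding mem_ec_points_iff y E weierstrass.sel by Groebner_Basis.algebra
    show ?thesis using that 1 2 3 y unfolding on_line_def by blast
  next
    case True
    have s: "y1 + y2 + wa1 E * x1 + wa3 E \<noteq> 0"
      using nz True by auto
    then have yy: "y2 = y1" using ec_points_same_x[of x1 y1 E y2] assms True by auto
    let ?d = "2 * y1 + wa1 E * x1 + wa3 E"
    have d: "?d \<noteq> 0" using s yy by simp
    define l where "l = (3 * x1 ^ 2 + 2 * wa2 E * x1 + wa4 E - wa1 E * y1) / ?d"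
    define m where "m = y1 - l * x1"
    define x3 where "x3 = l ^ 2 + wa1 E * l - wa2 E - x1 - x2"
    have l: "l * ?d = 3 * x1 ^ 2 + 2 * wa2 E * x1 + wa4 E - wa1 E * y1"
      using d by (simp add: l_def)
    have y: "y1 = l * x1 + m" by (simp add: m_def)
    have 1: "x1 + x2 + x3 = l ^ 2 + wa1 E * l - wa2 E" by (simp add: x3_def)
    have 2: "x1 * x2 + x1 * x3 + x2 * x3 = wa4 E - 2 * l * m - wa1 E * m - wa3 E * l"
      using l True unfolding y x3_def E weierstrass.sel by Groebner_Basis.algebra
    have 3: "x1 * x2 * x3 = m ^ 2 + wa3 E * m - wa6 E"
      using assms(1) 1 2 True unfolding mem_ec_points_iff y E weierstrass.sel by Groebner_Basis.algebra
    show ?thesis using that 1 2 3 y yy True unfolding on_line_def by blast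
  qed
qed

lemma ec_add_commute:
  "P \<in> ec_points E \<Longrightarrow> Q \<in> ec_points E \<Longrightarrow> elliptic_curve E \<Longrightarrow> ec_add E P Q = ec_add E Q P"
proof -
  assume a: "P \<in> ec_points E" "Q \<in> ec_points E" "elliptic_curve E"
  show ?thesis
  proof (cases "P = Infty \<or> Q = Infty")
    case True then show ?thesis by auto
  next
    case False
    then obtain x1 y1 x2 y2 where PQ: "P = Affine x1 y1" "Q = Affine x2 y2"
      by (meson ec_point.exhaust)
    show ?thesis
    proof (cases "ec_add E P Q = Infty")
      case True
      then have "x1 = x2 \<and> y1 + y2 + wa1 E * x2 + wa3 E = 0"
        by (auto simp: PQ Let_def split: if_splits)
      then show ?thesis by (auto simp: PQ add.commute)
    next
      case False
      then have mem: "Affine x1 y1 \<in> ec_points E" "Affine x2 y2 \<in> ec_points E"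
        "ec_add E (Affine x1 y1) (Affine x2 y2) \<noteq> Infty"
        using a PQ by blast+
      obtain l m x3 where L: "on_line E l m x1 x2 x3" "y1 = l * x1 + m" "y2 = l * x2 + m"
        by (rule ec_add_line_exists[OF mem])
      show ?thesis
        unfolding PQ L(2,3)
        using ec_add_on_line[OF a(3) L(1)] ec_add_on_line[OF a(3) on_line_perm(1)[OF L(1)]] by simp
    qed
  qed
qed

lemma ec_add_eq_Infty_iff:
  assumes "elliptic_curve E" "P \<in> ec_points E" "Q \<in> ec_points E"
  shows "ec_add E P Q = Infty \<longleftrightarrow> Q = ec_neg E P"
proof (cases "P = Infty \<or> Q = Infty")
  case True then show ?thesis by (cases P; cases Q) auto
next
  case False
  then obtain x1 y1 x2 y2 where PQ: "P = Affine x1 y1" "Q = Affine x2 y2"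
    by (meson ec_point.exhaust)
  have "y1 + y2 + wa1 E * x2 + wa3 E = y2 - (- y1 - wa1 E * x2 - wa3 E)"
    by simp
  then have "y1 + y2 + wa1 E * x2 + wa3 E = 0 \<longleftrightarrow> y2 = - y1 - wa1 E * x2 - wa3 E"
    by (simp only: right_minus_eq)
  then show ?thesis by (auto simp: PQ Let_def)
qed

lemma ec_add_closed:
  assumes "elliptic_curve E" "P \<in> ec_points E" "Q \<in> ec_points E"
  shows "ec_add E P Q \<in> ec_points E"
proof (cases "P = Infty \<or> Q = Infty \<or> ec_add E P Q = Infty")
  case True then show ?thesis using assms by auto
next
  case False
  then obtain x1 y1 x2 y2 where PQ: "P = Affine x1 y1" "Q = Affine x2 y2"
    by (meson ec_point.exhaust)
  then have mem: "Affine x1 y1 \<in> ec_points E" "Affine x2 y2 \<in> ec_points E"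
    "ec_add E (Affine x1 y1) (Affine x2 y2) \<noteq> Infty"
    using assms False by blast+
  obtain l m x3 where L: "on_line E l m x1 x2 x3" "y1 = l * x1 + m" "y2 = l * x2 + m"
    by (rule ec_add_line_exists[OF mem])
  show ?thesis
    unfolding PQ L(2,3) ec_add_on_line[OF assms(1) L(1)]
    by (rule ec_neg_closed[OF on_line_point[OF on_line_perm(2)[OF L(1)]]])
qed

lemma ec_neg_add:
  assumes "elliptic_curve E" "P \<in> ec_points E" "Q \<in> ec_points E"
  shows "ec_neg E (ec_add E P Q) = ec_add E (ec_neg E P) (ec_neg E Q)"
proof (cases "P = Infty \<or> Q = Infty \<or> ec_add E P Q = Infty")
  case True 
  then show ?thesis using assms
    using ec_add_eq_Infty_iff[OF assms] ec_add_neg[of E "ec_neg E P"] by auto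
next
  case False
  then obtain x1 y1 x2 y2 where PQ: "P = Affine x1 y1" "Q = Affine x2 y2"
    by (meson ec_point.exhaust)
  then have mem: "Affine x1 y1 \<in> ec_points E" "Affine x2 y2 \<in> ec_points E"
    "ec_add E (Affine x1 y1) (Affine x2 y2) \<noteq> Infty"
    using assms False by blast+
  obtain l m x3 where L: "on_line E l m x1 x2 x3" "y1 = l * x1 + m" "y2 = l * x2 + m"
    by (rule ec_add_line_exists[OF mem])
  let ?l = "- l - wa1 E" and ?m = "- m - wa3 E"
  have L': "on_line E ?l ?m x1 x2 x3"
    using L(1) unfolding on_line_def by (simp add: algebra_simps power2_eq_square)
  have n: "ec_neg E (Affine x (l * x + m)) = Affine x (?l * x + ?m)" for x
    by (simp add: algebra_simps)
  show ?thesis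
    using ec_add_on_line[OF assms(1) L(1)] ec_add_on_line[OF assms(1) L']
    unfolding PQ L(2,3) n by (simp add: algebra_simps)
qed

text \<open>For collinear \<open>P\<close>, \<open>Q\<close>, \<open>R\<close> the law says
  \<open>P + Q = - R\<close> and \<open>R + Q = - P\<close>, so this case of associativity is a
  permutation of three points on a line. It yields cancellation before associativity is
  known.\<close>

lemma ec_add_diff_cancel:
  assumes "elliptic_curve E" "P \<in> ec_points E" "Q \<in> ec_points E"
  shows "ec_add E (ec_add E P Q) (ec_neg E Q) = P"
proof (cases "P = Infty \<or> Q = Infty \<or> ec_add E P Q = Infty")
  case True then show ?thesis using assms
    using ec_add_eq_Infty_iff[OF assms] by auto
next
  case False
  then obtain x1 y1 x2 y2 where PQ: "P = Affine x1 y1" "Q = Affine x2 y2"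
    by (meson ec_point.exhaust)
  then have mem: "Affine x1 y1 \<in> ec_points E" "Affine x2 y2 \<in> ec_points E"
    "ec_add E (Affine x1 y1) (Affine x2 y2) \<noteq> Infty"
    using assms False by blast+
  obtain l m x3 where L: "on_line E l m x1 x2 x3" "y1 = l * x1 + m" "y2 = l * x2 + m"
    by (rule ec_add_line_exists[OF mem])
  let ?R = "Affine x3 (l * x3 + m)"
  have S: "ec_add E P Q = ec_neg E ?R" using ec_add_on_line[OF assms(1) L(1)] PQ L by simp
  have R: "?R \<in> ec_points E" using on_line_point on_line_perm L by blast
  have "ec_add E ?R Q = ec_neg E P"
    using ec_add_on_line[OF assms(1) on_line_perm(2)[OF L(1)]] PQ L by simp
  then show ?thesis unfolding S
    using ec_neg_add[OF assms(1) R assms(3)] by simp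
qed

lemma ec_add_right_cancel:
  assumes "elliptic_curve E" "P \<in> ec_points E" "P' \<in> ec_points E" "Q \<in> ec_points E"
    and "ec_add E P Q = ec_add E P' Q"
  shows "P = P'"
  using ec_add_diff_cancel assms by metis

subsection \<open>Associativity\<close>

text \<open>The generic case of associativity, with the middle point \<open>P\<close> moved to the
  origin. Lines of slopes \<open>l0\<close> and \<open>l3\<close> through it meet the curve again
  over \<open>x\<close>, \<open>x'\<close> and over \<open>q\<close>, \<open>q'\<close>. With
  \<open>T\<close> over \<open>x\<close> and \<open>Q\<close> over \<open>q\<close>,
  \<open>l1\<close> is the slope from \<open>T + P\<close> to \<open>Q\<close> and \<open>l2\<close>
  the slope from \<open>T\<close> to \<open>P + Q\<close>. The key relation is
  \<open>l1 - l3 = l2 - l0 = k\<close>; both third abscissas then equal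
  \<open>k * (k + l0 + l3 + a1)\<close>.\<close>

lemma chord_assoc:
  fixes x :: "'a::field"
  assumes 1: "x + x' = l0 ^ 2 + a1 * l0 - a2" and 2: "x * x' = a4 - a3 * l0"
    and 3: "q + q' = l3 ^ 2 + a1 * l3 - a2" and 4: "q * q' = a4 - a3 * l3"
    and nz: "q \<noteq> x'" "q' \<noteq> x"
    and l1: "l1 * (q - x') = l3 * q + (l0 + a1) * x' + a3"
    and l2: "l2 * (q' - x) = - (l3 + a1) * q' - a3 - l0 * x"
  shows "l1 + l0 = l2 + l3"
    and "l1 ^ 2 + a1 * l1 - a2 - x' - q = l2 ^ 2 + a1 * l2 - a2 - x - q'"
    and "- (l1 + a1) * (l1 ^ 2 + a1 * l1 - a2 - x' - q) - (- (l0 + a1) * x' - a3 - l1 * x') - a3 =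
      - (l2 + a1) * (l2 ^ 2 + a1 * l2 - a2 - x - q') - (l0 * x - l2 * x) - a3"
proof -
  have "(q - x') * ((q' - x) * (l1 - l3 - (l2 - l0))) = 0"
    using 1 2 3 4 l1 l2 by Groebner_Basis.algebra
  then have "l1 - l3 - (l2 - l0) = 0" using nz by (metis mult_eq_0_iff right_minus_eq)
  then show cc: "l1 + l0 = l2 + l3" by Groebner_Basis.algebra
  define k where "k = l1 - l3"
  have k: "l1 = k + l3" "l2 = k + l0" using cc by (auto simp: k_def algebra_simps)
  have kq: "k * (q - x') = (l0 + l3 + a1) * x' + a3" using l1 unfolding k by Groebner_Basis.algebra
  have "(q - x') * (k * (l3 - l0) - (x' - q')) = 0"
    using 1 2 3 4 kq by Groebner_Basis.algebra
  then have kl: "k * (l3 - l0) = x' - q'" using nz by simp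
  have X1: "l1 ^ 2 + a1 * l1 - a2 - x' - q = k * (k + l0 + l3 + a1)"
    using 1 2 3 4 kl unfolding k by Groebner_Basis.algebra
  have X2: "l2 ^ 2 + a1 * l2 - a2 - x - q' = k * (k + l0 + l3 + a1)"
    using 1 2 3 4 kl unfolding k by Groebner_Basis.algebra
  show "l1 ^ 2 + a1 * l1 - a2 - x' - q = l2 ^ 2 + a1 * l2 - a2 - x - q'"
    unfolding X1 X2 ..
  show "- (l1 + a1) * (l1 ^ 2 + a1 * l1 - a2 - x' - q) - (- (l0 + a1) * x' - a3 - l1 * x') - a3 =
      - (l2 + a1) * (l2 ^ 2 + a1 * l2 - a2 - x - q') - (l0 * x - l2 * x) - a3"
    unfolding X1 X2 unfolding k using 1 2 3 4 kq kl by Groebner_Basis.algebra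
qed

lemma ec_add_chord:
  assumes "x1 \<noteq> x2" "l * (x2 - x1) = y2 - y1" "x3 = l ^ 2 + wa1 E * l - wa2 E - x1 - x2"
  shows "ec_add E (Affine x1 y1) (Affine x2 y2) = Affine x3 (- (l + wa1 E) * x3 - (y1 - l * x1) - wa3 E)"
proof -
  have l: "(y2 - y1) / (x2 - x1) = l" using assms by (auto simp: field_simps)
  have n: "\<not> (x1 = x2 \<and> y1 + y2 + wa1 E * x2 + wa3 E = 0)" using assms by simp
  show ?thesis
    unfolding ec_add.simps if_not_P[OF n] if_not_P[OF assms(1)] l Let_def assms(3)
    by (rule refl)
qed

text \<open>The coefficients on the right belong to the equation translated by
  \<open>(x0, y0)\<close>. Splitting the known root \<open>x0\<close> off Vieta's cubic leaves the
  quadratic relations that \<open>chord_assoc\<close> takes.\<close>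

lemma line_through_point:
  assumes "on_line E l m x0 x x'" "y0 = l * x0 + m"
  shows "(x - x0) + (x' - x0) = l ^ 2 + wa1 E * l - (wa2 E + 3 * x0)"
    and "(x - x0) * (x' - x0) =
      wa4 E + 2 * x0 * wa2 E - y0 * wa1 E + 3 * x0 ^ 2 - (wa3 E + x0 * wa1 E + 2 * y0) * l"
proof -
  obtain a1 a2 a3 a4 a6 where E: "E = Weierstrass a1 a2 a3 a4 a6" by (cases E)
  show "(x - x0) + (x' - x0) = l ^ 2 + wa1 E * l - (wa2 E + 3 * x0)"
    using on_lineD[OF assms(1)] unfolding E weierstrass.sel by Groebner_Basis.algebra
  show "(x - x0) * (x' - x0) =
      wa4 E + 2 * x0 * wa2 E - y0 * wa1 E + 3 * x0 ^ 2 - (wa3 E + x0 * wa1 E + 2 * y0) * l"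
    using on_lineD[OF assms(1)] assms(2) unfolding E weierstrass.sel by Groebner_Basis.algebra
qed

lemma ec_add_assoc_generic:
  assumes E: "elliptic_curve E" and L0: "on_line E l0 m0 x0 x x'" and L3: "on_line E l3 m3 x0 q q'"
    and y0: "l0 * x0 + m0 = l3 * x0 + m3" and nz: "q \<noteq> x'" "q' \<noteq> x"
  shows "ec_add E (ec_neg E (Affine x' (l0 * x' + m0))) (Affine q (l3 * q + m3)) =
         ec_add E (Affine x (l0 * x + m0)) (ec_neg E (Affine q' (l3 * q' + m3)))"
proof -
  obtain a1 a2 a3 a4 a6 where W: "E = Weierstrass a1 a2 a3 a4 a6" by (cases E)
  define y0 where "y0 = l0 * x0 + m0"
  have m: "m0 = y0 - l0 * x0" "m3 = y0 - l3 * x0" using y0 by (auto simp: y0_def algebra_simps)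
  define y' where "y' = - (l0 * x' + m0) - a1 * x' - a3"
  define r' where "r' = - (l3 * q' + m3) - a1 * q' - a3"
  define l1 where "l1 = (l3 * q + m3 - y') / (q - x')"
  define l2 where "l2 = (r' - (l0 * x + m0)) / (q' - x)"
  have l1: "l1 * (q - x') = l3 * q + m3 - y'" and l2: "l2 * (q' - x) = r' - (l0 * x + m0)"
    using nz by (simp_all add: l1_def l2_def)
  note L = line_through_point[OF L0 y0_def] line_through_point[OF L3 y0_def[unfolded y0]]
  have s1: "l1 * ((q - x0) - (x' - x0)) =
      l3 * (q - x0) + (l0 + a1) * (x' - x0) + (a3 + x0 * a1 + 2 * y0)"
    using l1 unfolding y'_def m by Groebner_Basis.algebra
  have s2: "l2 * ((q' - x0) - (x - x0)) =
      - (l3 + a1) * (q' - x0) - (a3 + x0 * a1 + 2 * y0) - l0 * (x - x0)"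
    using l2 unfolding r'_def m by Groebner_Basis.algebra
  have nz': "q - x0 \<noteq> x' - x0" "q' - x0 \<noteq> x - x0" using nz by auto
  note C = chord_assoc[OF L[unfolded W weierstrass.sel] nz' s1 s2]
  define u where "u = l1 ^ 2 + a1 * l1 - a2 - x' - q"
  have X1: "l1 ^ 2 + a1 * l1 - (a2 + 3 * x0) - (x' - x0) - (q - x0) = u - x0"
    unfolding u_def by Groebner_Basis.algebra
  have X2: "l2 ^ 2 + a1 * l2 - (a2 + 3 * x0) - (x - x0) - (q' - x0) = u - x0"
    using C(2) unfolding X1 by simp
  have u: "u = l2 ^ 2 + a1 * l2 - a2 - x - q'"
    using X2 by Groebner_Basis.algebra
  have A1: "ec_add E (Affine x' y') (Affine q (l3 * q + m3)) =
      Affine u (- (l1 + a1) * u - (y' - l1 * x') - a3)"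
    using ec_add_chord[of x' q l1 "l3 * q + m3" y' u E] nz l1 by (simp add: W u_def)
  have A2: "ec_add E (Affine x (l0 * x + m0)) (Affine q' r') =
      Affine u (- (l2 + a1) * u - (l0 * x + m0 - l2 * x) - a3)"
    using ec_add_chord[of x q' l2 r' "l0 * x + m0" u E] nz l2 by (simp add: W u)
  have "- (l1 + a1) * (u - x0) - (- (l0 + a1) * (x' - x0) - (a3 + x0 * a1 + 2 * y0) - l1 * (x' - x0)) =
      - (l2 + a1) * (u - x0) - (l0 * (x - x0) - l2 * (x - x0))"
    using C(3) unfolding X1 X2 by Groebner_Basis.algebra
  then have "- (l1 + a1) * u - (y' - l1 * x') - a3 = - (l2 + a1) * u - (l0 * x + m0 - l2 * x) - a3"
    unfolding y'_def m by Groebner_Basis.algebra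
  then show ?thesis using A1 A2 by (simp add: W y'_def r'_def)
qed

lemma ec_points_same_x_cases:
  assumes "Affine x y \<in> ec_points E" "Affine x y' \<in> ec_points E"
  shows "Affine x y' = Affine x y \<or> Affine x y' = ec_neg E (Affine x y)"
proof -
  have "y + y' + wa1 E * x + wa3 E = y' - (- y - wa1 E * x - wa3 E)" by simp
  then show ?thesis using ec_points_same_x[OF assms] by (metis ec_neg.simps(2) right_minus_eq)
qed

lemma finite_ec_add_fibre:
  assumes "elliptic_curve E" "P \<in> ec_points E"
  shows "finite {T \<in> ec_points E. ec_add E T P = S}"
proof (rule finite_subset)
  show "{T \<in> ec_points E. ec_add E T P = S} \<subseteq> {ec_add E S (ec_neg E P)}"
    by (auto simp: ec_add_diff_cancel[OF assms(1) _ assms(2)])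
qed simp

text \<open>The chord computation applies to \<open>T\<close> as soon as \<open>T\<close> and
  \<open>T + P\<close> are affine, \<open>x(T + P)\<close> differs from \<open>x(Q)\<close> and
  \<open>x(T)\<close> from \<open>x(P + Q)\<close>. Each condition excludes finitely many
  \<open>T\<close>, since adding \<open>P\<close> has fibres of at most one element.\<close>

lemma finite_ec_add_assoc_exceptions:
  assumes E: "elliptic_curve E" and P: "P \<in> ec_points E" and Q: "Q \<in> ec_points E"
  shows "finite {T \<in> ec_points E. ec_add E (ec_add E T P) Q \<noteq> ec_add E T (ec_add E P Q)}"
    (is "finite ?B")
proof (cases "P = Infty \<or> Q = Infty \<or> ec_add E P Q = Infty")
  case True
  then consider "P = Infty" | "Q = Infty" | "Q = ec_neg E P"
    using ec_add_eq_Infty_iff assms by blast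
  then have "?B = {}"
  proof cases
    case 3
    then show ?thesis using ec_add_diff_cancel E P by auto
  qed auto
  then show ?thesis by (metis (no_types, lifting) finite.emptyI)
next
  case False
  then obtain x0 y0 q r where PQ: "P = Affine x0 y0" "Q = Affine q r"
    by (meson ec_point.exhaust)
  then have mem: "Affine x0 y0 \<in> ec_points E" "Affine q r \<in> ec_points E"
    "ec_add E (Affine x0 y0) (Affine q r) \<noteq> Infty"
    using assms False by blast+
  obtain l3 m3 q' where L3: "on_line E l3 m3 x0 q q'" "y0 = l3 * x0 + m3" "r = l3 * q + m3"
    by (rule ec_add_line_exists[OF mem])
  have S: "ec_add E P Q = ec_neg E (Affine q' (l3 * q' + m3))"
    unfolding PQ L3(2,3) by (rule ec_add_on_line[OF E L3(1)])
  let ?F = "{Infty, P, ec_neg E P, ec_add E P Q, ec_neg E (ec_add E P Q)} \<union>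
    {T \<in> ec_points E. ec_add E T P = Infty} \<union> {T \<in> ec_points E. ec_add E T P = Q} \<union>
    {T \<in> ec_points E. ec_add E T P = ec_neg E Q}"
  have "?B \<subseteq> ?F"
  proof
    fix T assume T: "T \<in> ?B"
    show "T \<in> ?F"
    proof (rule ccontr)
      assume nT: "T \<notin> ?F"
      have TE: "T \<in> ec_points E" using T by simp
      obtain x y where Txy: "T = Affine x y" using nT by (cases T) auto
      have mem': "Affine x0 y0 \<in> ec_points E" "Affine x y \<in> ec_points E"
        "ec_add E (Affine x0 y0) (Affine x y) \<noteq> Infty"
        using P TE nT ec_add_commute[OF P TE E] unfolding PQ Txy by auto
      obtain l0 m0 x' where L0: "on_line E l0 m0 x0 x x'" "y0 = l0 * x0 + m0" "y = l0 * x + m0"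
        by (rule ec_add_line_exists[OF mem'])
      have TP: "ec_add E T P = ec_neg E (Affine x' (l0 * x' + m0))"
        using ec_add_commute[OF P TE E] ec_add_on_line[OF E L0(1)] unfolding PQ Txy L0(2,3) by simp
      have TPm: "ec_neg E (Affine x' (l0 * x' + m0)) \<in> ec_points E"
        using ec_add_closed[OF E TE P] TP by simp
      have "q \<noteq> x'"
      proof
        assume qx: "q = x'"
        let ?y = "- (l0 * x' + m0) - wa1 E * x' - wa3 E"
        have "Affine q ?y \<in> ec_points E" using TPm qx by simp
        then have "Affine q ?y = Affine q r \<or> Affine q ?y = ec_neg E (Affine q r)"
          by (rule ec_points_same_x_cases[OF mem(2)])
        then have "ec_add E T P = Q \<or> ec_add E T P = ec_neg E Q"
          unfolding TP PQ(2) using qx by simp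
        then show False using nT TE by auto
      qed
      moreover have "q' \<noteq> x"
      proof
        assume qx: "q' = x"
        have "Affine q' (l3 * q' + m3) \<in> ec_points E"
          using on_line_point on_line_perm(2) L3(1) by blast
        then have "T = Affine q' (l3 * q' + m3) \<or> T = ec_neg E (Affine q' (l3 * q' + m3))"
          using ec_points_same_x_cases[of x "l3 * q' + m3" E y] TE unfolding Txy qx by simp
        then have "T = ec_add E P Q \<or> T = ec_neg E (ec_add E P Q)"
          unfolding S by (metis ec_neg_neg)
        then show False using nT by auto
      qed
      ultimately have "ec_add E (ec_add E T P) Q = ec_add E T (ec_add E P Q)"
        using ec_add_assoc_generic[OF E L0(1) L3(1)] L0(2,3) L3(2,3)
        unfolding TP S unfolding PQ(2) Txy by metis
      then show False using T by simp
    qed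
  qed
  moreover have "finite ?F"
    using finite_ec_add_fibre[OF E P] by simp
  ultimately show ?thesis by (rule finite_subset)
qed

lemma infinite_UNIV_alg_closed: "infinite (UNIV :: 'a::alg_closed_field set)"
proof
  assume fin: "finite (UNIV :: 'a set)"
  define p :: "'a poly" where "p = (\<Prod>a\<in>UNIV. [:- a, 1:]) + 1"
  have "degree (\<Prod>a\<in>UNIV. [:- a, 1::'a:]) = card (UNIV :: 'a set)"
    by (subst degree_prod_eq_sum_degree) auto
  moreover have "card (UNIV :: 'a set) > 0" using fin by (simp add: card_gt_0_iff)
  ultimately have "degree p > 0"
    unfolding p_def by (subst degree_add_eq_left) auto
  then obtain z where "poly p z = 0" using alg_closed_imp_poly_has_root by blast
  moreover have "(\<Prod>a\<in>UNIV. z - a) = 0" using fin by (auto simp: prod_zero_iff)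
  ultimately show False by (simp add: p_def poly_prod)
qed

lemma ec_point_above_exists:
  fixes E :: "'a::alg_closed_field weierstrass"
  obtains y where "Affine x y \<in> ec_points E"
proof -
  let ?p = "[: - (x ^ 3 + wa2 E * x ^ 2 + wa4 E * x + wa6 E), wa1 E * x + wa3 E, 1:]"
  have "degree ?p > 0" by simp
  then obtain y where "poly ?p y = 0" using alg_closed_imp_poly_has_root by blast
  then have "Affine x y \<in> ec_points E"
    by (simp add: mem_ec_points_iff algebra_simps power2_eq_square)
  then show ?thesis by (rule that)
qed

lemma infinite_ec_points:
  fixes E :: "'a::alg_closed_field weierstrass"
  shows "infinite (ec_points E)"
proof
  assume "finite (ec_points E)"
  then have "finite ((\<lambda>P. case P of Affine x y \<Rightarrow> x | Infty \<Rightarrow> 0) ` ec_points E)" by simp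
  moreover have "(\<lambda>P. case P of Affine x y \<Rightarrow> x | Infty \<Rightarrow> 0) ` ec_points E = UNIV"
  proof -
    have "x \<in> (\<lambda>P. case P of Affine x y \<Rightarrow> x | Infty \<Rightarrow> 0) ` ec_points E" for x
    proof -
      obtain y where "Affine x y \<in> ec_points E" by (rule ec_point_above_exists)
      then show ?thesis by force
    qed
    then show ?thesis by blast
  qed
  ultimately show False using infinite_UNIV_alg_closed by metis
qed

text \<open>For \<open>T\<close> outside the exceptional sets of \<open>(P, Q)\<close>,
  \<open>(P + Q, R)\<close> and \<open>(P, Q + R)\<close>, with \<open>T + P\<close> outside that of
  \<open>(Q, R)\<close>, four moves of brackets lead from \<open>T + ((P + Q) + R)\<close> to
  \<open>T + (P + (Q + R))\<close>, and \<open>T\<close> cancels. Such a \<open>T\<close> exists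
  because there are infinitely many points.\<close>

lemma ec_add_assoc_alg_closed:
  fixes E :: "'a::alg_closed_field weierstrass"
  assumes E: "elliptic_curve E" and P: "P \<in> ec_points E" and Q: "Q \<in> ec_points E"
    and R: "R \<in> ec_points E"
  shows "ec_add E (ec_add E P Q) R = ec_add E P (ec_add E Q R)"
proof -
  note c = ec_add_closed[OF E]
  let ?B = "\<lambda>P Q. {T \<in> ec_points E. ec_add E (ec_add E T P) Q \<noteq> ec_add E T (ec_add E P Q)}"
  let ?B' = "{T \<in> ec_points E. ec_add E T P \<in> ?B Q R}"
  have "?B' \<subseteq> (\<Union>S\<in>?B Q R. {T \<in> ec_points E. ec_add E T P = S})" by auto
  then have "finite ?B'"
    using finite_ec_add_assoc_exceptions[OF E Q R] finite_ec_add_fibre[OF E P]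
    by (meson finite_UN_I finite_subset)
  then have "finite (?B' \<union> ?B P Q \<union> ?B (ec_add E P Q) R \<union> ?B P (ec_add E Q R))"
    using finite_ec_add_assoc_exceptions[OF E] P Q R c by (intro finite_UnI) blast+
  then obtain T where T: "T \<in> ec_points E"
    and nT: "T \<notin> ?B' \<union> ?B P Q \<union> ?B (ec_add E P Q) R \<union> ?B P (ec_add E Q R)"
    using infinite_ec_points[of E] by (meson rev_finite_subset subsetI)
  have TP: "ec_add E T P \<in> ec_points E" using c T P by blast
  have "ec_add E (ec_add E T (ec_add E P Q)) R = ec_add E T (ec_add E (ec_add E P Q) R)"
    "ec_add E (ec_add E T P) Q = ec_add E T (ec_add E P Q)"
    "ec_add E (ec_add E (ec_add E T P) Q) R = ec_add E (ec_add E T P) (ec_add E Q R)"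
    "ec_add E (ec_add E T P) (ec_add E Q R) = ec_add E T (ec_add E P (ec_add E Q R))"
    using nT T TP by blast+
  then have "ec_add E T (ec_add E (ec_add E P Q) R) = ec_add E T (ec_add E P (ec_add E Q R))"
    by (simp only:)
  then show ?thesis
    using ec_add_right_cancel[OF E, of "ec_add E (ec_add E P Q) R" "ec_add E P (ec_add E Q R)" T]
      ec_add_commute E P Q R T c by metis
qed

subsection \<open>Multiples of points and the Kummer line\<close>

context field_embedding
begin

lemma emb_zero [simp]: "emb 0 = 0"
  using emb_add[of 0 0] by (metis add_0_right add_left_cancel)

lemma emb_uminus: "emb (- a) = - emb a"
  using emb_add[of a "- a"] by (simp add: eq_neg_iff_add_eq_0 add.commute)

lemma emb_diff: "emb (a - b) = emb a - emb b"
  using emb_add[of a "- b"] by (simp add: emb_uminus)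

lemma emb_eq_0_iff [simp]: "emb a = 0 \<longleftrightarrow> a = 0"
proof
  assume "emb a = 0"
  show "a = 0"
  proof (rule ccontr)
    assume "a \<noteq> 0"
    then have "emb a * emb (inverse a) = 1" by (simp flip: emb_mult add: emb_one)
    then show False using \<open>emb a = 0\<close> by simp
  qed
qed simp

lemma emb_eq_iff [simp]: "emb a = emb b \<longleftrightarrow> a = b"
  using emb_eq_0_iff[of "a - b"] by (simp add: emb_diff)

lemma inj_emb: "inj emb"
  by (rule injI) simp

lemma emb_inverse: "emb (inverse a) = inverse (emb a)"
proof (cases "a = 0")
  case False
  then have "emb a * emb (inverse a) = 1" by (simp flip: emb_mult add: emb_one)
  then show ?thesis by (metis inverse_unique)
qed simp

lemma emb_divide: "emb (a / b) = emb a / emb b"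
  by (simp add: divide_inverse emb_mult emb_inverse)

lemma emb_power: "emb (a ^ n) = emb a ^ n"
  by (induction n) (simp_all add: emb_one emb_mult)

lemma emb_of_nat: "emb (of_nat n) = of_nat n"
  by (induction n) (simp_all add: emb_one emb_add)

lemma emb_numeral: "emb (numeral n) = numeral n"
  using emb_of_nat[of "numeral n"] by simp

lemmas emb_simps = emb_one emb_add emb_mult emb_uminus emb_diff emb_inverse emb_divide emb_power
  emb_of_nat emb_numeral

lemma map_weierstrass_sel:
  "wa1 (map_weierstrass emb E) = emb (wa1 E)" "wa2 (map_weierstrass emb E) = emb (wa2 E)"
  "wa3 (map_weierstrass emb E) = emb (wa3 E)" "wa4 (map_weierstrass emb E) = emb (wa4 E)"
  "wa6 (map_weierstrass emb E) = emb (wa6 E)"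
  by (cases E; simp)+

lemma discriminant_map: "discriminant (map_weierstrass emb E) = emb (discriminant E)"
  by (simp add: discriminant_def Let_def map_weierstrass_sel emb_simps)

lemma elliptic_curve_map [simp]: "elliptic_curve (map_weierstrass emb E) \<longleftrightarrow> elliptic_curve E"
  by (simp add: elliptic_curve_def discriminant_map)

lemma map_ec_point_mem_iff:
  "map_ec_point emb P \<in> ec_points (map_weierstrass emb E) \<longleftrightarrow> P \<in> ec_points E"
proof (cases P)
  case (Affine x y)
  have "emb y ^ 2 + emb (wa1 E) * emb x * emb y + emb (wa3 E) * emb y =
      emb (y ^ 2 + wa1 E * x * y + wa3 E * y)"
    "emb x ^ 3 + emb (wa2 E) * emb x ^ 2 + emb (wa4 E) * emb x + emb (wa6 E) =
      emb (x ^ 3 + wa2 E * x ^ 2 + wa4 E * x + wa6 E)"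
    by (simp_all add: emb_simps)
  then show ?thesis
    using Affine by (simp only: ec_point.map mem_ec_points_iff map_weierstrass_sel emb_eq_iff)
qed simp

lemma map_ec_point_add:
  "map_ec_point emb (ec_add E P Q) = ec_add (map_weierstrass emb E) (map_ec_point emb P) (map_ec_point emb Q)"
proof (cases "P = Infty \<or> Q = Infty")
  case False
  then obtain x1 y1 x2 y2 where PQ: "P = Affine x1 y1" "Q = Affine x2 y2"
    by (meson ec_point.exhaust)
  have "emb y1 + emb y2 + emb (wa1 E) * emb x2 + emb (wa3 E) =
      emb (y1 + y2 + wa1 E * x2 + wa3 E)" by (simp add: emb_simps)
  then have "(emb y1 + emb y2 + emb (wa1 E) * emb x2 + emb (wa3 E) = 0) \<longleftrightarrow>
      y1 + y2 + wa1 E * x2 + wa3 E = 0" by simp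
  then show ?thesis by (simp add: PQ Let_def map_weierstrass_sel emb_simps)
qed auto

lemma inj_map_ec_point: "inj (map_ec_point emb)"
  using ec_point.inj_map[OF inj_emb] .

end

interpretation to_ac: field_embedding "to_ac :: 'a::field \<Rightarrow> 'a alg_closure"
  by standard simp_all

text \<open>A small field may have too few points to avoid the exceptions, so the identity is pulled
  back along the injective base change to the algebraic closure.\<close>

lemma ec_add_assoc:
  assumes "elliptic_curve E" "P \<in> ec_points E" "Q \<in> ec_points E" "R \<in> ec_points E"
  shows "ec_add E (ec_add E P Q) R = ec_add E P (ec_add E Q R)"
proof -
  let ?m = "map_ec_point to_ac"
  have "?m (ec_add E (ec_add E P Q) R) = ?m (ec_add E P (ec_add E Q R))"
    unfolding to_ac.map_ec_point_add
    by (rule ec_add_assoc_alg_closed) (use assms in \<open>simp_all add: to_ac.map_ec_point_mem_iff\<close>)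
  then show ?thesis by (rule injD[OF to_ac.inj_map_ec_point])
qed

section \<open>Multiples of a point\<close>

lemma ec_mult_0 [simp]: "ec_mult E 0 P = Infty"
  by (simp add: ec_mult_def)

lemma ec_mult_Suc: "ec_mult E (Suc n) P = ec_add E P (ec_mult E n P)"
  by (simp add: ec_mult_def)

lemma ec_mult_1 [simp]: "ec_mult E (Suc 0) P = P"
  by (simp add: ec_mult_Suc)

lemma ec_mult_Infty [simp]: "ec_mult E n Infty = Infty"
  by (induction n) (simp_all add: ec_mult_Suc)

context
  fixes E :: "'a::field weierstrass"
  assumes E: "elliptic_curve E"
begin

lemma ec_mult_closed: "P \<in> ec_points E \<Longrightarrow> ec_mult E n P \<in> ec_points E"
  by (induction n) (simp_all add: ec_mult_Suc ec_add_closed E)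

lemma ec_mult_add:
  assumes "P \<in> ec_points E"
  shows "ec_mult E (m + n) P = ec_add E (ec_mult E m P) (ec_mult E n P)"
  by (induction m) (simp_all add: ec_mult_Suc ec_add_assoc[OF E] ec_mult_closed assms)

lemma ec_mult_mult:
  assumes "P \<in> ec_points E"
  shows "ec_mult E (m * n) P = ec_mult E m (ec_mult E n P)"
  by (induction m) (simp_all add: ec_mult_Suc ec_mult_add assms)

lemma ec_mult_neg:
  assumes "P \<in> ec_points E"
  shows "ec_mult E n (ec_neg E P) = ec_neg E (ec_mult E n P)"
  by (induction n) (simp_all add: ec_mult_Suc ec_neg_add[OF E] ec_mult_closed assms)

lemma ec_mult_distrib:
  assumes "P \<in> ec_points E" "Q \<in> ec_points E"
  shows "ec_mult E n (ec_add E P Q) = ec_add E (ec_mult E n P) (ec_mult E n Q)"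
proof (induction n)
  case (Suc n)
  note c = ec_add_closed[OF E] ec_mult_closed
  have "ec_add E (ec_add E P Q) (ec_add E (ec_mult E n P) (ec_mult E n Q)) =
      ec_add E P (ec_add E (ec_add E Q (ec_mult E n P)) (ec_mult E n Q))"
    using assms c by (simp add: ec_add_assoc[OF E])
  also have "ec_add E Q (ec_mult E n P) = ec_add E (ec_mult E n P) Q"
    using assms c by (intro ec_add_commute E) auto
  also have "ec_add E P (ec_add E (ec_add E (ec_mult E n P) Q) (ec_mult E n Q)) =
      ec_add E (ec_add E P (ec_mult E n P)) (ec_add E Q (ec_mult E n Q))"
    using assms c by (simp add: ec_add_assoc[OF E])
  finally show ?case by (simp add: ec_mult_Suc Suc)
qed simp

end

section \<open>Addition on the Kummer line, in terms of the b-invariants of the curve\<close>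

definition wb2 :: "'a::comm_ring_1 weierstrass \<Rightarrow> 'a" where
  "wb2 E = wa1 E ^ 2 + 4 * wa2 E"
definition wb4 :: "'a::comm_ring_1 weierstrass \<Rightarrow> 'a" where
  "wb4 E = 2 * wa4 E + wa1 E * wa3 E"
definition wb6 :: "'a::comm_ring_1 weierstrass \<Rightarrow> 'a" where
  "wb6 E = wa3 E ^ 2 + 4 * wa6 E"
definition wb8 :: "'a::comm_ring_1 weierstrass \<Rightarrow> 'a" where
  "wb8 E = wa1 E ^ 2 * wa6 E + 4 * wa2 E * wa6 E - wa1 E * wa3 E * wa4 E
             + wa2 E * wa3 E ^ 2 - wa4 E ^ 2"

lemmas wb_defs = wb2_def wb4_def wb6_def wb8_def

text \<open>
  If \<open>f / g\<close> and \<open>c\<close> are the \<open>x\<close>-coordinates of two points \<open>R\<close> and \<open>Q\<close>, then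
  \<open>x(R + Q) x(R - Q)\<close> is \<open>kumA / kumC\<close> and \<open>x(R + Q) + x(R - Q)\<close> is \<open>kumB / kumC\<close>.
\<close>

definition kumA :: "'a::comm_ring_1 weierstrass \<Rightarrow> 'a \<Rightarrow> 'a \<Rightarrow> 'a \<Rightarrow> 'a" where
  "kumA E c f g = (f * c) ^ 2 - wb4 E * f * c * g - wb6 E * g * (f + c * g) - wb8 E * g ^ 2"
definition kumB :: "'a::comm_ring_1 weierstrass \<Rightarrow> 'a \<Rightarrow> 'a \<Rightarrow> 'a \<Rightarrow> 'a" where
  "kumB E c f g = 2 * f * c * (f + c * g) + wb2 E * f * c * g + wb4 E * g * (f + c * g) + wb6 E * g ^ 2"
definition kumC :: "'a::comm_ring_1 \<Rightarrow> 'a \<Rightarrow> 'a \<Rightarrow> 'a" where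
  "kumC c f g = (f - c * g) ^ 2"

lemmas kum_defs = kumA_def kumB_def kumC_def

text \<open>\<open>f\<close> and \<open>g\<close> are homogeneous coordinates of the image of the
  point on the x-line, with infinity at \<open>(1 : 0)\<close>. Fixing them only up to a common
  factor lets polynomial pairs be specialised even where a multiple of the point becomes
  infinite.\<close>

fun has_x :: "'a::field ec_point \<Rightarrow> 'a \<Rightarrow> 'a \<Rightarrow> bool" where
  "has_x Infty f g \<longleftrightarrow> f \<noteq> 0 \<and> g = 0"
| "has_x (Affine x y) f g \<longleftrightarrow> g \<noteq> 0 \<and> f = x * g"

lemma has_x_nonzero: "has_x P f g \<Longrightarrow> f \<noteq> 0 \<or> g \<noteq> 0"
  by (cases P) auto

lemma has_x_Infty_iff: "has_x P f g \<Longrightarrow> g = 0 \<longleftrightarrow> P = Infty"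
  by (cases P) auto

lemma has_x_neg [simp]: "has_x (ec_neg E P) f g \<longleftrightarrow> has_x P f g"
  by (cases P) auto

lemma chord_sum:
  assumes "Affine x y \<in> ec_points E" "Affine c d \<in> ec_points E" and ne: "x \<noteq> c"
    and 1: "ec_add E (Affine x y) (Affine c d) = Affine x3 y3"
    and 2: "ec_add E (Affine x y) (ec_neg E (Affine c d)) = Affine x4 y4"
  shows "(x3 + x4) * (x - c) ^ 2 = kumB E c x 1"
proof -
  obtain a1 a2 a3 a4 a6 where W: "E = Weierstrass a1 a2 a3 a4 a6" by (cases E)
  define l where "l = (d - y) / (c - x)"
  define l' where "l' = (- d - a1 * c - a3 - y) / (c - x)"
  have l: "l * (c - x) = d - y" "l' * (c - x) = - d - a1 * c - a3 - y"
    using ne by (simp_all add: l_def l'_def)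
  have x3: "x3 = l ^ 2 + a1 * l - a2 - x - c"
    using ec_add_chord[of x c l d y _ E] ne l 1 by (simp add: W)
  have x4: "x4 = l' ^ 2 + a1 * l' - a2 - x - c"
    using ec_add_chord[of x c l' "- d - a1 * c - a3" y _ E] ne l 2 by (simp add: W)
  show ?thesis
    using assms(1,2) l
    unfolding x3 x4 kumB_def wb_defs W mem_ec_points_iff weierstrass.sel mult_1_right mult_1_left power_one
    by Groebner_Basis.algebra
qed

lemma tangent_square:
  assumes "Affine c d \<in> ec_points E"
  shows "kumB E c c 1 = (2 * d + wa1 E * c + wa3 E) ^ 2"
proof -
  obtain a1 a2 a3 a4 a6 where W: "E = Weierstrass a1 a2 a3 a4 a6" by (cases E)
  have a6: "a6 = d ^ 2 + a1 * c * d + a3 * d - c ^ 3 - a2 * c ^ 2 - a4 * c"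
    using assms unfolding mem_ec_points_iff W weierstrass.sel by (simp add: algebra_simps)
  show ?thesis unfolding kum_defs wb_defs W weierstrass.sel a6
    by (simp add: algebra_simps eval_nat_numeral)
qed

lemma tangent_num:
  assumes "Affine c d \<in> ec_points E"
  shows "kumA E c c 1 = (3 * c ^ 2 + 2 * wa2 E * c + wa4 E - wa1 E * d) ^ 2
    + wa1 E * (3 * c ^ 2 + 2 * wa2 E * c + wa4 E - wa1 E * d) * (2 * d + wa1 E * c + wa3 E)
    - (wa2 E + 2 * c) * (2 * d + wa1 E * c + wa3 E) ^ 2"
proof -
  obtain a1 a2 a3 a4 a6 where W: "E = Weierstrass a1 a2 a3 a4 a6" by (cases E)
  have a6: "a6 = d ^ 2 + a1 * c * d + a3 * d - c ^ 3 - a2 * c ^ 2 - a4 * c"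
    using assms unfolding mem_ec_points_iff W weierstrass.sel by (simp add: algebra_simps)
  show ?thesis unfolding kum_defs wb_defs W weierstrass.sel a6
    by (simp add: algebra_simps eval_nat_numeral)
qed

text \<open>The diagonal values are the duplication formula,
  \<open>c^4 - b4 c^2 - 2 b6 c - b8\<close> over \<open>4 c^3 + b2 c^2 + 2 b4 c + b6\<close>. The
  denominator is the square of the y-derivative; where it vanishes the numerator is the square of
  the x-derivative, nonzero by nonsingularity.\<close>

lemma has_x_double:
  assumes E: "elliptic_curve E" and Q: "Affine c d \<in> ec_points E"
  shows "has_x (ec_add E (Affine c d) (Affine c d)) (kumA E c c 1) (kumB E c c 1)"
proof -
  let ?D = "2 * d + wa1 E * c + wa3 E" and ?n = "3 * c ^ 2 + 2 * wa2 E * c + wa4 E - wa1 E * d"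
  show ?thesis
  proof (cases "?D = 0")
    case True
    then have "d + d + wa1 E * c + wa3 E = 0" unfolding mult_2 .
    then have "ec_add E (Affine c d) (Affine c d) = Infty" by simp
    then show ?thesis
      using nonsingular[OF E Q True] unfolding tangent_num[OF Q] tangent_square[OF Q] True by simp
  next
    case False
    have n: "\<not> (c = c \<and> d + d + wa1 E * c + wa3 E = 0)" using False unfolding mult_2 by blast
    define l where "l = ?n / ?D"
    have l: "l * ?D = ?n" using False by (simp add: l_def)
    obtain y where y: "ec_add E (Affine c d) (Affine c d) = Affine (l ^ 2 + wa1 E * l - wa2 E - c - c) y"
      unfolding ec_add.simps if_not_P[OF n] if_P[OF refl] Let_def l_def by blast
    have "kumA E c c 1 = (l ^ 2 + wa1 E * l - wa2 E - c - c) * ?D ^ 2"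
      unfolding tangent_num[OF Q] l[symmetric] by (simp add: algebra_simps power2_eq_square)
    then show ?thesis unfolding y using False tangent_square[OF Q] by simp
  qed
qed

lemma kum_scale:
  "kumA E c (x * g) g = g ^ 2 * kumA E c x 1"
  "kumB E c (x * g) g = g ^ 2 * kumB E c x 1"
  "kumC c (x * g) g = g ^ 2 * kumC c x 1"
  by (simp_all add: kum_defs algebra_simps power2_eq_square)

text \<open>The pair representing \<open>x(R + Q)\<close> is determined by the ones of \<open>R - Q\<close>, \<open>R\<close> and \<open>Q\<close>.\<close>

lemma has_x_step:
  assumes E: "elliptic_curve E" and R: "R \<in> ec_points E" and Q: "Affine c d \<in> ec_points E"
    and R1: "has_x (ec_add E R (ec_neg E (Affine c d))) f1 g1" and R0: "has_x R f g"
    and A: "f1 * f2 = kumA E c f g" and B: "f1 * g2 + f2 * g1 = kumB E c f g"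
    and C: "g1 * g2 = kumC c f g"
  shows "has_x (ec_add E R (Affine c d)) f2 g2"
proof (cases R)
  case Infty
  then have g: "g = 0" "f \<noteq> 0" using R0 by auto
  have R1: "g1 \<noteq> 0" "f1 = c * g1" using R1 Infty by auto
  have g1: "g1 * g2 = f ^ 2" using C g by (simp add: kumC_def)
  then have "g2 \<noteq> 0" using g by auto
  moreover have "kumB E c f g = 2 * f ^ 2 * c"
    by (simp add: kumB_def g power2_eq_square)
  then have "f2 * g1 = c * g2 * g1"
    using B g1 unfolding R1(2) by Groebner_Basis.algebra
  ultimately show ?thesis using Infty R1(1) by simp
next
  case (Affine x y)
  have g: "g \<noteq> 0" "f = x * g" using R0 Affine by auto
  have Rm: "Affine x y \<in> ec_points E" using R Affine by simp
  let ?Q = "Affine c d"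
  show ?thesis
  proof (cases "x = c")
    case False
    then have "ec_add E R ?Q \<noteq> Infty" "ec_add E R (ec_neg E ?Q) \<noteq> Infty"
      by (auto simp: Affine Let_def)
    then obtain x3 y3 x4 y4 where S: "ec_add E R ?Q = Affine x3 y3"
      "ec_add E R (ec_neg E ?Q) = Affine x4 y4" by (meson ec_point.exhaust)
    have s: "(x3 + x4) * (x - c) ^ 2 = kumB E c x 1"
      using chord_sum[OF Rm Q False] S Affine by simp
    have f1: "g1 \<noteq> 0" "f1 = x4 * g1" using R1 S by auto
    have C': "g1 * g2 = g ^ 2 * (x - c) ^ 2"
      using C unfolding g kum_scale by (simp add: kumC_def)
    then have "g2 \<noteq> 0" using g False by auto
    moreover have "f2 * g1 = x3 * g2 * g1"
      using B C' s unfolding f1 g(2) kum_scale by Groebner_Basis.algebra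
    ultimately show ?thesis using S f1 by simp
  next
    case True
    have C': "g1 * g2 = 0" using C True by (simp add: g kumC_def)
    note A' = A[unfolded g(2) kum_scale True] and B' = B[unfolded g(2) kum_scale True]
    note D = has_x_double[OF E Q]
    have "R = ?Q \<or> R = ec_neg E ?Q"
      using ec_points_same_x_cases[OF Q] Rm unfolding Affine True by blast
    then show ?thesis
    proof
      \<comment> \<open>Here \<open>R - Q\<close> is infinite, so \<open>g1 = 0\<close>; the product
        and sum relations then make \<open>(f2, g2)\<close> proportional to the duplication
        pair.\<close>
      assume RQ: "R = ?Q"
      have f1: "f1 \<noteq> 0" "g1 = 0" using R1 unfolding RQ ec_add_neg by simp_all
      have "g ^ 2 / f1 \<noteq> 0" using g f1 by simp
      moreover have "f2 = g ^ 2 / f1 * kumA E c c 1" "g2 = g ^ 2 / f1 * kumB E c c 1"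
        using A' B' f1 by (simp_all add: field_simps)
      moreover have "has_x P (k * a) (k * b)" if "has_x P a b" "k \<noteq> 0" for P and k a b :: 'a
        using that by (cases P) auto
      ultimately show ?thesis using D unfolding RQ by metis
    next
      assume RQ: "R = ec_neg E ?Q"
      have "ec_add E R ?Q = Infty"
        using ec_add_neg[of E R] unfolding RQ ec_neg_neg .
      moreover have "has_x (ec_add E ?Q ?Q) f1 g1"
        using R1 ec_neg_add[OF E Q Q] has_x_neg unfolding RQ by metis
      \<comment> \<open>Now \<open>R + Q\<close> is infinite while \<open>(f1, g1)\<close>
        represents \<open>2 Q\<close>. If \<open>2 Q\<close> is infinite, \<open>g1 = 0\<close>, the
        sum relation gives \<open>g2 = 0\<close> and the product relation
        \<open>f2 \<noteq> 0\<close>; otherwise \<open>C\<close> gives \<open>g2 = 0\<close> and the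
        sum relation \<open>f2 \<noteq> 0\<close>.\<close>
      moreover have "g2 = 0 \<and> f2 \<noteq> 0"
      proof (cases "kumB E c c 1 = 0")
        case True
        then have d: "kumA E c c 1 \<noteq> 0" "ec_add E ?Q ?Q = Infty" using D by (metis has_x.simps(1) has_x_Infty_iff)+
        then have f1: "f1 \<noteq> 0" "g1 = 0" using \<open>has_x (ec_add E ?Q ?Q) f1 g1\<close> by (metis has_x.simps(1))+
        then show ?thesis using A' B' True d g by auto
      next
        case False
        then have "g1 \<noteq> 0" using D \<open>has_x (ec_add E ?Q ?Q) f1 g1\<close> has_x_Infty_iff by metis
        then show ?thesis using B' C' False g by auto
      qed
      ultimately show ?thesis by simp
    qed
  qed
qed

lemma chord_prod:
  assumes "Affine x y \<in> ec_points E" "Affine c d \<in> ec_points E" and ne: "x \<noteq> c"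
    and 1: "ec_add E (Affine x y) (Affine c d) = Affine x3 y3"
    and 2: "ec_add E (Affine x y) (ec_neg E (Affine c d)) = Affine x4 y4"
  shows "x3 * x4 * (x - c) ^ 2 = kumA E c x 1"
proof -
  obtain a1 a2 a3 a4 a6 where W: "E = Weierstrass a1 a2 a3 a4 a6" by (cases E)
  define l where "l = (d - y) / (c - x)"
  define l' where "l' = (- d - a1 * c - a3 - y) / (c - x)"
  have l: "l * (c - x) = d - y" "l' * (c - x) = - d - a1 * c - a3 - y"
    using ne by (simp_all add: l_def l'_def)
  have x3: "x3 = l ^ 2 + a1 * l - a2 - x - c"
    using ec_add_chord[of x c l d y _ E] ne l 1 by (simp add: W)
  have x4: "x4 = l' ^ 2 + a1 * l' - a2 - x - c"
    using ec_add_chord[of x c l' "- d - a1 * c - a3" y _ E] ne l 2 by (simp add: W)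
  \<comment> \<open>In terms of \<open>x\<close>, \<open>y\<close>, the step \<open>u\<close> and
    the two slopes, the conditions can be solved for \<open>a3\<close>, \<open>a6\<close> and, after
    cancelling \<open>u\<close>, for \<open>a4\<close>. Substituting turns the claim into an
    identity in free variables.\<close>
  define u where "u = c - x"
  have c: "c = x + u" by (simp add: u_def)
  have d: "d = y + l * u" "l' * u = - d - a1 * c - a3 - y" using l by (simp_all add: u_def algebra_simps)
  have u: "u \<noteq> 0" using ne by (simp add: u_def)
  have a3: "a3 = - (l + l') * u - 2 * y - a1 * (x + u)"
    using d unfolding c by Groebner_Basis.algebra
  have a6: "a6 = y ^ 2 + a1 * x * y + a3 * y - x ^ 3 - a2 * x ^ 2 - a4 * x"
    using assms(1) unfolding mem_ec_points_iff W weierstrass.sel by (simp add: algebra_simps)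
  have "d ^ 2 + a1 * c * d + a3 * d - (y ^ 2 + a1 * x * y + a3 * y) =
      c ^ 3 + a2 * c ^ 2 + a4 * c - (x ^ 3 + a2 * x ^ 2 + a4 * x)"
    using assms(1,2) unfolding mem_ec_points_iff W weierstrass.sel by (simp add: algebra_simps)
  then have "u * a4 = u * (l * (2 * y + a3 + a1 * (x + u)) + l ^ 2 * u + a1 * y
      - 3 * x ^ 2 - 3 * x * u - u ^ 2 - a2 * (2 * x + u))"
    unfolding c d(1) by Groebner_Basis.algebra
  then have a4: "a4 = l * (2 * y + a3 + a1 * (x + u)) + l ^ 2 * u + a1 * y
      - 3 * x ^ 2 - 3 * x * u - u ^ 2 - a2 * (2 * x + u)"
    using u by simp
  show ?thesis
    unfolding x3 x4 kumA_def wb_defs W weierstrass.sel a6 a4 a3 c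
    by (simp add: algebra_simps eval_nat_numeral)
qed


subsection \<open>Polynomials over a field\<close>

lemma bezout_poly:
  fixes p q :: "'a::field poly"
  shows "\<exists>d u v. d dvd p \<and> d dvd q \<and> d = u * p + v * q"
proof (induction "if q = 0 then 0 else Suc (degree q)" arbitrary: p q rule: less_induct)
  case less
  show ?case
  proof (cases "q = 0")
    case True
    then show ?thesis by (intro exI[of _ p] exI[of _ 1] exI[of _ 0]) simp
  next
    case False
    have "p mod q = 0 \<or> degree (p mod q) < degree q" using False degree_mod_less' by blast
    then have "(if p mod q = 0 then 0 else Suc (degree (p mod q))) < (if q = 0 then 0 else Suc (degree q))"
      using False by auto
    from less[OF this] obtain d u v where d: "d dvd q" "d dvd p mod q" "d = u * q + v * (p mod q)"
      by blast
    then have "d dvd p" by (metis dvd_mod_imp_dvd)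
    moreover have "d = v * p + (u - v * (p div q)) * q"
      using d(3) by (simp add: algebra_simps minus_div_mult_eq_mod[symmetric])
    ultimately show ?thesis using d(1) by blast
  qed
qed

lemma lowest_terms_poly:
  fixes p q :: "'a::field poly"
  assumes "q \<noteq> 0"
  obtains d p' q' u v where "p = d * p'" "q = d * q'" "u * p' + v * q' = 1" "d \<noteq> 0"
proof -
  obtain d u v where d: "d dvd p" "d dvd q" "d = u * p + v * q" using bezout_poly by blast
  obtain p' q' where pq: "p = d * p'" "q = d * q'" using d(1,2) by (auto elim!: dvdE)
  have "d \<noteq> 0" using pq assms by auto
  moreover have "d * (u * p' + v * q') = d * 1" using d(3) pq by (simp add: algebra_simps)
  ultimately have "u * p' + v * q' = 1" by (metis mult_left_cancel)
  then show ?thesis using that pq \<open>d \<noteq> 0\<close> by blast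
qed

context field_embedding
begin

definition peval :: "'k poly \<Rightarrow> 'f \<Rightarrow> 'f" where
  "peval p c = poly (map_poly emb p) c"

lemma peval_0 [simp]: "peval 0 c = 0"
  by (simp add: peval_def)

lemma peval_pCons [simp]: "peval (pCons a p) c = emb a + c * peval p c"
  by (simp add: peval_def map_poly_pCons)

lemma peval_1 [simp]: "peval 1 c = 1"
  by (simp add: one_pCons emb_one)

lemma peval_add [simp]: "peval (p + q) c = peval p c + peval q c"
proof (induction p arbitrary: q)
  case (pCons a p)
  obtain b r where "q = pCons b r" by (cases q)
  then show ?case by (simp add: pCons emb_add algebra_simps)
qed simp

lemma peval_uminus [simp]: "peval (- p) c = - peval p c"
  by (induction p) (simp_all add: emb_uminus)

lemma peval_diff [simp]: "peval (p - q) c = peval p c - peval q c"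
  using peval_add[of p "- q" c] by simp

lemma peval_smult [simp]: "peval (smult a p) c = emb a * peval p c"
  by (induction p) (simp_all add: emb_mult algebra_simps)

lemma peval_mult [simp]: "peval (p * q) c = peval p c * peval q c"
  by (induction p) (simp_all add: algebra_simps)

lemma peval_power [simp]: "peval (p ^ n) c = peval p c ^ n"
  by (induction n) simp_all

lemma peval_of_nat [simp]: "peval (of_nat n) c = of_nat n"
  by (induction n) simp_all

lemma peval_numeral [simp]: "peval (numeral n) c = numeral n"
  using peval_of_nat[of "numeral n" c] by simp

lemma peval_sum: "peval (sum g I) c = (\<Sum>i\<in>I. peval (g i) c)"
  by (induction I rule: infinite_finite_induct) simp_all

lemma peval_prod: "peval (prod g I) c = (\<Prod>i\<in>I. peval (g i) c)"
  by (induction I rule: infinite_finite_induct) simp_all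

lemma peval_monom: "peval (monom a n) c = emb a * c ^ n"
  by (induction n) (simp_all add: monom_0 monom_Suc algebra_simps)

lemma map_poly_emb_eq_0_iff [simp]: "map_poly emb p = 0 \<longleftrightarrow> p = 0"
  by (simp add: poly_eq_iff coeff_map_poly)

lemma degree_map_poly_emb [simp]: "degree (map_poly emb p) = degree p"
  by (rule degree_map_poly) simp

lemma finite_peval_roots: "p \<noteq> 0 \<Longrightarrow> finite {c. peval p c = 0}"
  unfolding peval_def by (rule poly_roots_finite) simp

lemma peval_altdef: "peval p c = (\<Sum>i\<le>degree p. emb (coeff p i) * c ^ i)"
  by (simp add: peval_def poly_altdef coeff_map_poly)

end

lemma nonconstant_poly_root_closure:
  fixes p :: "'a::field poly"
  assumes "degree p > 0"
  obtains c where "to_ac.peval p c = 0"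
proof -
  have "degree (map_poly to_ac p) > 0" using assms by simp
  then show ?thesis using that alg_closed_imp_poly_has_root unfolding to_ac.peval_def by blast
qed

text \<open>A common divisor of positive degree would have a root in the algebraic closure.
  Coprimality over \<open>K\<close> can thus be checked at geometric points, where the group law is
  available.\<close>

lemma bezout3_of_no_common_root:
  fixes p q r :: "'a::field poly"
  assumes "\<And>c. \<not> (to_ac.peval p c = 0 \<and> to_ac.peval q c = 0 \<and> to_ac.peval r c = 0)"
  obtains u v w where "u * p + v * q + w * r = 1"
proof -
  obtain d u v where d: "d dvd p" "d dvd q" "d = u * p + v * q" using bezout_poly by blast
  obtain e s t where e: "e dvd d" "e dvd r" "e = s * d + t * r" using bezout_poly by blast
  have dv: "e dvd p" "e dvd q" "e dvd r" using d e dvd_trans by blast+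
  have root: "to_ac.peval e c \<noteq> 0" for c
    using assms[of c] dv by (auto elim!: dvdE)
  have "degree e = 0"
    using nonconstant_poly_root_closure root by (metis neq0_conv)
  then obtain a where a: "e = [:a:]" by (metis degree_eq_zeroE)
  have "a \<noteq> 0" using root[of 0] a by auto
  then have "[:inverse a:] * e = 1" by (simp add: a one_pCons)
  moreover have "[:inverse a:] * e = ([:inverse a:] * s * u) * p + ([:inverse a:] * s * v) * q + ([:inverse a:] * t) * r"
    unfolding e(3) d(3) by (simp only: algebra_simps)
  ultimately show ?thesis using that by metis
qed

text \<open>A degree bound rather than the degree, since \<open>c\<close> may vanish: the
  denominators get top coefficient \<open>n^2\<close>, which is zero when the characteristic divides
  \<open>n\<close>.\<close>

definition top_coeff :: "'a::comm_ring_1 poly \<Rightarrow> nat \<Rightarrow> 'a \<Rightarrow> bool" where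
  "top_coeff p n c \<longleftrightarrow> degree p \<le> n \<and> coeff p n = c"

lemma top_coeff_add: "top_coeff p n c \<Longrightarrow> top_coeff q n d \<Longrightarrow> top_coeff (p + q) n (c + d)"
  by (auto simp: top_coeff_def degree_add_le)

lemma top_coeff_diff: "top_coeff p n c \<Longrightarrow> top_coeff q n d \<Longrightarrow> top_coeff (p - q) n (c - d)"
  by (auto simp: top_coeff_def degree_diff_le)

lemma top_coeff_weaken: "top_coeff p n c \<Longrightarrow> n < m \<Longrightarrow> top_coeff p m 0"
  by (auto simp: top_coeff_def coeff_eq_0)

lemma coeff_mult_at_bounds:
  assumes "degree p \<le> n" "degree q \<le> m"
  shows "coeff (p * q) (n + m) = coeff p n * coeff q m"
proof -
  have "coeff (p * q) (n + m) = (\<Sum>i\<le>n + m. coeff p i * coeff q (n + m - i))"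
    by (simp add: coeff_mult)
  also have "\<dots> = (\<Sum>i\<in>{n}. coeff p i * coeff q (n + m - i))"
  proof (rule sum.mono_neutral_right)
    show "\<forall>i\<in>{..n + m} - {n}. coeff p i * coeff q (n + m - i) = 0"
    proof
      fix i assume "i \<in> {..n + m} - {n}"
      then have "i > degree p \<or> n + m - i > degree q" using assms by auto
      then show "coeff p i * coeff q (n + m - i) = 0" by (auto simp: coeff_eq_0)
    qed
  qed auto
  finally show ?thesis by simp
qed

lemma top_coeff_mult: "top_coeff p n c \<Longrightarrow> top_coeff q m d \<Longrightarrow> top_coeff (p * q) (n + m) (c * d)"
  unfolding top_coeff_def using coeff_mult_at_bounds[of p n q m] degree_mult_le[of p q] by auto

lemma top_coeff_const: "top_coeff [:a:] 0 a" "top_coeff (numeral k) 0 (numeral k)"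
  by (simp_all add: top_coeff_def numeral_poly)

lemma top_coeff_X: "top_coeff [:0, 1:] 1 1"
  by (simp add: top_coeff_def)

abbreviation poly_weierstrass :: "'a::field weierstrass \<Rightarrow> 'a poly weierstrass" where
  "poly_weierstrass E \<equiv> map_weierstrass (\<lambda>a. [:a:]) E"

lemma poly_weierstrass_sel:
  "wa1 (poly_weierstrass E) = [:wa1 E:]" "wa2 (poly_weierstrass E) = [:wa2 E:]"
  "wa3 (poly_weierstrass E) = [:wa3 E:]" "wa4 (poly_weierstrass E) = [:wa4 E:]"
  "wa6 (poly_weierstrass E) = [:wa6 E:]"
  by (cases E; simp)+

lemma poly_wb:
  "wb2 (poly_weierstrass E) = [:wb2 E:]" "wb4 (poly_weierstrass E) = [:wb4 E:]"
  "wb6 (poly_weierstrass E) = [:wb6 E:]" "wb8 (poly_weierstrass E) = [:wb8 E:]"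
  by (simp_all add: wb_defs poly_weierstrass_sel power2_eq_square numeral_poly)

text \<open>The Kummer forms at the indeterminate, that is, at the x-coordinate of a generic point
  \<open>Q\<close>.\<close>

abbreviation pkumA :: "'a::field weierstrass \<Rightarrow> 'a poly \<Rightarrow> 'a poly \<Rightarrow> 'a poly" where
  "pkumA E f g \<equiv> kumA (poly_weierstrass E) [:0, 1:] f g"
abbreviation pkumB :: "'a::field weierstrass \<Rightarrow> 'a poly \<Rightarrow> 'a poly \<Rightarrow> 'a poly" where
  "pkumB E f g \<equiv> kumB (poly_weierstrass E) [:0, 1:] f g"
abbreviation pkumC :: "'a::field poly \<Rightarrow> 'a poly \<Rightarrow> 'a poly" where
  "pkumC f g \<equiv> kumC [:0, 1:] f g"

lemma (in field_embedding) peval_kum: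
  "peval (pkumA E f g) c = kumA (map_weierstrass emb E) c (peval f c) (peval g c)"
  "peval (pkumB E f g) c = kumB (map_weierstrass emb E) c (peval f c) (peval g c)"
  "peval (pkumC f g) c = kumC c (peval f c) (peval g c)"
proof -
  have wb: "wb2 (map_weierstrass emb E) = emb (wb2 E)" "wb4 (map_weierstrass emb E) = emb (wb4 E)"
    "wb6 (map_weierstrass emb E) = emb (wb6 E)" "wb8 (map_weierstrass emb E) = emb (wb8 E)"
    by (simp_all add: wb_defs map_weierstrass_sel emb_simps)
  show "peval (pkumA E f g) c = kumA (map_weierstrass emb E) c (peval f c) (peval g c)"
    "peval (pkumB E f g) c = kumB (map_weierstrass emb E) c (peval f c) (peval g c)"
    "peval (pkumC f g) c = kumC c (peval f c) (peval g c)"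
    unfolding kum_defs poly_wb wb
    by (simp_all only: peval_mult peval_add peval_diff peval_power peval_numeral peval_pCons peval_0
        emb_one emb_zero mult_zero_right add_0_left add_0_right mult_1_right)
qed

lemma top_coeff_pkumA:
  assumes "top_coeff f a 1" "top_coeff g b s" "b < a"
  shows "top_coeff (pkumA E f g) (2 * a + 2) 1"
proof -
  have X: "top_coeff (f * [:0, 1:]) (a + 1) 1" using top_coeff_mult[OF assms(1) top_coeff_X] by simp
  have 1: "top_coeff ((f * [:0, 1:]) ^ 2) (2 * a + 2) 1"
    unfolding power2_eq_square using top_coeff_mult[OF X X] by (simp add: mult_2)
  have 2: "top_coeff ([:wb4 E:] * f * [:0, 1:] * g) (2 * a + 2) 0"
    by (rule top_coeff_weaken[OF top_coeff_mult[OF top_coeff_mult[OF top_coeff_mult[OF top_coeff_const(1) assms(1)] top_coeff_X] assms(2)]])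
      (use assms in simp)
  have fxg: "top_coeff (f + [:0, 1:] * g) (a + 1) 0"
    using top_coeff_add[OF top_coeff_weaken[OF assms(1), of "a + 1"] top_coeff_weaken[OF top_coeff_mult[OF top_coeff_X assms(2)], of "a + 1"]] assms(3)
    by simp
  have 3: "top_coeff ([:wb6 E:] * g * (f + [:0, 1:] * g)) (2 * a + 2) 0"
    by (rule top_coeff_weaken[OF top_coeff_mult[OF top_coeff_mult[OF top_coeff_const(1) assms(2)] fxg]])
      (use assms in simp)
  have 4: "top_coeff ([:wb8 E:] * g ^ 2) (2 * a + 2) 0"
    unfolding power2_eq_square
    by (rule top_coeff_weaken[OF top_coeff_mult[OF top_coeff_const(1) top_coeff_mult[OF assms(2) assms(2)]]])
      (use assms in simp)
  show ?thesis unfolding kumA_def poly_wb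
    using top_coeff_diff[OF top_coeff_diff[OF top_coeff_diff[OF 1 2] 3] 4] by simp
qed

lemma top_coeff_pkumB:
  assumes "top_coeff f a 1" "top_coeff g (a - 1) s" "a \<ge> 1"
  shows "top_coeff (pkumB E f g) (2 * a + 1) (2 * (1 + s))"
proof -
  have fxg: "top_coeff (f + [:0, 1:] * g) a (1 + s)"
    using top_coeff_add[OF assms(1), of "[:0, 1:] * g" s] top_coeff_mult[OF top_coeff_X assms(2)] assms(3) by simp
  have 1: "top_coeff (2 * f * [:0, 1:] * (f + [:0, 1:] * g)) (2 * a + 1) (2 * (1 + s))"
  proof -
    have e: "0 + a + 1 + a = 2 * a + 1" by simp
    show ?thesis
      using top_coeff_mult[OF top_coeff_mult[OF top_coeff_mult[OF top_coeff_const(2) assms(1)] top_coeff_X] fxg]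
      unfolding e mult_1_right .
  qed
  have 2: "top_coeff ([:wb2 E:] * f * [:0, 1:] * g) (2 * a + 1) 0"
    by (rule top_coeff_weaken[OF top_coeff_mult[OF top_coeff_mult[OF top_coeff_mult[OF top_coeff_const(1) assms(1)] top_coeff_X] assms(2)]])
      (use assms in simp)
  have 3: "top_coeff ([:wb4 E:] * g * (f + [:0, 1:] * g)) (2 * a + 1) 0"
    by (rule top_coeff_weaken[OF top_coeff_mult[OF top_coeff_mult[OF top_coeff_const(1) assms(2)] fxg]])
      (use assms in simp)
  have 4: "top_coeff ([:wb6 E:] * g ^ 2) (2 * a + 1) 0"
    unfolding power2_eq_square
    by (rule top_coeff_weaken[OF top_coeff_mult[OF top_coeff_const(1) top_coeff_mult[OF assms(2) assms(2)]]])
      (use assms in simp)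
  show ?thesis unfolding kumB_def poly_wb
    using top_coeff_add[OF top_coeff_add[OF top_coeff_add[OF 1 2] 3] 4] by simp
qed

subsection \<open>Numerator and denominator of the multiplication maps\<close>

text \<open>\<open>s\<close>, \<open>r\<close>, \<open>t\<close> stand for the x-coordinates of
  \<open>(m - 1) Q\<close>, \<open>m Q\<close>, \<open>(m + 1) Q\<close>: the product of the linear
  forms given by \<open>s\<close> and \<open>t\<close> is the quadratic form with coefficients
  \<open>pkumA\<close>, \<open>pkumB\<close>, \<open>pkumC\<close> at \<open>r\<close>. Equality is
  exact and not up to a scalar, so that leading coefficients can be compared.\<close>

definition kum_rel :: "'a::field weierstrass \<Rightarrow> 'a poly \<times> 'a poly \<Rightarrow> 'a poly \<times> 'a poly \<Rightarrow>
    'a poly \<times> 'a poly \<Rightarrow> bool" where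
  "kum_rel E s r t \<longleftrightarrow>
     fst s * fst t = pkumA E (fst r) (snd r) \<and>
     fst s * snd t + fst t * snd s = pkumB E (fst r) (snd r) \<and>
     snd s * snd t = pkumC (fst r) (snd r)"

text \<open>At index 0 the pair is \<open>(1, 0)\<close>, infinity on the x-line, and
  \<open>m ^ 2 - 1\<close> truncates to 0. The coefficient \<open>m^2\<close> of the denominator is
  recorded because it produces roots, hence torsion, when it is nonzero in \<open>K\<close>.\<close>

definition div_pair_spec :: "nat \<Rightarrow> 'a::field poly \<times> 'a poly \<Rightarrow> bool" where
  "div_pair_spec m r \<longleftrightarrow>
     top_coeff (fst r) (m ^ 2) 1 \<and> top_coeff (snd r) (m ^ 2 - 1) (of_nat (m ^ 2)) \<and>
     (m = 0 \<longrightarrow> snd r = 0) \<and> (\<exists>u v. u * fst r + v * snd r = 1)"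

definition pair_x :: "'a::field weierstrass \<Rightarrow> nat \<Rightarrow> 'a poly \<times> 'a poly \<Rightarrow> bool" where
  "pair_x E m r \<longleftrightarrow> (\<forall>c d. Affine c d \<in> ec_points (map_weierstrass to_ac E) \<longrightarrow>
     has_x (ec_mult (map_weierstrass to_ac E) m (Affine c d)) (to_ac.peval (fst r) c) (to_ac.peval (snd r) c))"

lemma ec_mult_diff_step:
  assumes "elliptic_curve E" "Q \<in> ec_points E"
  shows "ec_add E (ec_mult E (Suc m) Q) (ec_neg E Q) = ec_mult E m Q"
    and "ec_add E (ec_mult E (Suc m) Q) Q = ec_mult E (Suc (Suc m)) Q"
proof -
  have m: "ec_mult E k Q \<in> ec_points E" for k using assms ec_mult_closed by blast
  have 1: "ec_mult E (Suc k) Q = ec_add E (ec_mult E k Q) Q" for k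
    unfolding ec_mult_Suc by (rule ec_add_commute[OF assms(2) m assms(1)])
  show "ec_add E (ec_mult E (Suc m) Q) (ec_neg E Q) = ec_mult E m Q"
    unfolding 1 by (rule ec_add_diff_cancel[OF assms(1) m assms(2)])
  show "ec_add E (ec_mult E (Suc m) Q) Q = ec_mult E (Suc (Suc m)) Q"
    by (rule 1[symmetric])
qed

lemma (in field_embedding) has_x_kum_step:
  assumes E: "elliptic_curve E" and Q: "Affine c d \<in> ec_points (map_weierstrass emb E)"
    and s: "has_x (ec_mult (map_weierstrass emb E) m (Affine c d)) (peval (fst s) c) (peval (snd s) c)"
    and r: "has_x (ec_mult (map_weierstrass emb E) (Suc m) (Affine c d)) (peval (fst r) c) (peval (snd r) c)"
    and k: "kum_rel E s r t"
  shows "has_x (ec_mult (map_weierstrass emb E) (Suc (Suc m)) (Affine c d)) (peval (fst t) c) (peval (snd t) c)"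
proof -
  let ?E = "map_weierstrass emb E"
  have E': "elliptic_curve ?E" using E by simp
  note st = ec_mult_diff_step[OF E' Q]
  show ?thesis
    unfolding st(2)[symmetric]
  proof (rule has_x_step[OF E' _ Q _ r])
    show "ec_mult ?E (Suc m) (Affine c d) \<in> ec_points ?E" by (rule ec_mult_closed[OF E' Q])
    show "has_x (ec_add ?E (ec_mult ?E (Suc m) (Affine c d)) (ec_neg ?E (Affine c d)))
        (peval (fst s) c) (peval (snd s) c)"
      unfolding st(1) by (rule s)
    show "peval (fst s) c * peval (fst t) c = kumA ?E c (peval (fst r) c) (peval (snd r) c)"
      "peval (fst s) c * peval (snd t) c + peval (fst t) c * peval (snd s) c =
        kumB ?E c (peval (fst r) c) (peval (snd r) c)"
      "peval (snd s) c * peval (snd t) c = kumC c (peval (fst r) c) (peval (snd r) c)"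
      using k unfolding kum_rel_def peval_kum[symmetric] by (metis peval_mult peval_add)+
  qed
qed

text \<open>\<open>kumC = 0\<close> means \<open>x(R) = x(Q)\<close>, and there the other two values
  are the duplication pair up to a nonzero square; a pair of homogeneous coordinates is never
  \<open>(0, 0)\<close>.\<close>

lemma kum_nonzero:
  assumes E: "elliptic_curve E" and R: "R \<in> ec_points E" and Q: "Affine c d \<in> ec_points E"
    and R0: "has_x R f g"
  shows "\<not> (kumA E c f g = 0 \<and> kumB E c f g = 0 \<and> kumC c f g = 0)"
proof
  assume z: "kumA E c f g = 0 \<and> kumB E c f g = 0 \<and> kumC c f g = 0"
  then have fc: "f = c * g" by (simp add: kumC_def)
  then have g: "g \<noteq> 0" using has_x_nonzero[OF R0] by auto
  have "kumA E c c 1 = 0" "kumB E c c 1 = 0" using z g unfolding fc kum_scale by auto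
  then show False using has_x_nonzero[OF has_x_double[OF E Q]] by simp
qed

text \<open>\<open>F / G\<close> is known to satisfy the sum relation only. Where
  \<open>kumC\<close> and the denominators do not vanish, this identifies it with
  \<open>x(R + Q)\<close>, and the product relation follows.\<close>

lemma kum_prod:
  assumes E: "elliptic_curve E" and R: "R \<in> ec_points E" and Q: "Affine c d \<in> ec_points E"
    and R0: "has_x R f g" and C: "kumC c f g \<noteq> 0" and g1: "g1 \<noteq> 0"
    and R1: "has_x (ec_add E R (ec_neg E (Affine c d))) f1 g1"
    and G: "G \<noteq> 0" and cross: "kumC c f g * (f1 * G + F * g1) = kumB E c f g * g1 * G"
  shows "kumA E c f g * g1 * G = kumC c f g * f1 * F"
proof (cases R)
  case Infty
  then have g: "g = 0" "f \<noteq> 0" using R0 by auto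
  have f1: "f1 = c * g1" using R1 Infty by simp
  have k: "kumA E c f g = f ^ 2 * c ^ 2" "kumB E c f g = f ^ 2 * (2 * c)" "kumC c f g = f ^ 2"
    by (simp_all add: kum_defs g power2_eq_square)
  have "f ^ 2 * (g1 * F) = f ^ 2 * (g1 * (c * G))" using cross unfolding k f1 by Groebner_Basis.algebra
  then have F: "F = c * G" using g g1 by simp
  show ?thesis unfolding k f1 F by (simp add: power2_eq_square)
next
  case (Affine x y)
  have g: "g \<noteq> 0" "f = x * g" using R0 Affine by auto
  have Rm: "Affine x y \<in> ec_points E" using R Affine by simp
  have ne: "x \<noteq> c" using C unfolding g(2) kum_scale by (auto simp: kumC_def)
  let ?Q = "Affine c d"
  have "ec_add E R ?Q \<noteq> Infty" "ec_add E R (ec_neg E ?Q) \<noteq> Infty"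
    using ne by (auto simp: Affine Let_def)
  then obtain x3 y3 x4 y4 where S: "ec_add E R ?Q = Affine x3 y3"
    "ec_add E R (ec_neg E ?Q) = Affine x4 y4" by (meson ec_point.exhaust)
  have s: "kumB E c x 1 = (x3 + x4) * (x - c) ^ 2" "kumA E c x 1 = x3 * x4 * (x - c) ^ 2"
    using chord_sum[OF Rm Q ne] chord_prod[OF Rm Q ne] S Affine by simp_all
  have f1: "f1 = x4 * g1" using R1 S by auto
  have k: "kumC c x 1 = (x - c) ^ 2" by (simp add: kumC_def)
  have "(g ^ 2 * (x - c) ^ 2 * g1) * F = (g ^ 2 * (x - c) ^ 2 * g1) * (x3 * G)"
    using cross unfolding g(2) kum_scale s k f1 by Groebner_Basis.algebra
  then have F: "F = x3 * G" using g g1 ne by simp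
  show ?thesis unfolding g(2) kum_scale s k f1 F by (simp only: mult_ac)
qed

lemma poly_eqI_closure:
  fixes p q :: "'a::field poly"
  assumes "r \<noteq> 0" "\<And>c. to_ac.peval r c \<noteq> 0 \<Longrightarrow> to_ac.peval p c = to_ac.peval q c"
  shows "p = q"
proof (rule ccontr)
  assume "p \<noteq> q"
  then have "r * (p - q) \<noteq> 0" using assms(1) by simp
  moreover have "{c. to_ac.peval (r * (p - q)) c = 0} = UNIV" using assms(2) by auto
  ultimately show False using to_ac.finite_peval_roots infinite_UNIV_alg_closed by metis
qed

text \<open>Proportional unimodular vectors differ by a unit. The Bezout combination of the first
  vector, applied to the second, is the factor \<open>L\<close>; its inverse \<open>M\<close> is
  obtained symmetrically, so \<open>L\<close> is a nonzero constant.\<close>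

lemma proportional_bezout:
  fixes a b c a' b' c' :: "'a::field poly"
  assumes 1: "a * b' = a' * b" and 2: "a * c' = a' * c" and 3: "b * c' = b' * c"
    and B: "u * a + v * b + w * c = 1" and B': "u' * a' + v' * b' + w' * c' = 1"
  obtains l where "l \<noteq> 0" "a' = smult l a" "b' = smult l b" "c' = smult l c"
proof -
  define L where "L = u * a' + v * b' + w * c'"
  define M where "M = u' * a + v' * b + w' * c"
  have L: "a' = L * a" "b' = L * b" "c' = L * c"
    using 1 2 3 B unfolding L_def by Groebner_Basis.algebra+
  have LM: "L * M = 1" using B' unfolding L M_def by (simp add: algebra_simps)
  then have nz: "L \<noteq> 0" "M \<noteq> 0" by auto
  have "degree (L * M) = 0" unfolding LM by simp
  then have "degree L = 0" unfolding degree_mult_eq[OF nz] by simp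
  then obtain l where l: "L = [:l:]" by (rule degree_eq_zeroE)
  then have "l \<noteq> 0" using nz by auto
  moreover have "a' = smult l a" "b' = smult l b" "c' = smult l c" unfolding L l by simp_all
  ultimately show ?thesis by (rule that)
qed


lemma div_pair_specD:
  assumes "div_pair_spec m r"
  shows "degree (fst r) = m ^ 2" "fst r \<noteq> 0" "m > 0 \<Longrightarrow> snd r \<noteq> 0"
proof -
  have t: "degree (fst r) \<le> m ^ 2" "coeff (fst r) (m ^ 2) = 1"
    using assms by (auto simp: div_pair_spec_def top_coeff_def)
  show nz: "fst r \<noteq> 0" using t(2) by auto
  show d: "degree (fst r) = m ^ 2" using t by (simp add: le_antisym le_degree)
  show "snd r \<noteq> 0" if "m > 0"
  proof
    assume "snd r = 0"
    then obtain u where u: "u * fst r = 1" using assms by (auto simp: div_pair_spec_def)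
    then have "u \<noteq> 0" by auto
    then have "degree u + degree (fst r) = 0" using u degree_mult_eq[OF \<open>u \<noteq> 0\<close> nz] by simp
    then show False using d that by simp
  qed
qed

text \<open>Generically \<open>m Q\<close> is neither \<open>Q\<close> nor \<open>- Q\<close> once
  \<open>m \<ge> 2\<close>: otherwise the fraction in lowest terms would be the indeterminate
  itself, of degree 1 instead of \<open>m^2\<close>.\<close>

lemma pkumC_nonzero:
  assumes "div_pair_spec m r" "m \<ge> 2"
  shows "pkumC (fst r) (snd r) \<noteq> 0"
proof
  assume "pkumC (fst r) (snd r) = 0"
  then have f: "fst r = [:0, 1:] * snd r" by (simp add: kumC_def)
  obtain u v where "u * fst r + v * snd r = 1" using assms by (auto simp: div_pair_spec_def)
  then have 1: "(u * [:0, 1:] + v) * snd r = 1" unfolding f by (simp only: algebra_simps)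
  then have nz: "u * [:0, 1:] + v \<noteq> 0" "snd r \<noteq> 0" by auto
  have "degree (u * [:0, 1:] + v) + degree (snd r) = 0" using 1 degree_mult_eq[OF nz] by simp
  then have "degree (snd r) = 0" by simp
  moreover have "degree (fst r) \<le> 1 + degree (snd r)"
    unfolding f using degree_mult_le[of "[:0, 1:]" "snd r"] by simp
  ultimately have "m ^ 2 \<le> 1" using div_pair_specD(1)[OF assms(1)] by simp
  moreover have "m ^ 2 \<ge> 2 ^ 2" using assms(2) by (rule power_mono) simp
  ultimately show False by simp
qed

text \<open>The product and sum relations are divided by \<open>fst s\<close>, which has leading
  coefficient 1. The arithmetic behind it is \<open>2 (n + 1)^2 + 2 = n^2 + (n + 2)^2\<close>, used
  once for the degrees and once for the coefficient, where \<open>2 (1 + (n + 1)^2)\<close> is the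
  top coefficient of \<open>pkumB\<close> and \<open>n^2\<close> is subtracted.\<close>

lemma kum_rel_top_coeffs:
  assumes s: "div_pair_spec n s" and r: "div_pair_spec (Suc n) r" and t: "kum_rel E s r t"
  shows "top_coeff (fst t) (Suc (Suc n) ^ 2) 1"
    and "top_coeff (snd t) (Suc (Suc n) ^ 2 - 1) (of_nat (Suc (Suc n) ^ 2))"
proof -
  let ?m = "Suc n"
  have f: "top_coeff (fst r) (?m ^ 2) 1" and g: "top_coeff (snd r) (?m ^ 2 - 1) (of_nat (?m ^ 2))"
    using r by (auto simp: div_pair_spec_def)
  have f1: "top_coeff (fst s) (n ^ 2) 1" and g1: "top_coeff (snd s) (n ^ 2 - 1) (of_nat (n ^ 2))"
    using s by (auto simp: div_pair_spec_def)
  have g1': "n = 0 \<Longrightarrow> snd s = 0" using s by (auto simp: div_pair_spec_def)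
  have d1: "degree (fst s) = n ^ 2" "fst s \<noteq> 0" using div_pair_specD[OF s] by auto
  have e: "2 * ?m ^ 2 + 2 = n ^ 2 + Suc (Suc n) ^ 2" by (simp add: power2_eq_square)
  have A: "top_coeff (fst s * fst t) (n ^ 2 + Suc (Suc n) ^ 2) 1"
    using top_coeff_pkumA[OF f g] t unfolding kum_rel_def e[symmetric] by (simp add: less_eq_nat.simps)
  then have t0: "fst t \<noteq> 0" by (auto simp: top_coeff_def)
  have "degree (fst s) + degree (fst t) \<le> n ^ 2 + Suc (Suc n) ^ 2"
    using A unfolding top_coeff_def degree_mult_eq[OF d1(2) t0] by simp
  then have dt: "degree (fst t) \<le> Suc (Suc n) ^ 2" using d1 by simp
  have "coeff (fst t) (Suc (Suc n) ^ 2) = 1"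
    using A f1 coeff_mult_at_bounds[OF _ dt, of "fst s" "n ^ 2"] by (simp add: top_coeff_def)
  then show tc: "top_coeff (fst t) (Suc (Suc n) ^ 2) 1" using dt by (simp add: top_coeff_def)
  have e2: "2 * ?m ^ 2 + 1 = n ^ 2 + (Suc (Suc n) ^ 2 - 1)" by (simp add: power2_eq_square)
  have B: "top_coeff (fst s * snd t + fst t * snd s) (n ^ 2 + (Suc (Suc n) ^ 2 - 1))
      (2 * (1 + of_nat (?m ^ 2)))"
    using top_coeff_pkumB[OF f g] t unfolding kum_rel_def e2[symmetric] by simp
  have fg: "top_coeff (fst t * snd s) (n ^ 2 + (Suc (Suc n) ^ 2 - 1)) (of_nat (n ^ 2))"
  proof (cases "n = 0")
    case True
    then show ?thesis using g1' by (simp add: top_coeff_def)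
  next
    case False
    then have "n ^ 2 \<ge> 1" by (simp add: Suc_le_eq)
    then have "Suc (Suc n) ^ 2 + (n ^ 2 - 1) = n ^ 2 + (Suc (Suc n) ^ 2 - 1)" by simp
    then show ?thesis using top_coeff_mult[OF tc g1] by (metis mult_1)
  qed
  have fs: "top_coeff (fst s * snd t) (n ^ 2 + (Suc (Suc n) ^ 2 - 1)) (of_nat (Suc (Suc n) ^ 2))"
  proof -
    have "2 * (1 + of_nat (?m ^ 2)) - of_nat (n ^ 2) = (of_nat (Suc (Suc n) ^ 2) :: 'a)"
      by (simp add: power2_eq_square algebra_simps)
    then show ?thesis using top_coeff_diff[OF B fg] by simp
  qed
  have ds: "degree (snd t) \<le> Suc (Suc n) ^ 2 - 1"
  proof (cases "snd t = 0")
    case False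
    have "degree (fst s) + degree (snd t) \<le> n ^ 2 + (Suc (Suc n) ^ 2 - 1)"
      using fs unfolding top_coeff_def degree_mult_eq[OF d1(2) False] by simp
    then show ?thesis using d1 by simp
  qed simp
  have "coeff (snd t) (Suc (Suc n) ^ 2 - 1) = of_nat (Suc (Suc n) ^ 2)"
    using fs f1 coeff_mult_at_bounds[OF _ ds, of "fst s" "n ^ 2"] by (simp add: top_coeff_def)
  then show "top_coeff (snd t) (Suc (Suc n) ^ 2 - 1) (of_nat (Suc (Suc n) ^ 2))"
    using ds by (simp add: top_coeff_def)
qed

lemma kum_rel_bezout:
  assumes E: "elliptic_curve E" and s: "pair_x E n s" and r: "pair_x E (Suc n) r"
    and t: "kum_rel E s r t"
  shows "\<exists>u v. u * fst t + v * snd t = 1"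
proof -
  have "\<not> (to_ac.peval (fst t) c = 0 \<and> to_ac.peval (snd t) c = 0 \<and> to_ac.peval 0 c = 0)" for c
  proof -
    obtain d where Q: "Affine c d \<in> ec_points (map_weierstrass to_ac E)" by (rule ec_point_above_exists)
    have "has_x (ec_mult (map_weierstrass to_ac E) (Suc (Suc n)) (Affine c d))
        (to_ac.peval (fst t) c) (to_ac.peval (snd t) c)"
      by (rule to_ac.has_x_kum_step[OF E Q _ _ t]) (use s r Q in \<open>auto simp: pair_x_def\<close>)
    then show ?thesis using has_x_nonzero by blast
  qed
  from bezout3_of_no_common_root[OF this] obtain u v w where "u * fst t + v * snd t + w * 0 = 1" .
  then show ?thesis by auto
qed

text \<open>The next fraction is defined by the sum relation. The product relation holds at all
  geometric points off a finite set, hence identically. The vectors \<open>(A, B, C)\<close> and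
  \<open>(f1 F, f1 G + F g1, g1 G)\<close> are then proportional, and both are unimodular, so a
  constant separates them; it is absorbed into \<open>F\<close> and \<open>G\<close>.\<close>

lemma kum_rel_exists:
  assumes E: "elliptic_curve E" and s: "div_pair_spec n s" and r: "div_pair_spec (Suc n) r"
    and sx: "pair_x E n s" and rx: "pair_x E (Suc n) r" and n: "n > 0"
  shows "\<exists>t. kum_rel E s r t"
proof -
  define f g f1 g1 where fg: "f = fst r" "g = snd r" "f1 = fst s" "g1 = snd s"
  define A B C where ABC: "A = pkumA E f g" "B = pkumB E f g" "C = pkumC f g"
  let ?E = "map_weierstrass to_ac E"
  have E': "elliptic_curve ?E" using E by simp
  have C0: "C \<noteq> 0" unfolding ABC fg by (rule pkumC_nonzero[OF r]) (use n in simp)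
  have g1: "g1 \<noteq> 0" using div_pair_specD(3)[OF s n] fg by simp
  then have "C * g1 \<noteq> 0" using C0 by simp
  \<comment> \<open>The sum relation solved for the unknown fraction,
    \<open>F / G = B / C - f1 / g1\<close>, in lowest terms.\<close>
  then obtain e F G u v where FG: "B * g1 - f1 * C = e * F" "C * g1 = e * G" "u * F + v * G = 1" "e \<noteq> 0"
    by (rule lowest_terms_poly)
  have G: "G \<noteq> 0" using FG(2) C0 g1 by auto
  have "e * ((B * g1 - f1 * C) * G) = e * (F * (C * g1))" unfolding FG(1,2) by (simp add: mult_ac)
  then have "(B * g1 - f1 * C) * G = F * (C * g1)"
    using FG(4) by (metis mult_left_cancel)
  then have cross: "C * (f1 * G + F * g1) = B * g1 * G"
    by (simp add: algebra_simps)
  have prod: "A * g1 * G = C * f1 * F"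
  proof (rule poly_eqI_closure[of "C * g1 * G"])
    show "C * g1 * G \<noteq> 0" using C0 g1 G by simp
    fix c assume nz: "to_ac.peval (C * g1 * G) c \<noteq> 0"
    obtain d where Q: "Affine c d \<in> ec_points ?E" by (rule ec_point_above_exists)
    let ?R = "ec_mult ?E (Suc n) (Affine c d)"
    have R: "?R \<in> ec_points ?E" by (rule ec_mult_closed[OF E' Q])
    have R0: "has_x ?R (to_ac.peval f c) (to_ac.peval g c)"
      using rx Q by (auto simp: pair_x_def fg)
    have R1: "has_x (ec_add ?E ?R (ec_neg ?E (Affine c d))) (to_ac.peval f1 c) (to_ac.peval g1 c)"
      unfolding ec_mult_diff_step(1)[OF E' Q] using sx Q by (auto simp: pair_x_def fg)
    have "to_ac.peval (C * (f1 * G + F * g1)) c = to_ac.peval (B * g1 * G) c" unfolding cross ..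
    then show "to_ac.peval (A * g1 * G) c = to_ac.peval (C * f1 * F) c"
      using kum_prod[OF E' R Q R0 _ _ R1] nz by (auto simp: ABC to_ac.peval_kum)
  qed
  have prod2: "A * (f1 * G + F * g1) = B * (f1 * F)"
  proof -
    have "C * (A * (f1 * G + F * g1)) = A * (C * (f1 * G + F * g1))" by (simp only: mult_ac)
    also have "\<dots> = B * (A * g1 * G)" unfolding cross by (simp only: mult_ac)
    also have "\<dots> = C * (B * (f1 * F))" unfolding prod by (simp only: mult_ac)
    finally show ?thesis using C0 by simp
  qed
  have "\<not> (to_ac.peval A c = 0 \<and> to_ac.peval B c = 0 \<and> to_ac.peval C c = 0)" for c
  proof -
    obtain d where Q: "Affine c d \<in> ec_points ?E" by (rule ec_point_above_exists)
    have "has_x (ec_mult ?E (Suc n) (Affine c d)) (to_ac.peval f c) (to_ac.peval g c)"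
      using rx Q by (auto simp: pair_x_def fg)
    from kum_nonzero[OF E' ec_mult_closed[OF E' Q] Q this]
    show ?thesis by (simp add: ABC to_ac.peval_kum)
  qed
  then obtain p1 q1 r1 where b1: "p1 * A + q1 * B + r1 * C = 1" by (rule bezout3_of_no_common_root)
  obtain us vs where bs: "us * f1 + vs * g1 = 1" using s by (auto simp: div_pair_spec_def fg)
  \<comment> \<open>Gauss's lemma, pointwise: a product of two linear forms with coprime
    coefficients has coprime coefficients.\<close>
  have "\<not> (to_ac.peval (f1 * F) c = 0 \<and> to_ac.peval (f1 * G + F * g1) c = 0 \<and> to_ac.peval (g1 * G) c = 0)" for c
  proof
    assume z: "to_ac.peval (f1 * F) c = 0 \<and> to_ac.peval (f1 * G + F * g1) c = 0 \<and> to_ac.peval (g1 * G) c = 0"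
    have "to_ac.peval (us * f1 + vs * g1) c = 1" "to_ac.peval (u * F + v * G) c = 1"
      unfolding bs FG(3) by simp_all
    then have "to_ac.peval f1 c \<noteq> 0 \<or> to_ac.peval g1 c \<noteq> 0" "to_ac.peval F c \<noteq> 0 \<or> to_ac.peval G c \<noteq> 0"
      by auto
    then show False using z by auto
  qed
  then obtain p2 q2 r2 where b2: "p2 * (f1 * F) + q2 * (f1 * G + F * g1) + r2 * (g1 * G) = 1"
    by (rule bezout3_of_no_common_root)
  have 1: "f1 * F * B = A * (f1 * G + F * g1)" using prod2 by (simp add: mult_ac)
  have 2: "f1 * F * C = A * (g1 * G)" using prod by (simp add: mult_ac)
  have 3: "(f1 * G + F * g1) * C = B * (g1 * G)" using cross by (simp add: mult_ac)
  from proportional_bezout[OF 1 2 3 b2 b1] obtain l where l: "l \<noteq> 0" "A = smult l (f1 * F)"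
    "B = smult l (f1 * G + F * g1)" "C = smult l (g1 * G)" .
  have "kum_rel E s r (smult l F, smult l G)"
    unfolding kum_rel_def fst_conv snd_conv fg[symmetric] ABC[symmetric] l(2-4)
    by (simp add: algebra_simps smult_add_right)
  then show ?thesis ..
qed

text \<open>
  The first component of the pair with index \<open>m\<close> is the pair \<open>(f, g)\<close> with
  \<open>x(m Q) = f(x(Q)) / g(x(Q))\<close>, the second one is the next such pair.
\<close>

primrec div_pairs :: "'a::field weierstrass \<Rightarrow> nat \<Rightarrow> ('a poly \<times> 'a poly) \<times> ('a poly \<times> 'a poly)" where
  "div_pairs E 0 = ((1, 0), ([:0, 1:], 1))"
| "div_pairs E (Suc n) = (snd (div_pairs E n),
     SOME t. kum_rel E (fst (div_pairs E n)) (snd (div_pairs E n)) t)"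

text \<open>The recursion looks two indices back, so consecutive pairs are carried together. The
  last conjunct records what the choice operator delivers for the next pair, which exists by the
  other four at the current index.\<close>

lemma div_pairs_spec:
  assumes E: "elliptic_curve E"
  shows "div_pair_spec n (fst (div_pairs E n)) \<and> div_pair_spec (Suc n) (snd (div_pairs E n)) \<and>
    pair_x E n (fst (div_pairs E n)) \<and> pair_x E (Suc n) (snd (div_pairs E n)) \<and>
    kum_rel E (fst (div_pairs E n)) (snd (div_pairs E n)) (snd (div_pairs E (Suc n)))"
proof (induction n)
  have *: "P n \<and> Q n \<and> R n \<and> S n \<and> kum_rel E (fst (div_pairs E n)) (snd (div_pairs E n)) (snd (div_pairs E (Suc n)))"
    if "P n" "Q n" "R n" "S n" "\<exists>t. kum_rel E (fst (div_pairs E n)) (snd (div_pairs E n)) t" for P Q R S n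
    using that someI_ex[OF that(5)] by simp
  case 0
  have "\<exists>t. kum_rel E (1, 0) ([:0, 1:], 1) t"
    by (rule exI[of _ "(pkumA E [:0, 1:] 1, pkumB E [:0, 1:] 1)"]) (simp add: kum_rel_def kumC_def)
  then show ?case
    by (intro *) (simp_all add: div_pair_spec_def top_coeff_def pair_x_def to_ac.emb_one exI[of _ 1] exI[of _ 0])
  case (Suc n)
  let ?s = "fst (div_pairs E n)" and ?r = "snd (div_pairs E n)" and ?t = "snd (div_pairs E (Suc n))"
  have IH: "div_pair_spec n ?s" "div_pair_spec (Suc n) ?r" "pair_x E n ?s" "pair_x E (Suc n) ?r"
    "kum_rel E ?s ?r ?t" using Suc by blast+
  have t: "div_pair_spec (Suc (Suc n)) ?t"
    using kum_rel_top_coeffs[OF IH(1,2,5)] kum_rel_bezout[OF E IH(3,4,5)]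
    unfolding div_pair_spec_def by simp
  have tx: "pair_x E (Suc (Suc n)) ?t"
    unfolding pair_x_def
  proof (intro allI impI)
    fix c d assume Q: "Affine c d \<in> ec_points (map_weierstrass to_ac E)"
    show "has_x (ec_mult (map_weierstrass to_ac E) (Suc (Suc n)) (Affine c d))
        (to_ac.peval (fst ?t) c) (to_ac.peval (snd ?t) c)"
      by (rule to_ac.has_x_kum_step[OF E Q _ _ IH(5)]) (use IH(3,4) Q in \<open>auto simp: pair_x_def\<close>)
  qed
  have f: "fst (div_pairs E (Suc n)) = ?r" by simp
  have "\<exists>t'. kum_rel E ?r ?t t'"
    by (rule kum_rel_exists[OF E IH(2) t IH(4) tx]) simp
  then show ?case using IH t tx by (intro *) (simp_all only: f)
qed

definition mult_num :: "'a::field weierstrass \<Rightarrow> nat \<Rightarrow> 'a poly" where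
  "mult_num E n = fst (fst (div_pairs E n))"
definition mult_den :: "'a::field weierstrass \<Rightarrow> nat \<Rightarrow> 'a poly" where
  "mult_den E n = snd (fst (div_pairs E n))"

lemma mult_num_den:
  assumes "elliptic_curve E"
  shows "degree (mult_num E n) = n ^ 2" "lead_coeff (mult_num E n) = 1"
    "n > 0 \<Longrightarrow> degree (mult_den E n) < n ^ 2" "n > 0 \<Longrightarrow> mult_den E n \<noteq> 0"
    "coeff (mult_den E n) (n ^ 2 - 1) = of_nat (n ^ 2)"
    "\<exists>u v. u * mult_num E n + v * mult_den E n = 1"
proof -
  have s: "div_pair_spec n (fst (div_pairs E n))" using div_pairs_spec[OF assms] by blast
  note d = div_pair_specD[OF s]
  show "degree (mult_num E n) = n ^ 2" "n > 0 \<Longrightarrow> mult_den E n \<noteq> 0"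
    using d by (simp_all add: mult_num_def mult_den_def)
  show "lead_coeff (mult_num E n) = 1"
    using s d(1) by (simp add: mult_num_def div_pair_spec_def top_coeff_def)
  have d': "degree (mult_den E n) \<le> n ^ 2 - 1" using s by (simp add: mult_den_def div_pair_spec_def top_coeff_def)
  have "n ^ 2 > 0" if "n > 0" using that by simp
  then show "degree (mult_den E n) < n ^ 2" if "n > 0"
    using that by (metis d' diff_less le_less_trans zero_less_one)
  show "coeff (mult_den E n) (n ^ 2 - 1) = of_nat (n ^ 2)"
    using s by (simp add: mult_den_def div_pair_spec_def top_coeff_def)
  show "\<exists>u v. u * mult_num E n + v * mult_den E n = 1"
    using s by (simp add: mult_num_def mult_den_def div_pair_spec_def)
qed

text \<open>The polynomial relations of the recursion specialise in every extension of
  \<open>K\<close>, so the same fractions serve for \<open>P\<close> over \<open>F\<close> and for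
  torsion points over the algebraic closure.\<close>

lemma (in field_embedding) has_x_mult:
  assumes E: "elliptic_curve E" and Q: "Affine c d \<in> ec_points (map_weierstrass emb E)"
  shows "has_x (ec_mult (map_weierstrass emb E) n (Affine c d))
    (peval (mult_num E n) c) (peval (mult_den E n) c)"
proof -
  have "has_x (ec_mult (map_weierstrass emb E) n (Affine c d))
      (peval (fst (fst (div_pairs E n))) c) (peval (snd (fst (div_pairs E n))) c) \<and>
    has_x (ec_mult (map_weierstrass emb E) (Suc n) (Affine c d))
      (peval (fst (snd (div_pairs E n))) c) (peval (snd (snd (div_pairs E n))) c)"
  proof (induction n)
    case 0
    show ?case by (simp add: emb_one)
  next
    case (Suc n)
    have "kum_rel E (fst (div_pairs E n)) (snd (div_pairs E n)) (snd (div_pairs E (Suc n)))"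
      using div_pairs_spec[OF E] by blast
    from has_x_kum_step[OF E Q _ _ this] Suc show ?case by simp
  qed
  then show ?thesis by (simp add: mult_num_def mult_den_def)
qed

subsection \<open>Torsion points\<close>

context
  fixes E :: "'k::field weierstrass" and E' :: "'k alg_closure weierstrass"
  assumes E: "elliptic_curve E"
  defines "E' \<equiv> map_weierstrass to_ac E"
begin

lemma E': "elliptic_curve E'"
  using E by (simp add: E'_def)

lemma ec_mult_surj:
  assumes "n > 0" "R \<in> ec_points E'"
  obtains Q where "Q \<in> ec_points E'" "ec_mult E' n Q = R"
proof (cases R)
  case Infty
  then show ?thesis using that[of Infty] by simp
next
  case (Affine a b)
  let ?f = "map_poly to_ac (mult_num E n)" and ?g = "map_poly to_ac (mult_den E n)"
  note m = mult_num_den[OF E]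
  have "degree (smult a ?g) < degree ?f"
    using m(1)[of n] m(3)[OF assms(1)] assms(1) by (simp add: le_less_trans[OF degree_smult_le])
  then have "degree (?f - smult a ?g) = n ^ 2"
    using degree_add_eq_left[of "- smult a ?g" ?f] m(1)[of n] by simp
  then have "degree (?f - smult a ?g) > 0" using assms(1) by simp
  then obtain c where "poly (?f - smult a ?g) c = 0" using alg_closed_imp_poly_has_root by blast
  then have c: "to_ac.peval (mult_num E n) c = a * to_ac.peval (mult_den E n) c"
    by (simp add: to_ac.peval_def)
  obtain d where Q: "Affine c d \<in> ec_points E'" by (rule ec_point_above_exists)
  let ?Q = "Affine c d"
  have hx: "has_x (ec_mult E' n ?Q) (to_ac.peval (mult_num E n) c) (to_ac.peval (mult_den E n) c)"
    unfolding E'_def by (rule to_ac.has_x_mult[OF E Q[unfolded E'_def]])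
  \<comment> \<open>If the denominator vanished at \<open>c\<close>, so would the numerator, and
    homogeneous coordinates are never both 0.\<close>
  then have "to_ac.peval (mult_den E n) c \<noteq> 0" using has_x_nonzero[OF hx] c by auto
  then obtain y where y: "ec_mult E' n ?Q = Affine a y"
    using hx c by (cases "ec_mult E' n ?Q") auto
  have "Affine a y \<in> ec_points E'" using ec_mult_closed[OF E' Q, of n] y by simp
  then have "R = ec_mult E' n ?Q \<or> R = ec_neg E' (ec_mult E' n ?Q)"
    using ec_points_same_x_cases assms(2) unfolding Affine y by blast
  then show ?thesis
  proof
    assume "R = ec_mult E' n ?Q"
    then show ?thesis using that Q by blast
  next
    assume "R = ec_neg E' (ec_mult E' n ?Q)"
    then have "ec_mult E' n (ec_neg E' ?Q) = R" by (simp only: ec_mult_neg[OF E' Q])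
    then show ?thesis using that ec_neg_closed[OF Q] by blast
  qed
qed

lemma torsion_point_of_den_root:
  assumes "to_ac.peval (mult_den E n) c = 0"
  obtains d where "Affine c d \<in> ec_points E'" "ec_mult E' n (Affine c d) = Infty"
proof -
  obtain d where Q: "Affine c d \<in> ec_points E'" by (rule ec_point_above_exists)
  have "has_x (ec_mult E' n (Affine c d)) (to_ac.peval (mult_num E n) c) (to_ac.peval (mult_den E n) c)"
    unfolding E'_def by (rule to_ac.has_x_mult[OF E Q[unfolded E'_def]])
  then show ?thesis using that Q has_x_Infty_iff assms by blast
qed

lemma torsion_point_exists:
  assumes "n > 1" "of_nat n \<noteq> (0 :: 'k)"
  obtains T where "T \<in> ec_points E'" "T \<noteq> Infty" "ec_mult E' n T = Infty"
proof -
  have "coeff (mult_den E n) (n ^ 2 - 1) \<noteq> 0" using mult_num_den(5)[OF E, of n] assms(2) by simp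
  moreover have "n ^ 2 - 1 > 0" using one_less_power[OF assms(1), of 2] by simp
  ultimately have "degree (mult_den E n) > 0" using le_degree by fastforce
  then obtain c where "to_ac.peval (mult_den E n) c = 0" by (rule nonconstant_poly_root_closure)
  then show ?thesis using torsion_point_of_den_root that by blast
qed

definition exact_order :: "nat \<Rightarrow> 'k alg_closure ec_point \<Rightarrow> bool" where
  "exact_order n Q \<longleftrightarrow> Q \<in> ec_points E' \<and> (\<forall>k. ec_mult E' k Q = Infty \<longleftrightarrow> n dvd k)"

lemma torsion_gcd:
  assumes "Q \<in> ec_points E'" "ec_mult E' a Q = Infty" "ec_mult E' b Q = Infty" "coprime a b"
  shows "Q = Infty"
proof (cases "a = 0")
  case True
  then show ?thesis using assms by simp
next
  case False
  obtain x y where "a * x = b * y + gcd a b" using bezout_nat[OF False] by blast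
  then have xy: "x * a = y * b + 1" using assms(4) by (simp add: mult.commute)
  have "ec_mult E' (x * a) Q = Infty" "ec_mult E' (y * b) Q = Infty"
    by (simp_all add: ec_mult_mult[OF E' assms(1)] assms)
  then show ?thesis using xy ec_mult_add[OF E' assms(1), of "y * b" 1] by simp
qed

text \<open>Induction over \<open>n = q * m\<close>: a point \<open>Q'\<close> of order
  \<open>m\<close> is divided by the prime \<open>q\<close>. The quotient \<open>Q\<close> has order
  \<open>n\<close> unless \<open>m Q\<close> is infinity; in that case \<open>q\<close> does not
  divide \<open>m\<close>, and adding a \<open>q\<close>-torsion point to \<open>Q\<close> repairs
  it.\<close>

lemma exact_order_exists:
  assumes "n > 0"
    and "\<And>q. prime q \<Longrightarrow> q dvd n \<Longrightarrow> \<exists>T\<in>ec_points E'. T \<noteq> Infty \<and> ec_mult E' q T = Infty"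
  shows "\<exists>Q. exact_order n Q"
  using assms
proof (induction n rule: less_induct)
  case (less n)
  show ?case
  proof (cases "n = 1")
    case True
    then show ?thesis by (auto simp: exact_order_def intro!: exI[of _ Infty])
  next
    case False
    then obtain q where q: "prime q" "q dvd n" using prime_factor_nat by blast
    then obtain m where n: "n = q * m" by (auto elim: dvdE)
    have m: "m > 0" "m < n" using less(2) n q(1) prime_gt_1_nat by (auto simp: n)
    have "\<exists>Q. exact_order m Q"
      by (rule less(1)) (use m n less(3) in auto)
    then obtain Q' where Q': "Q' \<in> ec_points E'" "\<And>k. ec_mult E' k Q' = Infty \<longleftrightarrow> m dvd k"
      unfolding exact_order_def by blast
    \<comment> \<open>If \<open>k Q\<close> is infinity then so is \<open>k Q'\<close>, whence
      \<open>k = j m\<close>. The point \<open>m Q\<close> is killed by the prime \<open>q\<close>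
      but is not infinity, so \<open>q\<close> divides \<open>j\<close>.\<close>
    have ok: "exact_order n Q" if Q: "Q \<in> ec_points E'" "ec_mult E' q Q = Q'" "ec_mult E' m Q \<noteq> Infty" for Q
      unfolding exact_order_def
    proof (intro conjI allI)
      show "Q \<in> ec_points E'" by fact
      note mm = ec_mult_mult[OF E' Q(1)]
      have qm: "ec_mult E' q (ec_mult E' m Q) = Infty"
        using Q'(2)[of m] mm[of m q] mm[of q m] Q(2) by (simp add: mult.commute)
      fix k show "ec_mult E' k Q = Infty \<longleftrightarrow> n dvd k"
      proof
        assume "n dvd k"
        then obtain j where "k = j * (q * m)" unfolding n by (metis dvd_def mult.commute)
        then show "ec_mult E' k Q = Infty" using qm mm by simp
      next
        assume k: "ec_mult E' k Q = Infty"
        have "ec_mult E' k Q' = ec_mult E' q (ec_mult E' k Q)"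
          using mm[of k q] mm[of q k] Q(2) by (simp add: mult.commute)
        then have "m dvd k" using k Q'(2) by simp
        then obtain j where j: "k = j * m" by (metis dvd_def mult.commute)
        have "ec_mult E' j (ec_mult E' m Q) = Infty" using k mm j by simp
        then have "\<not> coprime j q"
          using torsion_gcd[OF ec_mult_closed[OF E' Q(1)] _ qm] Q(3) by blast
        then have "q dvd j" using q(1) prime_imp_coprime_nat coprime_commute by metis
        then show "n dvd k" unfolding n j by simp
      qed
    qed
    have "q > 0" using q(1) prime_gt_0_nat by simp
    then obtain Q where Q: "Q \<in> ec_points E'" "ec_mult E' q Q = Q'"
      using ec_mult_surj Q'(1) by blast
    show ?thesis
    proof (cases "ec_mult E' m Q = Infty")
      case False
      then show ?thesis using ok Q by blast
    next
      case True
      have "\<not> q dvd m"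
      proof
        assume "q dvd m"
        then obtain j where j: "m = j * q" by (metis dvd_def mult.commute)
        have "ec_mult E' j Q' = Infty" using True ec_mult_mult[OF E' Q(1), of j q] j Q(2) by simp
        then have "m dvd j" using Q'(2) by simp
        moreover have "0 < j" "j < m" using m j q(1) prime_gt_1_nat by auto
        ultimately show False using nat_dvd_not_less by blast
      qed
      then have co: "coprime m q" using q(1) prime_imp_coprime_nat coprime_commute by metis
      obtain T where T: "T \<in> ec_points E'" "T \<noteq> Infty" "ec_mult E' q T = Infty"
        using less(3)[OF q] by blast
      let ?Q = "ec_add E' Q T"
      have "ec_mult E' q ?Q = Q'" "ec_mult E' m ?Q = ec_mult E' m T"
        by (simp_all add: ec_mult_distrib[OF E' Q(1) T(1)] T(3) Q(2) True)
      moreover have "ec_mult E' m T \<noteq> Infty" using torsion_gcd[OF T(1) _ T(3) co] T(2) by blast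
      ultimately show ?thesis using ok[OF ec_add_closed[OF E' Q(1) T(1)]] by metis
    qed
  qed
qed

lemma exact_order_exists':
  assumes "n > 0" "\<not> CHAR('k) dvd n \<or> ordinary E"
  shows "\<exists>Q. exact_order n Q"
proof (rule exact_order_exists[OF assms(1)])
  fix q :: nat assume q: "prime q" "q dvd n"
  show "\<exists>T\<in>ec_points E'. T \<noteq> Infty \<and> ec_mult E' q T = Infty"
  proof (cases "CHAR('k) dvd q")
    case False
    then have "of_nat q \<noteq> (0 :: 'k)" by (simp add: of_nat_eq_0_iff_char_dvd)
    then show ?thesis using torsion_point_exists prime_gt_1_nat[OF q(1)] by metis
  next
    case True
    then have "ordinary E" using assms(2) q(2) dvd_trans by blast
    moreover have "CHAR('k) \<noteq> 0" using True q(1) by (metis dvd_0_left_iff not_prime_0)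
    ultimately have "\<exists>T\<in>ec_points E'. T \<noteq> Infty \<and> ec_mult E' (CHAR('k)) T = Infty"
      unfolding ordinary_def supersingular_def E'_def by blast
    moreover have "CHAR('k) = q" using True q(1) CHAR_not_1 by (metis prime_nat_iff CHAR_not_1' One_nat_def)
    ultimately show ?thesis by simp
  qed
qed

lemma supersingular_den_constant:
  assumes "supersingular E"
  shows "degree (mult_den E (CHAR('k))) = 0"
proof (rule ccontr)
  assume "degree (mult_den E (CHAR('k))) \<noteq> 0"
  then obtain c where "to_ac.peval (mult_den E (CHAR('k))) c = 0"
    using nonconstant_poly_root_closure by blast
  then obtain d where "Affine c d \<in> ec_points E'" "ec_mult E' (CHAR('k)) (Affine c d) = Infty"
    by (rule torsion_point_of_den_root)
  then show False using assms unfolding supersingular_def E'_def by blast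
qed

end

subsection \<open>Valuations and minimal equations\<close>

locale valuation = field_embedding emb for emb :: "'k::field \<Rightarrow> 'f::field" +
  fixes v :: "'f \<Rightarrow> ereal"
  assumes is_valuation: "is_valuation emb v"
begin

lemma v_zero [simp]: "v 0 = \<infinity>"
  and v_mult: "v (a * b) = v a + v b"
  and v_add_ge: "min (v a) (v b) \<le> v (a + b)"
  and v_emb: "c \<noteq> 0 \<Longrightarrow> v (emb c) = 0"
  using is_valuation by (auto simp: is_valuation_def)

lemma v_finite: "a \<noteq> 0 \<Longrightarrow> \<exists>r. v a = ereal r"
  using is_valuation unfolding is_valuation_def by blast

lemma v_one [simp]: "v 1 = 0"
  using v_emb[of 1] by (simp add: emb_one)

lemma v_emb_ge: "0 \<le> v (emb c)"
  by (cases "c = 0") (simp_all add: v_emb)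

lemma v_uminus [simp]: "v (- a) = v a"
  using v_mult[of "emb (- 1)" a] v_emb[of "- 1"] by (simp add: emb_uminus emb_one)

lemma v_power: "v a = ereal r \<Longrightarrow> v (a ^ n) = ereal (of_nat n * r)"
  by (induction n) (simp_all add: v_mult algebra_simps zero_ereal_def)

lemma v_mult_ge0: "0 \<le> v a \<Longrightarrow> 0 \<le> v b \<Longrightarrow> 0 \<le> v (a * b)"
  by (simp add: v_mult)

lemma v_add_geI: "c \<le> v a \<Longrightarrow> c \<le> v b \<Longrightarrow> c \<le> v (a + b)"
  using v_add_ge[of a b] by (meson min.boundedI order_trans)

lemma v_diff_geI: "c \<le> v a \<Longrightarrow> c \<le> v b \<Longrightarrow> c \<le> v (a - b)"
  using v_add_geI[of c a "- b"] by simp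

lemma v_power_ge0: "0 \<le> v a \<Longrightarrow> 0 \<le> v (a ^ n)"
  by (induction n) (simp_all add: v_mult_ge0)

lemma v_numeral_ge0: "0 \<le> v (numeral k)"
  using v_emb_ge[of "numeral k"] by (simp add: emb_numeral)

lemma v_add_eq:
  assumes "v a < v b"
  shows "v (a + b) = v a"
proof (rule antisym)
  show "v a \<le> v (a + b)" using assms by (intro v_add_geI) auto
  show "v (a + b) \<le> v a"
  proof (rule ccontr)
    assume "\<not> v (a + b) \<le> v a"
    then have "v a < min (v (a + b)) (v (- b))" using assms by simp
    also have "\<dots> \<le> v (a + b + - b)" by (rule v_add_ge)
    finally show False by simp
  qed
qed

lemma v_divide: "b \<noteq> 0 \<Longrightarrow> v (a / b) = v a - v b"
proof -
  assume b: "b \<noteq> 0"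
  obtain r where r: "v b = ereal r" using v_finite[OF b] by blast
  have "v a = v (a / b) + v b" using v_mult[of "a / b" b] b by simp
  then show ?thesis using r by (cases "v (a / b)") auto
qed

lemma v_peval_ge0: "0 \<le> v x \<Longrightarrow> 0 \<le> v (peval p x)"
  by (induction p) (simp_all add: v_add_geI v_mult_ge0 v_emb_ge)

lemma v_peval_neg:
  assumes x: "v x = ereal r" "r < 0" and p: "p \<noteq> 0"
  shows "v (peval p x) = ereal (of_nat (degree p) * r)"
  using p
proof (induction p)
  case (pCons a p)
  show ?case
  proof (cases "p = 0")
    case True
    then show ?thesis using pCons by (simp add: v_emb zero_ereal_def)
  next
    case False
    have e: "v (x * peval p x) = ereal (of_nat (Suc (degree p)) * r)"
      using pCons.IH[OF False] x by (simp add: v_mult algebra_simps)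
    have "of_nat (Suc (degree p)) * r < 0" using x(2) by (simp add: mult_less_0_iff)
    then have "v (x * peval p x) < v (emb a)"
      unfolding e using v_emb_ge[of a] by (metis less_ereal.simps(1) less_le_trans zero_ereal_def)
    then have "v (x * peval p x + emb a) = v (x * peval p x)" by (rule v_add_eq)
    then show ?thesis using False e by (simp add: add.commute)
  qed
qed simp

lemma v_bezout:
  assumes "u * p + w * q = 1" "0 \<le> v x" "0 < v (peval q x)"
  shows "v (peval p x) = 0"
proof -
  have "peval (u * p + w * q) x = 1" unfolding assms(1) by simp
  then have 1: "peval u x * peval p x + peval w x * peval q x = 1" by simp
  have ge: "0 \<le> v (peval p x)" by (rule v_peval_ge0[OF assms(2)])
  moreover have "\<not> 0 < v (peval p x)"
  proof
    assume "0 < v (peval p x)"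
    then have "0 < v (peval u x * peval p x)" "0 < v (peval w x * peval q x)"
      using assms(3) v_peval_ge0[OF assms(2)] by (auto simp: v_mult add_nonneg_pos)
    then have "0 < min (v (peval u x * peval p x)) (v (peval w x * peval q x))" by simp
    also have "\<dots> \<le> v 1" using v_add_ge 1 by metis
    finally show False by simp
  qed
  ultimately show ?thesis by auto
qed

end

section \<open>Changes of coordinates and minimality for constant curves\<close>

lemma change_coords_wb:
  fixes E :: "'a::field weierstrass"
  assumes u: "u \<noteq> 0"
  shows "wb2 (change_coords E (u, r, s, t)) * u ^ 2 = wb2 E + 12 * r"
    "wb4 (change_coords E (u, r, s, t)) * u ^ 4 = wb4 E + r * wb2 E + 6 * r ^ 2"
    "wb6 (change_coords E (u, r, s, t)) * u ^ 6 = wb6 E + 2 * r * wb4 E + r ^ 2 * wb2 E + 4 * r ^ 3"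
    "wb8 (change_coords E (u, r, s, t)) * u ^ 8 =
      wb8 E + 3 * r * wb6 E + 3 * r ^ 2 * wb4 E + r ^ 3 * wb2 E + 3 * r ^ 4"
proof -
  obtain a1 a2 a3 a4 a6 where E: "E = Weierstrass a1 a2 a3 a4 a6" by (cases E)
  obtain c1 c2 c3 c4 c6 where C: "change_coords E (u, r, s, t) = Weierstrass c1 c2 c3 c4 c6"
    by (cases "change_coords E (u, r, s, t)")
  have c: "c1 * u = a1 + 2 * s" "c2 * u ^ 2 = a2 - s * a1 + 3 * r - s ^ 2"
    "c3 * u ^ 3 = a3 + r * a1 + 2 * t"
    "c4 * u ^ 4 = a4 - s * a3 + 2 * r * a2 - (t + r * s) * a1 + 3 * r ^ 2 - 2 * s * t"
    "c6 * u ^ 6 = a6 + r * a4 + r ^ 2 * a2 + r ^ 3 - t * a3 - t ^ 2 - r * t * a1"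
    using C u by (auto simp: E)
  note C = C[unfolded E]
  have "wb2 (Weierstrass c1 c2 c3 c4 c6) * u ^ 2 = (c1 * u) ^ 2 + 4 * (c2 * u ^ 2)"
    by (simp add: wb_defs algebra_simps eval_nat_numeral)
  then show "wb2 (change_coords E (u, r, s, t)) * u ^ 2 = wb2 E + 12 * r"
    unfolding E C c by (simp add: wb_defs algebra_simps eval_nat_numeral)
  have "wb4 (Weierstrass c1 c2 c3 c4 c6) * u ^ 4 = 2 * (c4 * u ^ 4) + (c1 * u) * (c3 * u ^ 3)"
    by (simp add: wb_defs algebra_simps eval_nat_numeral)
  then show "wb4 (change_coords E (u, r, s, t)) * u ^ 4 = wb4 E + r * wb2 E + 6 * r ^ 2"
    unfolding E C c by (simp add: wb_defs algebra_simps eval_nat_numeral)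
  have "wb6 (Weierstrass c1 c2 c3 c4 c6) * u ^ 6 = (c3 * u ^ 3) ^ 2 + 4 * (c6 * u ^ 6)"
    by (simp add: wb_defs algebra_simps eval_nat_numeral)
  then show "wb6 (change_coords E (u, r, s, t)) * u ^ 6 = wb6 E + 2 * r * wb4 E + r ^ 2 * wb2 E + 4 * r ^ 3"
    unfolding E C c by (simp add: wb_defs algebra_simps eval_nat_numeral)
  have "wb8 (Weierstrass c1 c2 c3 c4 c6) * u ^ 8 = (c1 * u) ^ 2 * (c6 * u ^ 6) +
      4 * (c2 * u ^ 2) * (c6 * u ^ 6) - (c1 * u) * (c3 * u ^ 3) * (c4 * u ^ 4) +
      (c2 * u ^ 2) * (c3 * u ^ 3) ^ 2 - (c4 * u ^ 4) ^ 2"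
    by (simp add: wb_defs algebra_simps eval_nat_numeral)
  then show "wb8 (change_coords E (u, r, s, t)) * u ^ 8 =
      wb8 E + 3 * r * wb6 E + 3 * r ^ 2 * wb4 E + r ^ 3 * wb2 E + 3 * r ^ 4"
    unfolding E C c by (simp add: wb_defs algebra_simps eval_nat_numeral)
qed

lemma discriminant_wb:
  "discriminant E = - (wb2 E ^ 2 * wb8 E) - 8 * wb4 E ^ 3 - 27 * wb6 E ^ 2 + 9 * wb2 E * wb4 E * wb6 E"
  by (simp add: discriminant_def wb_defs Let_def)

lemma wb_rel: "4 * wb8 E = wb2 E * wb6 E - wb4 E ^ 2"
  by (simp add: wb_defs algebra_simps eval_nat_numeral)

lemma discriminant_change_coords:
  fixes E :: "'a::field weierstrass"
  assumes u: "u \<noteq> 0"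
  shows "discriminant (change_coords E (u, r, s, t)) * u ^ 12 = discriminant E"
proof -
  define b2 b4 b6 b8 where b: "b2 = wb2 E" "b4 = wb4 E" "b6 = wb6 E" "b8 = wb8 E"
  have rel: "4 * b8 = b2 * b6 - b4 ^ 2" unfolding b by (rule wb_rel)
  let ?C = "change_coords E (u, r, s, t)"
  have "discriminant ?C * u ^ 12 = - ((wb2 ?C * u ^ 2) ^ 2 * (wb8 ?C * u ^ 8)) - 8 * (wb4 ?C * u ^ 4) ^ 3
      - 27 * (wb6 ?C * u ^ 6) ^ 2 + 9 * (wb2 ?C * u ^ 2) * (wb4 ?C * u ^ 4) * (wb6 ?C * u ^ 6)"
    unfolding discriminant_wb by (simp add: algebra_simps eval_nat_numeral)
  also have "\<dots> = - (b2 ^ 2 * b8) - 8 * b4 ^ 3 - 27 * b6 ^ 2 + 9 * b2 * b4 * b6"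
    unfolding change_coords_wb[OF u] b[symmetric] using rel by Groebner_Basis.algebra
  also have "\<dots> = discriminant E" unfolding b discriminant_wb ..
  finally show ?thesis .
qed

context valuation
begin

lemma v_wb_ge0:
  assumes "integral_model v E"
  shows "0 \<le> v (wb2 E)" "0 \<le> v (wb4 E)" "0 \<le> v (wb6 E)" "0 \<le> v (wb8 E)" "0 \<le> v (discriminant E)"
proof -
  have a: "0 \<le> v (wa1 E)" "0 \<le> v (wa2 E)" "0 \<le> v (wa3 E)" "0 \<le> v (wa4 E)" "0 \<le> v (wa6 E)"
    using assms by (cases E; auto simp: integral_model_def)+
  note I = a v_add_geI v_diff_geI v_mult_ge0 v_power_ge0 v_numeral_ge0
  show b: "0 \<le> v (wb2 E)" "0 \<le> v (wb4 E)" "0 \<le> v (wb6 E)" "0 \<le> v (wb8 E)"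
    unfolding wb_defs by (intro I)+
  show "0 \<le> v (discriminant E)"
    unfolding discriminant_wb v_uminus minus_mult_left[symmetric]
    by (intro v_add_geI v_diff_geI) (simp_all add: b v_mult_ge0 v_power_ge0 v_numeral_ge0)
qed

lemma integral_model_map: "integral_model v (map_weierstrass emb E)"
  by (cases E) (simp add: integral_model_def v_emb_ge)

text \<open>The constant equation has unit discriminant, so a minimal one has too, and the factor
  \<open>u^12\<close> between them is a unit. A pole of \<open>r\<close> would survive in the term
  \<open>3 r^4\<close> of the transformed \<open>b8\<close> or, when \<open>3 = 0\<close>, in the
  term \<open>4 r^3 = r^3\<close> of the transformed \<open>b6\<close>, since all other terms have
  poles of smaller order.\<close>

lemma minimal_change_bounds:
  assumes E: "elliptic_curve E" and m: "minimal_change v (map_weierstrass emb E) (u, r, s, t)"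
  shows "u \<noteq> 0" "v u = 0" "0 \<le> v r"
proof -
  let ?E = "map_weierstrass emb E" let ?C = "change_coords ?E (u, r, s, t)"
  show u: "u \<noteq> 0" using m by (simp add: minimal_change_def)
  have C: "integral_model v ?C" using m by (simp add: minimal_change_def)
  have id: "change_coords ?E (1, 0, 0, 0) = ?E" by (cases E) simp
  have "v (discriminant ?C) \<le> v (discriminant (change_coords ?E (1, 0, 0, 0)))"
    using m integral_model_map[of E] id unfolding minimal_change_def by (metis fst_conv zero_neq_one)
  also have "\<dots> = 0" unfolding id discriminant_map using E by (simp add: v_emb elliptic_curve_def)
  finally have dC: "v (discriminant ?C) = 0" using v_wb_ge0(5)[OF C] by (rule antisym)
  obtain w where w: "v u = ereal w" using v_finite[OF u] by blast
  have "v (discriminant ?C * u ^ 12) = 0"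
    unfolding discriminant_change_coords[OF u] discriminant_map using E by (simp add: v_emb elliptic_curve_def)
  then have "w = 0" unfolding v_mult dC v_power[OF w] by (simp add: zero_ereal_def)
  then show vu: "v u = 0" using w by (simp add: zero_ereal_def)
  have up: "v (u ^ k) = 0" for k using v_power[OF w] \<open>w = 0\<close> by (simp add: zero_ereal_def)
  show "0 \<le> v r"
  proof (rule ccontr)
    assume neg: "\<not> 0 \<le> v r"
    then have "r \<noteq> 0" by auto
    then obtain q where q: "v r = ereal q" using v_finite by blast
    have q0: "q < 0" using neg q by simp
    note b = v_wb_ge0[OF integral_model_map[of E]] and b' = v_wb_ge0[OF C]
    note p = v_power[OF q]
    have mono: "c \<le> v (a * b)" if "0 \<le> v a" "c \<le> v b" for a b c
      using add_mono[OF that] by (simp add: v_mult)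
    have pos: "ereal x \<le> v a" if "x \<le> 0" "0 \<le> v a" for x a
      using that by (metis ereal_less_eq(3) order_trans zero_ereal_def)
    have v3: "0 \<le> v 3" "0 \<le> v 2" using v_numeral_ge0 by auto
    show False
    proof (cases "(3::'k) = 0")
      case False
      then have "v 3 = 0" using v_emb[of 3] by (simp add: emb_numeral)
      then have v4: "v (3 * r ^ 4) = ereal (4 * q)" by (simp add: v_mult p)
      have e: "3 * r ^ 4 = wb8 ?C * u ^ 8 - wb8 ?E - wb6 ?E * 3 * r - wb4 ?E * 3 * r ^ 2 - wb2 ?E * r ^ 3"
        unfolding change_coords_wb[OF u] by (simp add: algebra_simps)
      have "ereal (3 * q) \<le> v (wb8 ?C * u ^ 8)" "ereal (3 * q) \<le> v (wb8 ?E)"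
        using mono[OF b'(4), of "ereal (3 * q)" "u ^ 8"] pos[OF _ b(4), of "3 * q"] q0 up[of 8] by simp_all
      moreover have "ereal (3 * q) \<le> v (wb6 ?E * 3 * r)" "ereal (3 * q) \<le> v (wb4 ?E * 3 * r ^ 2)"
        by (rule mono, rule v_mult_ge0[OF b(3) v3(1)], use q q0 in simp)
          (rule mono, rule v_mult_ge0[OF b(2) v3(1)], use p[of 2] q0 in simp)
      moreover have "ereal (3 * q) \<le> v (wb2 ?E * r ^ 3)"
        by (rule mono, rule b(1), use p[of 3] q0 in simp)
      ultimately have "ereal (3 * q) \<le> v (3 * r ^ 4)"
        unfolding e by (intro v_diff_geI)
      then show False using v4 q0 by simp
    next
      case True
      have "(4::'k) = 3 + 1" by simp
      then have "(4::'k) = 1" unfolding True by simp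
      then have "(4::'f) = 1" by (metis emb_numeral emb_one)
      then have e: "r ^ 3 = wb6 ?C * u ^ 6 - wb6 ?E - wb4 ?E * 2 * r - wb2 ?E * r ^ 2"
        unfolding change_coords_wb[OF u] by (simp add: algebra_simps)
      have "ereal (2 * q) \<le> v (wb6 ?C * u ^ 6)" "ereal (2 * q) \<le> v (wb6 ?E)"
        using mono[OF b'(3), of "ereal (2 * q)" "u ^ 6"] pos[OF _ b(3), of "2 * q"] q0 up[of 6] by simp_all
      moreover have "ereal (2 * q) \<le> v (wb4 ?E * 2 * r)" "ereal (2 * q) \<le> v (wb2 ?E * r ^ 2)"
        by (rule mono, rule v_mult_ge0[OF b(2) v3(2)], use q q0 in simp)
          (rule mono, rule b(1), use p[of 2] q0 in simp)
      ultimately have "ereal (2 * q) \<le> v (r ^ 3)"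
        unfolding e by (intro v_diff_geI)
      then show False using p[of 3] q0 by simp
    qed
  qed
qed

text \<open>The identity change attains discriminant valuation 0, so a minimal change exists and the
  chosen one is minimal; its unit \<open>u\<close> and integral \<open>r\<close> leave the order of
  a pole of \<open>x\<close> unchanged.\<close>

lemma minimal_x_pole_order:
  assumes E: "elliptic_curve E"
  shows "max (- (v (minimal_x v (map_weierstrass emb E) x) / 2)) 0 = max (- (v x / 2)) 0"
proof -
  let ?E = "map_weierstrass emb E"
  have id: "change_coords ?E (1, 0, 0, 0) = ?E" by (cases E) simp
  have "minimal_change v ?E (1, 0, 0, 0)"
    unfolding minimal_change_def
  proof (intro conjI allI impI)
    fix c' assume c': "fst c' \<noteq> 0 \<and> integral_model v (change_coords ?E c')"
    have "v (discriminant (change_coords ?E (1, 0, 0, 0))) = 0"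
      unfolding id discriminant_map using E by (simp add: v_emb elliptic_curve_def)
    then show "v (discriminant (change_coords ?E (1, 0, 0, 0))) \<le> v (discriminant (change_coords ?E c'))"
      using v_wb_ge0(5) c' by simp
  qed (simp_all only: id integral_model_map, simp)
  then have m: "minimal_change v ?E (SOME c. minimal_change v ?E c)" by (rule someI)
  obtain u r s t where c: "(SOME c. minimal_change v ?E c) = (u, r, s, t)" by (metis prod.collapse)
  note b = minimal_change_bounds[OF E m[unfolded c]]
  have "v (u ^ 2) = 0" using b(2) by (simp add: power2_eq_square v_mult)
  then have e: "v (minimal_x v ?E x) = v (x - r)"
    using b(1) by (simp add: minimal_x_def c v_divide)
  show ?thesis
  proof (cases "v x < 0")
    case True
    then have "v (x + - r) = v x" using b(3) by (intro v_add_eq) auto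
    then show ?thesis unfolding e by simp
  next
    case False
    then have "0 \<le> v (x - r)" "0 \<le> v x" using b(3) v_diff_geI by auto
    then have "0 \<le> v (x - r) / 2" "0 \<le> v x / 2" by (simp_all add: zero_le_divide_ereal)
    then show ?thesis unfolding e by (simp add: max_def)
  qed
qed

lemma eds_eq:
  assumes "elliptic_curve E" "ec_mult (map_weierstrass emb E) n P = Affine x y"
  shows "eds (map_weierstrass emb E) P n v = max (- (v x / 2)) 0"
  using minimal_x_pole_order[OF assms(1)] assms(2) by (simp add: eds_def point_divisor_def)

end


text \<open>
  A valuation of \<open>F\<close> above the place \<open>x(P) = x(Q)\<close>, for a geometric point \<open>Q\<close> of exact order
  \<open>n\<close>, is primitive: the numerator and the denominator of \<open>x(m P)\<close> have no common zero.
\<close>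

lemma (in field_embedding) primitive_valuation_exists:
  assumes E: "elliptic_curve E" and P: "Affine x y \<in> ec_points (map_weierstrass emb E)"
    and inf: "infinite_order (map_weierstrass emb E) (Affine x y)" and n: "n > 0"
    and x: "\<And>q. q \<noteq> 0 \<Longrightarrow> peval q x \<noteq> 0"
    and places: "\<And>t. (\<And>q. q \<noteq> 0 \<Longrightarrow> peval q t \<noteq> 0) \<Longrightarrow> \<exists>v. is_valuation emb v \<and> 0 < v t"
    and ord: "\<not> CHAR('k) dvd n \<or> ordinary E"
  shows "\<exists>v. primitive_valuation emb (map_weierstrass emb E) (Affine x y) n v"
proof -
  let ?E = "map_weierstrass emb E" and ?P = "Affine x y"
  obtain xm ym where xym: "\<And>m. m > 0 \<Longrightarrow> ec_mult ?E m ?P = Affine (xm m) (ym m)"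
  proof -
    have "\<forall>m. \<exists>a b. m > 0 \<longrightarrow> ec_mult ?E m ?P = Affine a b"
      using inf unfolding infinite_order_def by (metis ec_point.exhaust)
    then show ?thesis using that by metis
  qed
  have frac: "xm m = peval (mult_num E m) x / peval (mult_den E m) x" if "m > 0" for m
    using has_x_mult[OF E P, of m] xym[OF that] by auto
  show ?thesis
  proof (cases "n = 1")
    case True
    \<comment> \<open>Order 1 corresponds to \<open>Q\<close> at infinity: the valuation must be a
      zero of \<open>1 / x\<close>, whose transcendence is checked with the reversed
      polynomial.\<close>
    have x0: "x \<noteq> 0" using x[of "[:0, 1:]"] by (auto simp: emb_one)
    have "\<exists>v. is_valuation emb v \<and> 0 < v (1 / x)"
    proof (rule places)
      fix q :: "'k poly" assume q: "q \<noteq> 0"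
      have "peval (reflect_poly q) x = x ^ degree q * peval q (inverse x)"
      proof -
        have m: "map_poly emb (reflect_poly q) = reflect_poly (map_poly emb q)"
          by (rule poly_eqI) (simp add: coeff_map_poly coeff_reflect_poly)
        show ?thesis unfolding peval_def m using poly_reflect_poly_nz[OF x0] by simp
      qed
      moreover have "peval (reflect_poly q) x \<noteq> 0" using q by (intro x) simp
      ultimately show "peval q (1 / x) \<noteq> 0" by (auto simp: inverse_eq_divide)
    qed
    then obtain v where v: "is_valuation emb v" "0 < v (1 / x)" by blast
    interpret valuation emb v by standard (rule v)
    have "v x < 0" using v(2) v_finite[OF x0] by (auto simp: v_divide[OF x0] zero_ereal_def)
    then have "- (v x / 2) > 0" using v_finite[OF x0] by (auto simp: zero_ereal_def)
    then have "eds ?E ?P 1 v > 0" using eds_eq[OF E, of 1 ?P x y] by simp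
    then show ?thesis using v(1) True by (auto simp: primitive_valuation_def)
  next
    case False
    then obtain Q where Q: "Q \<in> ec_points (map_weierstrass to_ac E)"
      "\<And>k. ec_mult (map_weierstrass to_ac E) k Q = Infty \<longleftrightarrow> n dvd k"
      using exact_order_exists'[OF E n ord] unfolding exact_order_def[OF E] by blast
    have "Q \<noteq> Infty" using Q(2)[of 1] False by auto
    then obtain a b where ab: "Q = Affine a b" by (cases Q) auto
    have den: "to_ac.peval (mult_den E m) a = 0 \<longleftrightarrow> n dvd m" for m
      using has_x_Infty_iff[OF to_ac.has_x_mult[OF E Q(1)[unfolded ab], of m]] Q(2)[of m] ab by simp
    \<comment> \<open>\<open>h\<close> will be the minimal polynomial over \<open>K\<close> of
      \<open>a = x(Q)\<close>, up to a constant. The denominator with index \<open>n\<close> shows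
      that there is a nonzero polynomial vanishing at \<open>a\<close>.\<close>
    define S where "S = {h :: 'k poly. h \<noteq> 0 \<and> to_ac.peval h a = 0}"
    have dS: "mult_den E n \<in> S" using den[of n] mult_num_den(4)[OF E n] by (simp add: S_def)
    define h where "h = arg_min degree (\<lambda>h. h \<in> S)"
    have h: "h \<in> S" "\<And>g. g \<in> S \<Longrightarrow> degree h \<le> degree g"
      using arg_min_nat_lemma[of "\<lambda>h. h \<in> S" "mult_den E n" degree] dS by (auto simp: h_def)
    have h0: "h \<noteq> 0" "to_ac.peval h a = 0" using h(1) by (auto simp: S_def)
    \<comment> \<open>Irreducibility of \<open>h\<close> as a dichotomy: one of the factors in
      \<open>h = d * e\<close> vanishes at \<open>a\<close> and therefore has full degree.\<close>
    have hdvd: "h dvd g \<or> (\<exists>u w. u * h + w * g = 1)" for g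
    proof -
      obtain d u w where d: "d dvd h" "d dvd g" "d = u * h + w * g" using bezout_poly by blast
      obtain e where e: "h = d * e" using d(1) by (auto elim: dvdE)
      have de: "d \<noteq> 0" "e \<noteq> 0" using e h0 by auto
      have "to_ac.peval d a = 0 \<or> to_ac.peval e a = 0" using h0(2) e by simp
      then show ?thesis
      proof
        assume "to_ac.peval d a = 0"
        then have "degree h \<le> degree d" using h(2) de by (simp add: S_def)
        then have "degree e = 0" using e degree_mult_eq[OF de] by simp
        then obtain c where c: "e = [:c:]" by (rule degree_eq_zeroE)
        then have "h dvd d" using de e by (simp add: smult_dvd)
        then show ?thesis using d(2) dvd_trans by blast
      next
        assume "to_ac.peval e a = 0"
        then have "degree h \<le> degree e" using h(2) de by (simp add: S_def)
        then have "degree d = 0" using e degree_mult_eq[OF de] by simp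
        then obtain c where c: "d = [:c:]" by (rule degree_eq_zeroE)
        then have "c \<noteq> 0" using de by auto
        then have "([:inverse c:] * u) * h + ([:inverse c:] * w) * g = 1"
          using d(3) c by (metis (no_types, lifting) one_pCons distrib_left mult.assoc mult_pCons_left
              smult_0_left pCons_0_0 add.right_neutral mult_smult_left right_inverse smult_pCons smult_0_right mult_zero_left left_inverse)
        then show ?thesis by blast
      qed
    qed
    have dh: "degree h > 0"
    proof (rule ccontr)
      assume "\<not> degree h > 0"
      then obtain c where "h = [:c:]" by (auto elim: degree_eq_zeroE)
      then show False using h0 by simp
    qed
    \<comment> \<open>\<open>h(x)\<close> is transcendental because \<open>h\<close> is nonconstant,
      so it has a zero; this is a place above \<open>x = a\<close>.\<close>
    have "\<exists>v. is_valuation emb v \<and> 0 < v (peval h x)"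
    proof (rule places)
      fix q :: "'k poly" assume q: "q \<noteq> 0"
      have "peval (pcompose q h) x = peval q (peval h x)"
        by (induction q) (simp_all add: pcompose_pCons)
      moreover have "pcompose q h \<noteq> 0" using q dh by (metis degree_pCons_0 pcompose_eq_0 less_numeral_extra(3))
      ultimately show "peval q (peval h x) \<noteq> 0" using x by metis
    qed
    then obtain v where v: "is_valuation emb v" "0 < v (peval h x)" by blast
    interpret valuation emb v by standard (rule v)
    have vx: "0 \<le> v x"
    proof (rule ccontr)
      assume neg: "\<not> 0 \<le> v x"
      then have "x \<noteq> 0" by auto
      then obtain r where r: "v x = ereal r" using v_finite by blast
      then have "r < 0" using neg by simp
      then have "v (peval h x) < 0"
        using v_peval_neg[OF r _ h0(1)] dh by (simp add: zero_ereal_def mult_less_0_iff)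
      then show False using v(2) by simp
    qed
    have eds: "eds ?E ?P m v = max (- (v (xm m) / 2)) 0" if "m > 0" for m
      using eds_eq[OF E xym[OF that]] .
    have "eds ?E ?P n v > 0"
    proof -
      have "h dvd mult_den E n"
        using hdvd[of "mult_den E n"]
      proof
        assume "\<exists>u w. u * h + w * mult_den E n = 1"
        then obtain u w where "u * h + w * mult_den E n = 1" by blast
        then have "to_ac.peval (u * h + w * mult_den E n) a = 1" by simp
        then show ?thesis using h0(2) den[of n] by simp
      qed
      then obtain k where k: "mult_den E n = h * k" by (auto elim: dvdE)
      have vd: "0 < v (peval (mult_den E n) x)"
        unfolding k using v(2) v_peval_ge0[OF vx, of k] by (simp add: v_mult add_pos_nonneg)
      obtain u w where "u * mult_num E n + w * mult_den E n = 1" using mult_num_den(6)[OF E] by blast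
      then have vn: "v (peval (mult_num E n) x) = 0" by (rule v_bezout[OF _ vx vd])
      have dn: "peval (mult_den E n) x \<noteq> 0" by (rule x[OF mult_num_den(4)[OF E n]])
      then obtain r where "v (peval (mult_den E n) x) = ereal r" using v_finite by blast
      then have "0 < - (v (xm n) / 2)"
        using vd vn unfolding frac[OF n] v_divide[OF dn] by (simp add: zero_ereal_def)
      then show ?thesis unfolding eds[OF n] by simp
    qed
    moreover have "eds ?E ?P m v = 0" if m: "1 \<le> m" "m < n" for m
    proof -
      have m0: "m > 0" using m by simp
      \<comment> \<open>\<open>m < n\<close> is no multiple of the order of \<open>Q\<close>, so
        \<open>h\<close> is coprime to the denominator of \<open>x(mP)\<close>, which is then a unit
        at \<open>v\<close>.\<close>
      have "to_ac.peval (mult_den E m) a \<noteq> 0" unfolding den using nat_dvd_not_less[OF m0 m(2)] .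
      then have "\<not> h dvd mult_den E m" using h0(2) by (auto elim!: dvdE)
      then obtain u w where uw: "w * mult_den E m + u * h = 1" using hdvd by (metis add.commute)
      have "v (peval (mult_den E m) x) = 0" by (rule v_bezout[OF uw vx v(2)])
      moreover have "peval (mult_den E m) x \<noteq> 0" by (rule x[OF mult_num_den(4)[OF E m0]])
      ultimately have "0 \<le> v (xm m)" unfolding frac[OF m0] using v_peval_ge0[OF vx] by (simp add: v_divide)
      then have "0 \<le> v (xm m) / 2" by (simp add: zero_le_divide_ereal)
      then show ?thesis unfolding eds[OF m0] by (simp add: max_def)
    qed
    ultimately show ?thesis using v(1) by (auto simp: primitive_valuation_def)
  qed
qed

text \<open>Put \<open>R = (n / p) P\<close>. As the denominator with index \<open>p\<close> is a
  nonzero constant, \<open>x(p R)\<close> has a pole exactly where \<open>x(R)\<close> does, of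
  \<open>p^2\<close> times the order.\<close>

lemma (in valuation) eds_supersingular:
  assumes E: "elliptic_curve E" and P: "P \<in> ec_points (map_weierstrass emb E)"
    and inf: "infinite_order (map_weierstrass emb E) P" and n: "n > 0" "CHAR('k) dvd n"
    and ss: "supersingular E"
  shows "eds (map_weierstrass emb E) P n v =
    ereal (real (CHAR('k) ^ 2)) * eds (map_weierstrass emb E) P (n div CHAR('k)) v"
proof -
  let ?E = "map_weierstrass emb E" and ?p = "CHAR('k)"
  have p: "?p > 0" using ss by (simp add: supersingular_def)
  obtain m where m: "n = ?p * m" using n(2) by (auto elim: dvdE)
  then have m0: "m > 0" using n(1) by simp
  have E': "elliptic_curve ?E" using E by simp
  obtain a b where ab: "ec_mult ?E m P = Affine a b"
    using inf m0 unfolding infinite_order_def by (metis ec_point.exhaust)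
  obtain c d where cd: "ec_mult ?E n P = Affine c d"
    using inf n(1) unfolding infinite_order_def by (metis ec_point.exhaust)
  have Q: "Affine a b \<in> ec_points ?E" using ec_mult_closed[OF E' P, of m] ab by simp
  have "ec_mult ?E ?p (Affine a b) = Affine c d"
    using ec_mult_mult[OF E' P, of ?p m] ab cd m by simp
  then have hx: "has_x (Affine c d) (peval (mult_num E ?p) a) (peval (mult_den E ?p) a)"
    using has_x_mult[OF E Q, of ?p] by simp
  obtain e where e: "mult_den E ?p = [:e:]"
    using supersingular_den_constant[OF E ss] by (rule degree_eq_zeroE)
  have e0: "e \<noteq> 0" using hx e by auto
  have c: "v c = v (peval (mult_num E ?p) a)"
    using hx e e0 by (simp add: v_mult v_emb)
  note num = mult_num_den(1,2)[OF E, of ?p]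
  have "max (- (v c / 2)) 0 = ereal (real (?p ^ 2)) * max (- (v a / 2)) 0"
  proof (cases "0 \<le> v a")
    case True
    then have "0 \<le> v a / 2" "0 \<le> v c / 2" unfolding c using v_peval_ge0[OF True] by (simp_all add: zero_le_divide_ereal)
    then show ?thesis by (simp add: max_def)
  next
    case False
    then have "a \<noteq> 0" by auto
    then obtain r where r: "v a = ereal r" using v_finite by blast
    have "r < 0" using False r by simp
    moreover have "mult_num E ?p \<noteq> 0" using num(2) by auto
    ultimately have "v c = ereal (real (?p ^ 2) * r)" unfolding c using v_peval_neg[OF r] num(1) by simp
    moreover have "real (?p ^ 2) * r \<le> 0" using \<open>r < 0\<close> by (simp add: mult_nonneg_nonpos)
    ultimately show ?thesis using r \<open>r < 0\<close> by (simp add: max_def zero_ereal_def)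
  qed
  then show ?thesis
    using eds_eq[OF E cd] eds_eq[OF E ab] m p by simp
qed

subsection \<open>Linear algebra over subfields\<close>

text \<open>Subfields are sets inside the fixed \<open>F\<close> because the base varies:
  \<open>K\<close>, \<open>K(t)\<close>, \<open>K(t^p)\<close>, \<open>K F^p\<close> and finite
  extensions of some of these all occur.\<close>

locale subfield_set =
  fixes M :: "'f::field set"
  assumes sf_one: "1 \<in> M"
    and sf_diff: "a \<in> M \<Longrightarrow> b \<in> M \<Longrightarrow> a - b \<in> M"
    and sf_mult: "a \<in> M \<Longrightarrow> b \<in> M \<Longrightarrow> a * b \<in> M"
    and sf_inverse: "a \<in> M \<Longrightarrow> inverse a \<in> M"
begin

lemma sf_zero: "0 \<in> M" using sf_diff[OF sf_one sf_one] by simp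
lemma sf_uminus: "a \<in> M \<Longrightarrow> - a \<in> M" using sf_diff[OF sf_zero] by simp
lemma sf_add: "a \<in> M \<Longrightarrow> b \<in> M \<Longrightarrow> a + b \<in> M" using sf_diff[OF _ sf_uminus] by force
lemma sf_divide: "a \<in> M \<Longrightarrow> b \<in> M \<Longrightarrow> a / b \<in> M" by (simp add: divide_inverse sf_mult sf_inverse)
lemma sf_power: "a \<in> M \<Longrightarrow> a ^ n \<in> M" by (induction n) (simp_all add: sf_one sf_mult)
lemma sf_sum: "(\<And>i. i \<in> I \<Longrightarrow> f i \<in> M) \<Longrightarrow> sum f I \<in> M"
  by (induction I rule: infinite_finite_induct) (simp_all add: sf_zero sf_add)
lemma sf_prod: "(\<And>i. i \<in> I \<Longrightarrow> f i \<in> M) \<Longrightarrow> prod f I \<in> M"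
  by (induction I rule: infinite_finite_induct) (simp_all add: sf_one sf_mult)

end

inductive_set lin_span :: "'f::field set \<Rightarrow> 'f set \<Rightarrow> 'f set" for M S where
  zero: "0 \<in> lin_span M S"
| step: "c \<in> M \<Longrightarrow> s \<in> S \<Longrightarrow> x \<in> lin_span M S \<Longrightarrow> c * s + x \<in> lin_span M S"

lemma lin_span_add: "x \<in> lin_span M S \<Longrightarrow> y \<in> lin_span M S \<Longrightarrow> x + y \<in> lin_span M S"
  by (induction rule: lin_span.induct) (auto simp: add.assoc intro: lin_span.step)

lemma lin_span_mono: "x \<in> lin_span M S \<Longrightarrow> M \<subseteq> M' \<Longrightarrow> S \<subseteq> S' \<Longrightarrow> x \<in> lin_span M' S'"
  by (induction rule: lin_span.induct) (auto intro: lin_span.intros)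

lemma lin_span_single: "c \<in> M \<Longrightarrow> s \<in> S \<Longrightarrow> c * s \<in> lin_span M S"
  using lin_span.step[OF _ _ lin_span.zero] by force

lemma lin_span_sum: "(\<And>i. i \<in> I \<Longrightarrow> f i \<in> lin_span M S) \<Longrightarrow> sum f I \<in> lin_span M S"
  by (induction I rule: infinite_finite_induct) (auto intro: lin_span_add lin_span.zero)

context subfield_set
begin

lemma lin_span_scale: "x \<in> lin_span M S \<Longrightarrow> c \<in> M \<Longrightarrow> c * x \<in> lin_span M S"
proof (induction rule: lin_span.induct)
  case (step d s x)
  then have "(c * d) * s + c * x \<in> lin_span M S" by (intro lin_span.step sf_mult)
  then show ?case by (simp add: algebra_simps)
qed (simp add: lin_span.zero)

lemma lin_span_base: "s \<in> S \<Longrightarrow> s \<in> lin_span M S"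
  using lin_span_single[OF sf_one, of s] by simp

lemma lin_span_uminus: "x \<in> lin_span M S \<Longrightarrow> - x \<in> lin_span M S"
  using lin_span_scale[OF _ sf_uminus[OF sf_one]] by simp

lemma lin_span_trans: "x \<in> lin_span M S \<Longrightarrow> S \<subseteq> lin_span M T \<Longrightarrow> x \<in> lin_span M T"
  by (induction rule: lin_span.induct) (auto intro: lin_span.zero lin_span_add lin_span_scale)

lemma lin_span_tower:
  assumes "x \<in> lin_span N T" "N \<subseteq> lin_span M S"
  shows "x \<in> lin_span M ((\<lambda>(s, t). s * t) ` (S \<times> T))"
  using assms(1)
proof (induction rule: lin_span.induct)
  case (step c t x)
  have "c * t \<in> lin_span M ((\<lambda>(s, t). s * t) ` (S \<times> T))" if "c \<in> lin_span M S"
    using that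
  proof (induction rule: lin_span.induct)
    case (step d s y)
    have "d * (s * t) \<in> lin_span M ((\<lambda>(s, t). s * t) ` (S \<times> T))"
      using step \<open>t \<in> T\<close> by (intro lin_span_single) auto
    then show ?case using lin_span_add step.IH by (simp add: algebra_simps)
  qed (simp add: lin_span.zero)
  then show ?case using step assms(2) by (intro lin_span_add) auto
qed (simp add: lin_span.zero)

lemma lin_span_insert_cases:
  assumes "x \<in> lin_span M (insert s S)"
  obtains c y where "c \<in> M" "y \<in> lin_span M S" "x = c * s + y"
proof -
  from assms have "\<exists>c\<in>M. \<exists>y\<in>lin_span M S. x = c * s + y"
  proof (induction rule: lin_span.induct)
    case zero
    show ?case by (rule bexI[OF _ sf_zero], rule bexI[OF _ lin_span.zero]) simp
  next
    case (step d s' x)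
    then obtain c y where cy: "c \<in> M" "y \<in> lin_span M S" "x = c * s + y" by blast
    show ?case
    proof (cases "s' = s")
      case True
      have "d * s' + x = (d + c) * s + y" using cy True by (simp add: algebra_simps)
      then show ?thesis using cy step(1) sf_add by blast
    next
      case False
      then have "d * s' + y \<in> lin_span M S" using step cy by (intro lin_span.step) auto
      moreover have "d * s' + x = c * s + (d * s' + y)" using cy by (simp add: algebra_simps)
      ultimately show ?thesis using cy by blast
    qed
  qed
  then show ?thesis using that by blast
qed

text \<open>Gaussian elimination: a member with nonzero coefficient at \<open>s\<close> serves as
  pivot and clears \<open>s\<close> from the others. The family is indexed, so repeated values count
  separately.\<close>

lemma lin_dependent:
  assumes "finite S" "finite J" "card S < card J" "\<And>j. j \<in> J \<Longrightarrow> g j \<in> lin_span M S"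
  shows "\<exists>a. (\<forall>j\<in>J. a j \<in> M) \<and> (\<exists>j\<in>J. a j \<noteq> 0) \<and> (\<Sum>j\<in>J. a j * g j) = 0"
  using assms
proof (induction S arbitrary: J g rule: finite_induct)
  case empty
  have "x = 0" if "x \<in> lin_span M {}" for x using that by (induction rule: lin_span.induct) auto
  then have "\<forall>j\<in>J. g j = 0" using empty by blast
  moreover have "J \<noteq> {}" using empty by auto
  ultimately show ?case using sf_one by (intro exI[of _ "\<lambda>_. 1"]) auto
next
  case (insert s S)
  have "\<forall>j\<in>J. \<exists>c y. c \<in> M \<and> y \<in> lin_span M S \<and> g j = c * s + y"
  proof
    fix j assume "j \<in> J"
    then have "g j \<in> lin_span M (insert s S)" by (rule insert.prems(3))
    then show "\<exists>c y. c \<in> M \<and> y \<in> lin_span M S \<and> g j = c * s + y"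
      by (rule lin_span_insert_cases) blast
  qed
  then obtain c y where cy: "\<And>j. j \<in> J \<Longrightarrow> c j \<in> M \<and> y j \<in> lin_span M S \<and> g j = c j * s + y j"
    by metis
  show ?case
  proof (cases "\<forall>j\<in>J. c j = 0")
    case True
    then have "\<And>j. j \<in> J \<Longrightarrow> g j \<in> lin_span M S" using cy by auto
    moreover have "card S < card J" using insert by simp
    ultimately show ?thesis using insert.IH insert.prems(1) by blast
  next
    case False
    then obtain j0 where j0: "j0 \<in> J" "c j0 \<noteq> 0" by blast
    let ?J = "J - {j0}" and ?g = "\<lambda>j. g j - c j / c j0 * g j0"
    have "?g j \<in> lin_span M S" if "j \<in> ?J" for j
    proof -
      have "?g j = y j + (- (c j / c j0)) * y j0" using cy[of j] cy[of j0] that j0 by (simp add: field_simps)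
      moreover have "- (c j / c j0) \<in> M" using cy[of j] cy[of j0] that j0 sf_uminus sf_divide by blast
      moreover have "y j \<in> lin_span M S" "y j0 \<in> lin_span M S" using cy[of j] cy[of j0] that j0 by auto
      ultimately show ?thesis by (simp only: lin_span_add lin_span_scale)
    qed
    moreover have "card S < card ?J" using insert j0 by simp
    ultimately obtain a where a: "\<forall>j\<in>?J. a j \<in> M" "\<exists>j\<in>?J. a j \<noteq> 0" "(\<Sum>j\<in>?J. a j * ?g j) = 0"
      using insert.IH[of ?J ?g] insert.prems(1) by blast
    define a' where "a' = (\<lambda>j. if j = j0 then - (\<Sum>j\<in>?J. a j * (c j / c j0)) else a j)"
    have "(\<Sum>j\<in>?J. a j * (c j / c j0)) \<in> M"
      using a(1) cy j0 by (intro sf_sum sf_mult sf_divide) auto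
    then have 1: "\<forall>j\<in>J. a' j \<in> M" using a(1) sf_uminus by (auto simp: a'_def)
    have 2: "\<exists>j\<in>J. a' j \<noteq> 0" using a(2) by (auto simp: a'_def)
    have "(\<Sum>j\<in>J. a' j * g j) = a' j0 * g j0 + (\<Sum>j\<in>?J. a' j * g j)"
      using insert.prems(1) j0 by (simp add: sum.remove)
    also have "(\<Sum>j\<in>?J. a' j * g j) = (\<Sum>j\<in>?J. a j * g j)"
      by (intro sum.cong) (auto simp: a'_def)
    also have "a' j0 * g j0 + (\<Sum>j\<in>?J. a j * g j) = (\<Sum>j\<in>?J. a j * ?g j)"
      by (simp add: a'_def sum_distrib_right right_diff_distrib sum_subtractf mult.assoc)
    finally have "(\<Sum>j\<in>J. a' j * g j) = 0" using a(3) by simp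
    then show ?thesis using 1 2 by blast
  qed
qed

section \<open>Algebraic elements and finite extensions\<close>

definition algebraic_over :: "'f \<Rightarrow> bool" where
  "algebraic_over z \<longleftrightarrow> (\<exists>p. p \<noteq> 0 \<and> (\<forall>i. coeff p i \<in> M) \<and> poly p z = 0)"

lemma algebraic_overI_powers:
  assumes "finite S" "\<And>i. z ^ i \<in> lin_span M S"
  shows "algebraic_over z"
proof -
  obtain a where a: "\<forall>j\<in>{..card S}. a j \<in> M" "\<exists>j\<in>{..card S}. a j \<noteq> 0" "(\<Sum>j\<in>{..card S}. a j * z ^ j) = 0"
    using lin_dependent[of S "{..card S}" "\<lambda>j. z ^ j"] assms by auto
  define p where "p = (\<Sum>j\<le>card S. monom (a j) j)"
  have c: "coeff p i = (if i \<le> card S then a i else 0)" for i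
    by (simp add: p_def coeff_sum coeff_monom if_distrib sum.delta cong: if_cong)
  have "p \<noteq> 0" using a(2) c by (metis atMost_iff coeff_0)
  moreover have "\<forall>i. coeff p i \<in> M" using a(1) by (simp add: c sf_zero)
  moreover have "poly p z = 0" using a(3) by (simp add: p_def poly_sum poly_monom)
  ultimately show ?thesis by (auto simp: algebraic_over_def)
qed

lemma algebraic_over_powers:
  assumes "algebraic_over z"
  obtains d where "\<And>n. z ^ n \<in> lin_span M ((\<lambda>i. z ^ i) ` {..<d})"
proof -
  obtain p where p: "p \<noteq> 0" "\<forall>i. coeff p i \<in> M" "poly p z = 0"
    using assms by (auto simp: algebraic_over_def)
  define d where "d = degree p"
  let ?S = "(\<lambda>i. z ^ i) ` {..<d}"
  have lc: "coeff p d \<noteq> 0" using p(1) by (simp add: d_def)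
  have "(\<Sum>i\<le>d. coeff p i * z ^ i) = 0" using p(3) by (simp add: poly_altdef d_def)
  then have "coeff p d * z ^ d = - (\<Sum>i<d. coeff p i * z ^ i)"
    by (simp add: lessThan_Suc_atMost[symmetric] eq_neg_iff_add_eq_0 add.commute)
  then have "inverse (coeff p d) * (coeff p d * z ^ d) =
      inverse (coeff p d) * (- (\<Sum>i<d. coeff p i * z ^ i))" by simp
  then have zd: "z ^ d = (\<Sum>i<d. - (inverse (coeff p d) * coeff p i) * z ^ i)"
    using lc by (simp add: sum_distrib_left sum_negf mult.assoc flip: mult.assoc[of "inverse (coeff p d)" "coeff p d"])
  have z: "z ^ d \<in> lin_span M ?S"
    unfolding zd using p(2) by (intro lin_span_sum lin_span_single sf_uminus sf_mult sf_inverse) auto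
  have m: "z * x \<in> lin_span M ?S" if "x \<in> lin_span M ?S" for x
    using that
  proof (induction rule: lin_span.induct)
    case (step c s x)
    then obtain i where i: "i < d" "s = z ^ i" by auto
    have "z * s \<in> lin_span M ?S"
    proof (cases "Suc i = d")
      case True
      then show ?thesis using z i by auto
    next
      case False
      then have "Suc i \<in> {..<d}" using i by auto
      then have "z ^ Suc i \<in> ?S" by (rule imageI)
      then show ?thesis using lin_span_base[of "z ^ Suc i" ?S] i(2) by simp
    qed
    then have "c * (z * s) + z * x \<in> lin_span M ?S"
      using step lin_span_add lin_span_scale by blast
    then show ?case by (simp add: algebra_simps)
  qed (simp add: lin_span.zero)
  have d0: "d > 0"
  proof (rule ccontr)
    assume "\<not> d > 0"
    then show False using p by (auto simp: d_def elim!: degree_eq_zeroE)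
  qed
  have "z ^ n \<in> lin_span M ?S" for n
  proof (induction n)
    case 0
    have "z ^ 0 \<in> ?S" using d0 by blast
    then show ?case by (rule lin_span_base)
  qed (simp add: m)
  then show ?thesis by (rule that)
qed

text \<open>A nonzero \<open>a\<close> satisfies an algebraic equation over \<open>M\<close> because
  its powers lie in a finite span. After cancelling a power of \<open>a\<close> the constant term is
  nonzero, and the equation exhibits the inverse as a polynomial in \<open>a\<close>.\<close>

lemma subfield_of_finite_span:
  assumes R: "M \<subseteq> R" "\<And>a b. a \<in> R \<Longrightarrow> b \<in> R \<Longrightarrow> a - b \<in> R" "\<And>a b. a \<in> R \<Longrightarrow> b \<in> R \<Longrightarrow> a * b \<in> R"
    and S: "finite S" "R \<subseteq> lin_span M S"
  shows "subfield_set R"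
proof
  show "1 \<in> R" using R(1) sf_one by blast
  fix a assume a: "a \<in> R"
  show "inverse a \<in> R"
  proof (cases "a = 0")
    case True then show ?thesis using a by simp
  next
    case False
    have pw: "a ^ n \<in> R" for n using a R sf_one by (induction n) auto
    have R0: "0 \<in> R" using R(2)[OF a a] by simp
    have Radd: "x + y \<in> R" if "x \<in> R" "y \<in> R" for x y
      using R(2)[OF that(1) R(2)[OF R0 that(2)]] by simp
    have Rsum: "sum f I \<in> R" if "\<And>i. i \<in> I \<Longrightarrow> f i \<in> R" for f and I :: "nat set"
      using that by (induction I rule: infinite_finite_induct) (auto simp: R0 Radd)
    have "algebraic_over a" using algebraic_overI_powers[OF S(1)] pw S(2) by blast
    then obtain p where p: "p \<noteq> 0" "\<forall>i. coeff p i \<in> M" "poly p a = 0"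
      by (auto simp: algebraic_over_def)
    define k where "k = (LEAST i. coeff p i \<noteq> 0)"
    have "\<exists>i. coeff p i \<noteq> 0" using p(1) by (metis leading_coeff_0_iff)
    then have k1: "coeff p k \<noteq> 0" unfolding k_def by (rule LeastI_ex)
    have "\<And>i. i < k \<Longrightarrow> coeff p i = 0" unfolding k_def using not_less_Least by blast
    note k = k1 this
    have kd: "k \<le> degree p" using k(1) by (rule le_degree)
    have "0 = (\<Sum>i\<le>degree p. coeff p i * a ^ i)" using p(3) by (simp add: poly_altdef)
    also have "\<dots> = (\<Sum>i\<in>{k..degree p}. coeff p i * a ^ i)"
      by (rule sum.mono_neutral_right) (auto simp: k(2) not_le)
    also have "\<dots> = coeff p k * a ^ k + (\<Sum>i\<in>{Suc k..degree p}. coeff p i * a ^ i)"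
      using kd by (rule sum.atLeast_Suc_atMost)
    also have "(\<Sum>i\<in>{Suc k..degree p}. coeff p i * a ^ i) =
        a ^ k * (a * (\<Sum>i\<in>{Suc k..degree p}. coeff p i * a ^ (i - Suc k)))"
      unfolding sum_distrib_left
    proof (intro sum.cong refl)
      fix i assume "i \<in> {Suc k..degree p}"
      then have "i = k + Suc (i - Suc k)" by simp
      then have "a ^ i = a ^ k * (a * a ^ (i - Suc k))" by (metis power_add power_Suc)
      then show "coeff p i * a ^ i = a ^ k * (a * (coeff p i * a ^ (i - Suc k)))" by simp
    qed
    finally have "a ^ k * (coeff p k + a * (\<Sum>i\<in>{Suc k..degree p}. coeff p i * a ^ (i - Suc k))) = 0"
      by (simp add: algebra_simps)
    then have "coeff p k + a * (\<Sum>i\<in>{Suc k..degree p}. coeff p i * a ^ (i - Suc k)) = 0"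
      using False by simp
    then have as: "a * (\<Sum>i\<in>{Suc k..degree p}. coeff p i * a ^ (i - Suc k)) = - coeff p k"
      by (simp only: add_eq_0_iff)
    have "a * (- inverse (coeff p k) * (\<Sum>i\<in>{Suc k..degree p}. coeff p i * a ^ (i - Suc k))) =
        - inverse (coeff p k) * (a * (\<Sum>i\<in>{Suc k..degree p}. coeff p i * a ^ (i - Suc k)))"
      by (simp only: mult.left_commute)
    then have "a * (- inverse (coeff p k) * (\<Sum>i\<in>{Suc k..degree p}. coeff p i * a ^ (i - Suc k))) = 1"
      unfolding as using k(1) by simp
    then have "inverse a = - inverse (coeff p k) * (\<Sum>i\<in>{Suc k..degree p}. coeff p i * a ^ (i - Suc k))"
      by (rule inverse_unique)
    moreover have "\<dots> \<in> R"
      using R(1) p(2) pw sf_uminus sf_inverse by (intro R(3) Rsum) blast+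
    ultimately show ?thesis by simp
  qed
qed (use R in auto)

lemma finite_extension_one:
  assumes z: "algebraic_over z"
  shows "\<exists>R S. subfield_set R \<and> insert z M \<subseteq> R \<and> finite S \<and> R \<subseteq> lin_span M S"
proof -
  obtain d where d: "\<And>n. z ^ n \<in> lin_span M ((\<lambda>i. z ^ i) ` {..<d})"
    using algebraic_over_powers[OF z] by blast
  let ?S = "(\<lambda>i. z ^ i) ` {..<d}"
  have zm: "z ^ n * y \<in> lin_span M ?S" if "y \<in> lin_span M ?S" for n y
    using that
  proof (induction rule: lin_span.induct)
    case (step c s x)
    then obtain i where "s = z ^ i" by auto
    then have "z ^ n * s \<in> lin_span M ?S" using d[of "n + i"] by (simp add: power_add)
    then have "c * (z ^ n * s) + z ^ n * x \<in> lin_span M ?S"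
      using step lin_span_add lin_span_scale by blast
    then show ?case by (simp add: algebra_simps)
  qed (simp add: lin_span.zero)
  have mm: "x * y \<in> lin_span M ?S" if "x \<in> lin_span M ?S" "y \<in> lin_span M ?S" for x y
    using that
  proof (induction rule: lin_span.induct)
    case (step c s x)
    then obtain i where "s = z ^ i" by auto
    then have "c * (s * y) + x * y \<in> lin_span M ?S"
      using step zm lin_span_add lin_span_scale by blast
    then show ?case by (simp add: algebra_simps)
  qed (simp add: lin_span.zero)
  have "M \<subseteq> lin_span M ?S" using lin_span_scale[OF d[of 0]] by auto
  moreover have "x - y \<in> lin_span M ?S" if "x \<in> lin_span M ?S" "y \<in> lin_span M ?S" for x y
    using lin_span_add[OF that(1) lin_span_uminus[OF that(2)]] by simp
  ultimately have "subfield_set (lin_span M ?S)"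
    using mm by (intro subfield_of_finite_span[of _ ?S]) auto
  moreover have "z \<in> lin_span M ?S" using d[of 1] by simp
  ultimately show ?thesis using \<open>M \<subseteq> lin_span M ?S\<close> by (intro exI[of _ "lin_span M ?S"] exI[of _ ?S]) auto
qed

end

lemma algebraic_over_mono:
  assumes "subfield_set M" "subfield_set N" "M \<subseteq> N" "subfield_set.algebraic_over M z"
  shows "subfield_set.algebraic_over N z"
  using assms by (auto simp: subfield_set.algebraic_over_def[OF assms(1)] subfield_set.algebraic_over_def[OF assms(2)])

lemma (in subfield_set) finite_extension:
  assumes "finite Z" "\<And>z. z \<in> Z \<Longrightarrow> algebraic_over z"
  shows "\<exists>R S. subfield_set R \<and> Z \<union> M \<subseteq> R \<and> finite S \<and> R \<subseteq> lin_span M S"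
  using assms
proof (induction Z rule: finite_induct)
  case empty
  have "M \<subseteq> lin_span M {1}" using lin_span_single[of _ M 1 "{1}"] by auto
  then show ?case using subfield_set_axioms by blast
next
  case (insert z Z)
  then obtain R S where R: "subfield_set R" "Z \<union> M \<subseteq> R" "finite S" "R \<subseteq> lin_span M S" by auto
  have "subfield_set.algebraic_over R z"
    using algebraic_over_mono[OF subfield_set_axioms R(1)] R(2) insert.prems by blast
  then obtain R' S' where R': "subfield_set R'" "insert z R \<subseteq> R'" "finite S'" "R' \<subseteq> lin_span R S'"
    using subfield_set.finite_extension_one[OF R(1)] by blast
  have "R' \<subseteq> lin_span M ((\<lambda>(s, t). s * t) ` (S \<times> S'))"
    using lin_span_tower[OF _ R(4)] R'(4) by blast
  moreover have "finite ((\<lambda>(s, t). s * t) ` (S \<times> S'))" using R(3) R'(3) by blast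
  ultimately show ?case using R'(1,2) R(2) by blast
qed

lemma (in subfield_set) algebraic_over_trans:
  assumes R: "subfield_set R" "finite S" "R \<subseteq> lin_span M S" and z: "subfield_set.algebraic_over R z"
  shows "algebraic_over z"
proof -
  obtain R' S' where R': "subfield_set R'" "insert z R \<subseteq> R'" "finite S'" "R' \<subseteq> lin_span R S'"
    using subfield_set.finite_extension_one[OF R(1) z] by blast
  have "z ^ i \<in> R'" for i using subfield_set.sf_power[OF R'(1)] R'(2) by blast
  then have "z ^ i \<in> lin_span M ((\<lambda>(s, t). s * t) ` (S \<times> S'))" for i
    using lin_span_tower[OF _ R(3)] R'(4) by blast
  then show ?thesis
    by (rule algebraic_overI_powers[rotated]) (intro finite_imageI finite_cartesian_product R(2) R'(3))
qed

context field_embedding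
begin

definition trans_elt :: "'f \<Rightarrow> bool" where
  "trans_elt t \<longleftrightarrow> (\<forall>q. q \<noteq> 0 \<longrightarrow> peval q t \<noteq> 0)"

definition ratfuns :: "'f \<Rightarrow> 'f set" where
  "ratfuns t = {peval p t / peval q t | p q. peval q t \<noteq> 0}"

sublocale base: subfield_set "range emb"
proof
  show "1 \<in> range emb" by (metis emb_one rangeI)
qed (auto simp flip: emb_diff emb_mult emb_inverse)

lemma subfield_ratfuns: "subfield_set (ratfuns t)"
proof
  have "1 = peval 1 t / peval 1 t" by simp
  then show "1 \<in> ratfuns t" unfolding ratfuns_def by (metis (mono_tags, lifting) mem_Collect_eq peval_1 zero_neq_one)
  fix a b assume "a \<in> ratfuns t" "b \<in> ratfuns t"
  then obtain p q p' q' where a: "a = peval p t / peval q t" "peval q t \<noteq> 0"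
    and b: "b = peval p' t / peval q' t" "peval q' t \<noteq> 0" by (auto simp: ratfuns_def)
  have "a - b = peval (p * q' - p' * q) t / peval (q * q') t"
    by (simp add: a b diff_frac_eq)
  moreover have "a * b = peval (p * p') t / peval (q * q') t"
    using a b by simp
  moreover have "peval (q * q') t \<noteq> 0" using a b by simp
  ultimately show "a - b \<in> ratfuns t" "a * b \<in> ratfuns t" unfolding ratfuns_def by blast+
next
  fix a assume "a \<in> ratfuns t"
  then obtain p q where a: "a = peval p t / peval q t" "peval q t \<noteq> 0" by (auto simp: ratfuns_def)
  show "inverse a \<in> ratfuns t"
  proof (cases "peval p t = 0")
    case True
    then have "inverse a = peval 0 t / peval q t" using a by simp
    then show ?thesis using a(2) unfolding ratfuns_def by blast
  next
    case False
    have "inverse a = peval q t / peval p t" unfolding a(1) by simp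
    then show ?thesis using False unfolding ratfuns_def by blast
  qed
qed

lemma peval_in_ratfuns: "peval p t \<in> ratfuns t"
proof -
  have "peval p t = peval p t / peval 1 t" "peval 1 t \<noteq> 0" by simp_all
  then show ?thesis unfolding ratfuns_def by blast
qed

lemma range_emb_subset_ratfuns: "range emb \<subseteq> ratfuns t"
proof
  fix a assume "a \<in> range emb"
  then obtain c where "a = peval [:c:] t" by auto
  then show "a \<in> ratfuns t" by (simp only: peval_in_ratfuns)
qed

lemma peval_in_subfield:
  assumes "subfield_set R" "range emb \<subseteq> R" "t \<in> R"
  shows "peval p t \<in> R"
  using assms by (induction p) (auto intro!: subfield_set.sf_add subfield_set.sf_mult subfield_set.sf_zero)

lemma ratfuns_subset:
  assumes "subfield_set R" "range emb \<subseteq> R" "t \<in> R"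
  shows "ratfuns t \<subseteq> R"
  using peval_in_subfield[OF assms] subfield_set.sf_divide[OF assms(1)] by (auto simp: ratfuns_def)

lemma algebraic_base_iff: "base.algebraic_over t \<longleftrightarrow> \<not> trans_elt t"
proof
  assume "base.algebraic_over t"
  then obtain p where p: "p \<noteq> 0" "\<forall>i. coeff p i \<in> range emb" "poly p t = 0"
    by (auto simp: base.algebraic_over_def)
  define q where "q = map_poly (inv_into UNIV emb) p"
  have "map_poly emb q = p"
    by (rule poly_eqI) (use p(2) inv_f_f[OF inj_emb] in \<open>simp add: q_def coeff_map_poly f_inv_into_f
      inv_f_eq[OF inj_emb emb_zero]\<close>)
  then have "peval q t = 0" "q \<noteq> 0" using p by (auto simp: peval_def)
  then show "\<not> trans_elt t" by (auto simp: trans_elt_def)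
next
  assume "\<not> trans_elt t"
  then obtain q where "q \<noteq> 0" "peval q t = 0" by (auto simp: trans_elt_def)
  then show "base.algebraic_over t" unfolding base.algebraic_over_def
    by (intro exI[of _ "map_poly emb q"]) (simp add: peval_def coeff_map_poly)
qed

end

subsection \<open>Polynomials in several variables and finiteness over rational function fields\<close>

abbreviation "lookup \<equiv> Poly_Mapping.lookup"
abbreviation "keys \<equiv> Poly_Mapping.keys"

definition mon :: "('i \<Rightarrow> 'a::comm_semiring_1) \<Rightarrow> ('i \<Rightarrow>\<^sub>0 nat) \<Rightarrow> 'a" where
  "mon x m = (\<Prod>i\<in>keys m. x i ^ lookup m i)"

lemma mon_superset:
  assumes "finite A" "keys m \<subseteq> A"
  shows "mon x m = (\<Prod>i\<in>A. x i ^ lookup m i)"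
  unfolding mon_def by (rule prod.mono_neutral_left) (use assms in \<open>auto simp: in_keys_iff\<close>)

lemma mon_0 [simp]: "mon x 0 = 1"
  by (simp add: mon_def)

lemma mon_single [simp]: "mon x (Poly_Mapping.single i n) = x i ^ n"
  by (simp add: mon_def)

lemma mon_add: "mon x (m + n) = mon x m * mon x n"
proof -
  let ?A = "keys m \<union> keys n"
  have "keys (m + n) \<subseteq> ?A" by (rule keys_add)
  then have "mon x (m + n) = (\<Prod>i\<in>?A. x i ^ (lookup m i + lookup n i))"
    by (subst mon_superset[of ?A]) (auto simp: lookup_add)
  also have "\<dots> = mon x m * mon x n"
    by (subst (1 2) mon_superset[of ?A]) (auto simp: power_add prod.distrib)
  finally show ?thesis .
qed

lemma poly_mapping_sum_single: "f = (\<Sum>m\<in>keys f. Poly_Mapping.single m (lookup f m))"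
proof (rule poly_mapping_eqI)
  fix k
  have "lookup (\<Sum>m\<in>keys f. Poly_Mapping.single m (lookup f m)) k =
      (\<Sum>m\<in>keys f. if m = k then lookup f k else 0)"
    unfolding lookup_sum by (intro sum.cong) (auto simp: lookup_single when_def)
  also have "\<dots> = lookup f k" by (simp add: in_keys_iff)
  finally show "lookup f k = lookup (\<Sum>m\<in>keys f. Poly_Mapping.single m (lookup f m)) k" by simp
qed

context field_embedding
begin

lemma mpoly_eval_mon: "mpoly_eval emb f x = (\<Sum>m\<in>keys f. emb (lookup f m) * mon x m)"
  by (simp add: mpoly_eval_def mon_def)

lemma mpoly_eval_superset:
  assumes "finite A" "keys f \<subseteq> A"
  shows "mpoly_eval emb f x = (\<Sum>m\<in>A. emb (lookup f m) * mon x m)"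
  unfolding mpoly_eval_mon by (rule sum.mono_neutral_left) (use assms in \<open>auto simp: in_keys_iff\<close>)

lemma mpoly_eval_0 [simp]: "mpoly_eval emb 0 x = 0"
  by (simp add: mpoly_eval_mon)

lemma mpoly_eval_single [simp]: "mpoly_eval emb (Poly_Mapping.single m c) x = emb c * mon x m"
  by (subst mpoly_eval_superset[of "{m}"]) auto

lemma mpoly_eval_add: "mpoly_eval emb (f + g) x = mpoly_eval emb f x + mpoly_eval emb g x"
proof -
  let ?A = "keys f \<union> keys g"
  have "keys (f + g) \<subseteq> ?A" by (rule keys_add)
  then show ?thesis
    by (subst (1 2 3) mpoly_eval_superset[of ?A])
      (auto simp: lookup_add emb_add sum.distrib algebra_simps)
qed

lemma mpoly_eval_sum: "mpoly_eval emb (\<Sum>i\<in>I. f i) x = (\<Sum>i\<in>I. mpoly_eval emb (f i) x)"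
  by (induction I rule: infinite_finite_induct) (simp_all add: mpoly_eval_add)

lemma mpoly_eval_mult: "mpoly_eval emb (f * g) x = mpoly_eval emb f x * mpoly_eval emb g x"
proof -
  have "f * g = (\<Sum>m\<in>keys f. \<Sum>n\<in>keys g.
      Poly_Mapping.single m (lookup f m) * Poly_Mapping.single n (lookup g n))"
    by (subst (1) poly_mapping_sum_single[of f], subst (1) poly_mapping_sum_single[of g])
      (simp add: sum_product)
  then have "mpoly_eval emb (f * g) x = (\<Sum>m\<in>keys f. \<Sum>n\<in>keys g.
      (emb (lookup f m) * mon x m) * (emb (lookup g n) * mon x n))"
    by (simp add: mpoly_eval_sum mult_single mon_add emb_mult mult_ac)
  also have "\<dots> = mpoly_eval emb f x * mpoly_eval emb g x"
    by (simp add: mpoly_eval_mon sum_product)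
  finally show ?thesis .
qed

lemma mpoly_eval_1 [simp]: "mpoly_eval emb 1 x = 1"
  using mpoly_eval_single[of 0 1 x] by (simp add: emb_one)

lemma mpoly_eval_power: "mpoly_eval emb (f ^ n) x = mpoly_eval emb f x ^ n"
  by (induction n) (simp_all add: mpoly_eval_mult)

lemma mpoly_eval_homogeneous:
  assumes "homogeneous_of_degree d f"
  shows "mpoly_eval emb f (\<lambda>i. c * x i) = c ^ d * mpoly_eval emb f x"
proof -
  have "mon (\<lambda>i. c * x i) m = c ^ d * mon x m" if "m \<in> keys f" for m
  proof -
    have "mon (\<lambda>i. c * x i) m = c ^ (\<Sum>i\<in>keys m. lookup m i) * mon x m"
      by (simp add: mon_def power_mult_distrib prod.distrib power_sum)
    then show ?thesis using assms that by (simp add: homogeneous_of_degree_def)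
  qed
  then show ?thesis by (simp add: mpoly_eval_mon sum_distrib_left mult_ac)
qed

lemma mpoly_eval_in_subfield:
  assumes "subfield_set R" "range emb \<subseteq> R" "\<And>i. x i \<in> R"
  shows "mpoly_eval emb f x \<in> R"
  unfolding mpoly_eval_def using assms(2,3)
  by (intro subfield_set.sf_sum[OF assms(1)] subfield_set.sf_mult[OF assms(1)]
      subfield_set.sf_prod[OF assms(1)] subfield_set.sf_power[OF assms(1)]) auto

lemma trans_elt_of_alg_independent: "alg_independent emb {b} \<Longrightarrow> trans_elt b"
proof -
  assume ai: "alg_independent emb {b}"
  show "trans_elt b" unfolding trans_elt_def
  proof (intro allI impI notI)
    fix q :: "'k poly" assume q: "q \<noteq> 0" "peval q b = 0"
    define f :: "('f, 'k) mpolynomial" where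
      "f = (\<Sum>i\<le>degree q. Poly_Mapping.single (Poly_Mapping.single b i) (coeff q i))"
    have "mpoly_eval emb f (\<lambda>s. s) = 0"
      using q(2) by (simp add: f_def mpoly_eval_sum peval_altdef)
    moreover have "mpoly_vars f \<subseteq> {b}"
    proof -
      have "keys f \<subseteq> (\<Union>i\<le>degree q. keys (Poly_Mapping.single (Poly_Mapping.single b i) (coeff q i)))"
        unfolding f_def by (rule keys_sum)
      also have "\<dots> \<subseteq> range (Poly_Mapping.single b)" by (auto split: if_splits)
      finally have "keys f \<subseteq> range (Poly_Mapping.single b)" .
      then show ?thesis by (force simp: mpoly_vars_def split: if_splits)
    qed
    ultimately have "f = 0" using ai by (auto simp: alg_independent_def)
    moreover have "lookup f (Poly_Mapping.single b (degree q)) = (\<Sum>i\<le>degree q. if i = degree q then lead_coeff q else 0)"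
      unfolding f_def lookup_sum
      by (intro sum.cong) (auto simp: lookup_single when_def dest: arg_cong[where f = "\<lambda>m. lookup m b"])
    ultimately show False using q(1) by simp
  qed
qed

text \<open>By maximality \<open>b\<close> and any other \<open>u\<close> satisfy a polynomial
  relation. Collected by powers of \<open>u\<close> it has the coefficients \<open>q j\<close> at
  \<open>b\<close>, and these do not all vanish because \<open>b\<close> is transcendental.\<close>

lemma algebraic_of_maximal:
  assumes tb: "transcendence_basis emb {b}"
  shows "subfield_set.algebraic_over (ratfuns b) u"
proof (cases "u = b")
  case True
  have "\<forall>i. coeff [:- b, 1:] i \<in> ratfuns b"
    using subfield_set.sf_uminus[OF subfield_ratfuns] subfield_set.sf_one[OF subfield_ratfuns]
      subfield_set.sf_zero[OF subfield_ratfuns] peval_in_ratfuns[of "[:0, 1:]" b]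
    by (auto simp: coeff_pCons emb_one split: nat.splits)
  then show ?thesis unfolding subfield_set.algebraic_over_def[OF subfield_ratfuns]
    using True by (intro exI[of _ "[:- b, 1:]"]) simp
next
  case False
  have tr: "trans_elt b" using tb trans_elt_of_alg_independent by (simp add: transcendence_basis_def)
  have "\<not> alg_independent emb {b, u}"
    using tb False unfolding transcendence_basis_def by (metis insertI1 insert_commute singletonD subset_insertI)
  then obtain f :: "('f, 'k) mpolynomial" where
    f: "mpoly_vars f \<subseteq> {b, u}" "mpoly_eval emb f (\<lambda>s. s) = 0" "f \<noteq> 0"
    by (auto simp: alg_independent_def)
  have km: "keys m \<subseteq> {b, u}" if "m \<in> keys f" for m using f(1) that by (auto simp: mpoly_vars_def)
  define q where "q = (\<lambda>j. \<Sum>m\<in>{m \<in> keys f. lookup m u = j}. monom (lookup f m) (lookup m b))"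
  define N where "N = Max ((\<lambda>m. lookup m u) ` keys f)"
  have N: "lookup m u \<le> N" if "m \<in> keys f" for m using that by (simp add: N_def)
  define p where "p = (\<Sum>j\<le>N. monom (peval (q j) b) j)"
  have cp: "coeff p i = (if i \<le> N then peval (q i) b else 0)" for i
    by (simp add: p_def coeff_sum coeff_monom if_distrib sum.delta cong: if_cong)
  have m: "mon (\<lambda>s. s) m = b ^ lookup m b * u ^ lookup m u" if "m \<in> keys f" for m
    using mon_superset[OF _ km[OF that], of "\<lambda>s. s"] False by simp
  have "poly p u = (\<Sum>j\<le>N. peval (q j) b * u ^ j)"
    by (simp add: p_def poly_sum poly_monom)
  also have "\<dots> = (\<Sum>j\<le>N. \<Sum>m\<in>{m \<in> keys f. lookup m u = j}. emb (lookup f m) * mon (\<lambda>s. s) m)"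
    by (intro sum.cong refl) (simp add: q_def peval_sum peval_monom sum_distrib_left m mult_ac)
  also have "\<dots> = (\<Sum>m\<in>keys f. emb (lookup f m) * mon (\<lambda>s. s) m)"
    by (rule sum.group) (use N in auto)
  also have "\<dots> = 0" using f(2) by (simp add: mpoly_eval_mon)
  finally have "poly p u = 0" .
  moreover have "p \<noteq> 0"
  proof -
    obtain m0 where m0: "m0 \<in> keys f" using f(3) by (metis all_not_in_conv keys_eq_empty)
    let ?j = "lookup m0 u"
    have "coeff (q ?j) (lookup m0 b) = (\<Sum>m\<in>{m \<in> keys f. lookup m u = ?j}. if m = m0 then lookup f m0 else 0)"
      unfolding q_def coeff_sum
    proof (intro sum.cong refl)
      fix m assume mm: "m \<in> {m \<in> keys f. lookup m u = ?j}"
      have "m = m0" if "lookup m b = lookup m0 b"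
      proof (rule poly_mapping_eqI)
        fix k
        have "k \<notin> {b, u} \<Longrightarrow> lookup m k = 0 \<and> lookup m0 k = 0"
          using km[of m] km[OF m0] mm by (auto simp: in_keys_iff)
        then show "lookup m k = lookup m0 k" using that mm by (cases "k \<in> {b, u}") auto
      qed
      then show "coeff (monom (lookup f m) (lookup m b)) (lookup m0 b) = (if m = m0 then lookup f m0 else 0)"
        by (auto simp: coeff_monom)
    qed
    also have "\<dots> = lookup f m0" using m0 by simp
    also have "\<dots> \<noteq> 0" using m0 by (simp add: in_keys_iff)
    finally have "q ?j \<noteq> 0" by auto
    then have "peval (q ?j) b \<noteq> 0" using tr by (simp add: trans_elt_def)
    then show ?thesis using cp[of ?j] N[OF m0] by auto
  qed
  moreover have "\<forall>i. coeff p i \<in> ratfuns b"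
    using cp peval_in_ratfuns subfield_set.sf_zero[OF subfield_ratfuns] by auto
  ultimately show ?thesis unfolding subfield_set.algebraic_over_def[OF subfield_ratfuns] by blast
qed

lemma ratfuns_clear_denominators:
  assumes "finite J" "\<And>j. j \<in> J \<Longrightarrow> a j \<in> ratfuns t"
  obtains D p where "D \<noteq> 0" "\<And>j. j \<in> J \<Longrightarrow> peval (p j) t = D * a j"
proof -
  have "\<forall>j. \<exists>r s. j \<in> J \<longrightarrow> a j = peval r t / peval s t \<and> peval s t \<noteq> 0"
    using assms(2) unfolding ratfuns_def by blast
  then obtain r s where rs: "\<And>j. j \<in> J \<Longrightarrow> a j = peval (r j) t / peval (s j) t"
    "\<And>j. j \<in> J \<Longrightarrow> peval (s j) t \<noteq> 0" by metis
  define D where "D = (\<Prod>j\<in>J. peval (s j) t)"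
  show ?thesis
  proof (rule that[of D "\<lambda>i. r i * (\<Prod>j\<in>J - {i}. s j)"])
    show "D \<noteq> 0" using rs(2) assms(1) by (simp add: D_def)
    fix i assume i: "i \<in> J"
    have "D = peval (s i) t * (\<Prod>j\<in>J - {i}. peval (s j) t)"
      using i assms(1) by (simp add: D_def prod.remove)
    then show "peval (r i * (\<Prod>j\<in>J - {i}. s j)) t = D * a i" using rs i by (simp add: peval_prod)
  qed
qed

text \<open>A relation between \<open>b\<close> and \<open>t\<close> can be sorted in two ways: by
  powers of \<open>t\<close> it has coefficients \<open>P i\<close> at \<open>b\<close>, by powers
  of \<open>b\<close> it has coefficients \<open>c j\<close> at \<open>t\<close>. Transcendence of
  \<open>t\<close> keeps one of the latter nonzero.\<close>

lemma algebraic_exchange: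
  assumes t: "trans_elt t" and alg: "subfield_set.algebraic_over (ratfuns b) t"
  shows "subfield_set.algebraic_over (ratfuns t) b"
proof -
  obtain p where p: "p \<noteq> 0" "\<forall>i. coeff p i \<in> ratfuns b" "poly p t = 0"
    using alg by (auto simp: subfield_set.algebraic_over_def[OF subfield_ratfuns])
  define n where "n = degree p"
  obtain D P where D0: "D \<noteq> 0" and P: "\<And>i. i \<in> {..n} \<Longrightarrow> peval (P i) b = D * coeff p i"
    using ratfuns_clear_denominators[of "{..n}" "coeff p" b] p(2) by auto
  have sum0: "(\<Sum>i\<le>n. peval (P i) b * t ^ i) = 0"
  proof -
    have "(\<Sum>i\<le>n. peval (P i) b * t ^ i) = D * poly p t"
      by (simp add: P poly_altdef n_def sum_distrib_left mult_ac)
    then show ?thesis using p(3) by simp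
  qed
  have Pn: "P n \<noteq> 0" using P[of n] p(1) D0 by (auto simp: n_def)
  define N where "N = Max (degree ` P ` {..n})"
  have N: "degree (P i) \<le> N" if "i \<le> n" for i using that by (simp add: N_def)
  define c where "c = (\<lambda>j. \<Sum>i\<le>n. monom (coeff (P i) j) i)"
  have pc: "peval (c j) t = (\<Sum>i\<le>n. emb (coeff (P i) j) * t ^ i)" for j
    by (simp add: c_def peval_sum peval_monom)
  have pN: "peval (P i) b = (\<Sum>j\<le>N. emb (coeff (P i) j) * b ^ j)" if "i \<le> n" for i
    unfolding peval_altdef using N[OF that]
    by (intro sum.mono_neutral_left) (auto simp: coeff_eq_0)
  define w where "w = (\<Sum>j\<le>N. monom (peval (c j) t) j)"
  have cw: "coeff w i = (if i \<le> N then peval (c i) t else 0)" for i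
    by (simp add: w_def coeff_sum coeff_monom if_distrib sum.delta cong: if_cong)
  have "poly w b = (\<Sum>j\<le>N. \<Sum>i\<le>n. emb (coeff (P i) j) * t ^ i * b ^ j)"
    by (simp add: w_def poly_sum poly_monom pc sum_distrib_right)
  also have "\<dots> = (\<Sum>i\<le>n. \<Sum>j\<le>N. emb (coeff (P i) j) * t ^ i * b ^ j)"
    by (rule sum.swap)
  also have "\<dots> = (\<Sum>i\<le>n. peval (P i) b * t ^ i)"
    by (intro sum.cong refl) (simp add: pN sum_distrib_left mult_ac)
  finally have "poly w b = 0" using sum0 by simp
  moreover have "w \<noteq> 0"
  proof -
    let ?j = "degree (P n)"
    have "coeff (c ?j) n = lead_coeff (P n)"
      by (simp add: c_def coeff_sum coeff_monom if_distrib sum.delta cong: if_cong)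
    then have "c ?j \<noteq> 0" using Pn by auto
    then have "peval (c ?j) t \<noteq> 0" using t by (simp add: trans_elt_def)
    then show ?thesis using cw[of ?j] N[of n] by auto
  qed
  moreover have "\<forall>i. coeff w i \<in> ratfuns t"
    using cw peval_in_ratfuns subfield_set.sf_zero[OF subfield_ratfuns] by auto
  ultimately show ?thesis unfolding subfield_set.algebraic_over_def[OF subfield_ratfuns] by blast
qed

end

section \<open>Finiteness of the function field over K(t)\<close>

context smooth_projective_geom_irreducible_curve
begin

abbreviation xi :: "'i \<Rightarrow> 'f" where "xi i \<equiv> \<xi> $ i"

lemma homogeneous_quotient:
  assumes "xi i0 \<noteq> 0"
  obtains f g where "t = mpoly_eval emb f (\<lambda>i. xi i / xi i0) / mpoly_eval emb g (\<lambda>i. xi i / xi i0)"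
    "mpoly_eval emb g (\<lambda>i. xi i / xi i0) \<noteq> 0"
proof -
  obtain d f g where fg: "homogeneous_of_degree d f" "homogeneous_of_degree d g"
    "mpoly_eval emb g xi \<noteq> 0" "t = mpoly_eval emb f xi / mpoly_eval emb g xi"
    using function_field by blast
  have e: "mpoly_eval emb h (\<lambda>i. xi i / xi i0) = inverse (xi i0) ^ d * mpoly_eval emb h xi"
    if "homogeneous_of_degree d h" for h
    using mpoly_eval_homogeneous[OF that, of "inverse (xi i0)" xi] by (simp add: divide_inverse mult.commute)
  show ?thesis
    by (rule that[of f g]) (use fg assms in \<open>simp_all add: e\<close>)
qed

lemma field_generated:
  assumes "xi i0 \<noteq> 0" "subfield_set R" "range emb \<subseteq> R" "\<And>i. xi i / xi i0 \<in> R"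
  shows "t \<in> R"
proof -
  obtain f g where "t = mpoly_eval emb f (\<lambda>i. xi i / xi i0) / mpoly_eval emb g (\<lambda>i. xi i / xi i0)"
    by (rule homogeneous_quotient[OF assms(1)])
  moreover have "mpoly_eval emb h (\<lambda>i. xi i / xi i0) \<in> R" for h :: "('i, 'k) mpolynomial"
    by (rule mpoly_eval_in_subfield[OF assms(2,3)]) (rule assms(4))
  ultimately show ?thesis using subfield_set.sf_divide[OF assms(2)] by blast
qed

lemma nonzero_coordinate: "\<exists>i. xi i \<noteq> 0"
  using generic_point_nonzero by (auto simp: vec_eq_iff)

lemma trans_elt_exists: "\<exists>b. trans_elt b"
  using dimension_one trans_elt_of_alg_independent
  by (metis card_1_singletonE transcendence_basis_def)

lemma algebraic_over_ratfuns:
  assumes t: "trans_elt t"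
  shows "subfield_set.algebraic_over (ratfuns t) u"
proof -
  obtain b where b: "transcendence_basis emb {b}" using dimension_one card_1_singletonE by metis
  note alg = algebraic_of_maximal[OF b]
  have bt: "subfield_set.algebraic_over (ratfuns t) b" by (rule algebraic_exchange[OF t alg])
  obtain R S where R: "subfield_set R" "{b} \<union> ratfuns t \<subseteq> R" "finite S" "R \<subseteq> lin_span (ratfuns t) S"
    using subfield_set.finite_extension[OF subfield_ratfuns, of "{b}" t] bt by auto
  have "ratfuns b \<subseteq> R" using ratfuns_subset[OF R(1)] R(2) range_emb_subset_ratfuns by blast
  then have "subfield_set.algebraic_over R u"
    by (rule algebraic_over_mono[OF subfield_ratfuns R(1) _ alg])
  then show ?thesis
    by (rule subfield_set.algebraic_over_trans[OF subfield_ratfuns R(1,3,4)])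
qed

text \<open>The finitely many coordinate ratios generate \<open>F\<close> and are algebraic over
  \<open>K(t)\<close>, so a finite extension of \<open>K(t)\<close> containing them is all of
  \<open>F\<close>.\<close>

lemma finite_over_ratfuns:
  assumes t: "trans_elt t"
  obtains S where "finite S" "\<And>u. u \<in> lin_span (ratfuns t) S"
proof -
  obtain i0 where i0: "xi i0 \<noteq> 0" using nonzero_coordinate by blast
  let ?Z = "range (\<lambda>i. xi i / xi i0)"
  obtain R S where R: "subfield_set R" "?Z \<union> ratfuns t \<subseteq> R" "finite S" "R \<subseteq> lin_span (ratfuns t) S"
    using subfield_set.finite_extension[OF subfield_ratfuns, of ?Z t] algebraic_over_ratfuns[OF t] by auto
  have "u \<in> R" for u
    by (rule field_generated[OF i0 R(1)]) (use R(2) range_emb_subset_ratfuns in blast)+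
  then show ?thesis using that R(3,4) by blast
qed

end

subsection \<open>Places and discrete valuations\<close>

text \<open>
  A homomorphism over \<open>K\<close> from a subring of \<open>F\<close> to the algebraic closure of \<open>K\<close> is represented
  by its graph, a subring of the product ring. Zorn's lemma then applies to sets ordered by inclusion.
\<close>

locale hom_graph = field_embedding emb for emb :: "'k::field \<Rightarrow> 'f::field" +
  fixes G :: "('f \<times> 'k alg_closure) set"
  assumes hg_emb: "(emb c, to_ac c) \<in> G"
    and hg_add: "(a, x) \<in> G \<Longrightarrow> (b, y) \<in> G \<Longrightarrow> (a + b, x + y) \<in> G"
    and hg_mult: "(a, x) \<in> G \<Longrightarrow> (b, y) \<in> G \<Longrightarrow> (a * b, x * y) \<in> G"
    and hg_zero_eq: "(0, x) \<in> G \<Longrightarrow> x = 0"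
begin

lemma hg_zero: "(0, 0) \<in> G" using hg_emb[of 0] by simp
lemma hg_one: "(1, 1) \<in> G" using hg_emb[of 1] by (simp add: emb_one)
lemma hg_uminus: "(a, x) \<in> G \<Longrightarrow> (- a, - x) \<in> G"
  using hg_mult[OF hg_emb[of "- 1"]] by (simp add: emb_uminus emb_one)
lemma hg_diff: "(a, x) \<in> G \<Longrightarrow> (b, y) \<in> G \<Longrightarrow> (a - b, x - y) \<in> G"
  using hg_add[OF _ hg_uminus] by force
lemma hg_unique: "(a, x) \<in> G \<Longrightarrow> (a, y) \<in> G \<Longrightarrow> x = y"
  using hg_diff[of a x a y] hg_zero_eq[of "x - y"] by simp
lemma hg_power: "(a, x) \<in> G \<Longrightarrow> (a ^ n, x ^ n) \<in> G"
  by (induction n) (simp_all add: hg_one hg_mult)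
lemma hg_sum: "(\<And>i. i \<in> I \<Longrightarrow> (f i, g i) \<in> G) \<Longrightarrow> (sum f I, sum g I) \<in> G"
  by (induction I rule: infinite_finite_induct) (simp_all add: hg_zero hg_add)
lemma hg_prod: "(\<And>i. i \<in> I \<Longrightarrow> (f i, g i) \<in> G) \<Longrightarrow> (prod f I, prod g I) \<in> G"
  by (induction I rule: infinite_finite_induct) (simp_all add: hg_one hg_mult)

lemma hg_peval: "(a, x) \<in> G \<Longrightarrow> (peval p a, to_ac.peval p x) \<in> G"
  by (induction p) (simp_all add: hg_zero hg_add hg_mult hg_emb)

lemma hg_mpoly_eval:
  "(\<And>i. (x i, z i) \<in> G) \<Longrightarrow> (mpoly_eval emb f x, mpoly_eval to_ac f z) \<in> G"
  unfolding mpoly_eval_def by (intro hg_sum hg_mult hg_prod hg_power hg_emb)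

text \<open>\<open>r\<close> is the image of \<open>q\<close> under the homomorphism with graph
  \<open>G\<close>, applied to the coefficients.\<close>

definition matched :: "'f poly \<Rightarrow> 'k alg_closure poly \<Rightarrow> bool" where
  "matched q r \<longleftrightarrow> (\<forall>i. (coeff q i, coeff r i) \<in> G)"

lemma matched_add: "matched q r \<Longrightarrow> matched q' r' \<Longrightarrow> matched (q + q') (r + r')"
  by (simp add: matched_def hg_add)

lemma matched_diff: "matched q r \<Longrightarrow> matched q' r' \<Longrightarrow> matched (q - q') (r - r')"
  by (simp add: matched_def hg_diff)

lemma matched_mult: "matched q r \<Longrightarrow> matched q' r' \<Longrightarrow> matched (q * q') (r * r')"
  by (simp add: matched_def coeff_mult hg_sum hg_mult)

lemma matched_monom: "(a, x) \<in> G \<Longrightarrow> matched (monom a n) (monom x n)"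
  by (simp add: matched_def hg_zero)

lemma matched_const: "(a, x) \<in> G \<Longrightarrow> matched [:a:] [:x:]"
  using matched_monom[of a x 0] by (simp add: monom_0)

definition adjoin :: "'f \<Rightarrow> 'k alg_closure \<Rightarrow> ('f \<times> 'k alg_closure) set" where
  "adjoin u y = {(poly q u, poly r y) | q r. matched q r}"

lemma adjoin_superset: "G \<subseteq> adjoin u y"
proof
  fix p assume "p \<in> G"
  then obtain a x where p: "p = (a, x)" "matched [:a:] [:x:]" using matched_const by (cases p) auto
  then have "p = (poly [:a:] u, poly [:x:] y)" by simp
  then show "p \<in> adjoin u y" using p(2) unfolding adjoin_def by blast
qed

lemma adjoin_new: "(u, y) \<in> adjoin u y"
proof -
  have "matched [:0, 1:] [:0, 1:]"
    using hg_zero hg_one by (auto simp: matched_def coeff_pCons split: nat.splits)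
  then have "(poly [:0, 1:] u, poly [:0, 1:] y) \<in> adjoin u y" unfolding adjoin_def by blast
  then show ?thesis by simp
qed

lemma hom_graph_adjoin:
  assumes "\<And>q r. matched q r \<Longrightarrow> poly q u = 0 \<Longrightarrow> poly r y = 0"
  shows "hom_graph emb (adjoin u y)"
proof
  show "(emb c, to_ac c) \<in> adjoin u y" for c using adjoin_superset hg_emb by blast
  fix a x b z assume "(a, x) \<in> adjoin u y" "(b, z) \<in> adjoin u y"
  then obtain q r q' r' where e: "a = poly q u" "x = poly r y" "b = poly q' u" "z = poly r' y"
    and m: "matched q r" "matched q' r'" unfolding adjoin_def by blast
  have "(a + b, x + z) = (poly (q + q') u, poly (r + r') y)" "(a * b, x * z) = (poly (q * q') u, poly (r * r') y)"
    using e by simp_all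
  then show "(a + b, x + z) \<in> adjoin u y" "(a * b, x * z) \<in> adjoin u y"
    unfolding adjoin_def using matched_add[OF m] matched_mult[OF m] by blast+
next
  show "(0, x) \<in> adjoin u y \<Longrightarrow> x = 0" for x using assms unfolding adjoin_def by force
qed

end

text \<open>\<open>J\<close> is closed under the division step only, because in some applications it
  is no ideal of the polynomial ring: multipliers are restricted to coefficients in a subfield or in
  the image of a homomorphism.\<close>

lemma dvd_of_min_degree:
  fixes d :: "'a::field poly"
  assumes d: "d \<noteq> 0" and dmin: "\<And>r. r \<in> J \<Longrightarrow> r \<noteq> 0 \<Longrightarrow> degree d \<le> degree r"
    and closed: "\<And>e n. e \<in> J \<Longrightarrow> e - monom (lead_coeff e * inverse (lead_coeff d)) n * d \<in> J"
    and e: "e \<in> J"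
  shows "d dvd e"
  using e
proof (induction "if e = 0 then 0 else Suc (degree e)" arbitrary: e rule: less_induct)
  case less
  show ?case
  proof (cases "e = 0")
    case False
    have le: "degree d \<le> degree e" using dmin less.prems False by blast
    let ?c = "lead_coeff e * inverse (lead_coeff d)" and ?n = "degree e - degree d"
    let ?e = "e - monom ?c ?n * d"
    have "degree (monom ?c ?n * d) \<le> degree e"
      using degree_mult_le[of "monom ?c ?n" d] degree_monom_le[of ?c ?n] le by linarith
    then have "degree ?e \<le> degree e" by (intro degree_diff_le) simp_all
    moreover have "coeff ?e (degree e) = 0"
      using coeff_mult_at_bounds[OF degree_monom_le order_refl, of ?c ?n d] le d by simp
    ultimately have "?e = 0 \<or> degree ?e < degree e"
      by (metis leading_coeff_0_iff order_less_le)
    then have "d dvd ?e" using closed[OF less.prems] False by (intro less.hyps) auto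
    then have "d dvd ?e + monom ?c ?n * d" by (rule dvd_add) simp
    then show ?thesis by (simp only: diff_add_cancel)
  qed simp
qed

text \<open>A homomorphism to the algebraic closure with no extension to a larger subring.
  Maximality is what makes its domain a valuation ring.\<close>

locale place = hom_graph emb G for emb :: "'k::field \<Rightarrow> 'f::field" and G +
  assumes maximal: "hom_graph emb H \<Longrightarrow> G \<subseteq> H \<Longrightarrow> H = G"

lemma (in hom_graph) place_exists: "\<exists>H. place emb H \<and> G \<subseteq> H"
proof -
  let ?A = "{H. hom_graph emb H \<and> G \<subseteq> H}"
  have "\<exists>M\<in>?A. \<forall>H\<in>?A. M \<subseteq> H \<longrightarrow> H = M"
  proof (rule subset_Zorn_nonempty)
    show "?A \<noteq> {}" using hom_graph_axioms by blast
    fix C assume C: "C \<noteq> {}" "subset.chain ?A C"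
    then have CA: "\<And>H. H \<in> C \<Longrightarrow> hom_graph emb H \<and> G \<subseteq> H" by (auto simp: subset.chain_def)
    have two: "\<exists>H\<in>C. p \<in> H \<and> q \<in> H" if "p \<in> \<Union>C" "q \<in> \<Union>C" for p q
      using that C(2) unfolding subset.chain_def by blast
    have "hom_graph emb (\<Union>C)"
    proof
      show "(emb c, to_ac c) \<in> \<Union>C" for c using C(1) CA hg_emb by blast
      fix a x b y assume "(a, x) \<in> \<Union>C" "(b, y) \<in> \<Union>C"
      then obtain H where H: "H \<in> C" "(a, x) \<in> H" "(b, y) \<in> H" using two by blast
      then show "(a + b, x + y) \<in> \<Union>C" "(a * b, x * y) \<in> \<Union>C"
        using CA hom_graph.hg_add hom_graph.hg_mult by blast+
    next
      show "(0, x) \<in> \<Union>C \<Longrightarrow> x = 0" for x using CA hom_graph.hg_zero_eq by blast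
    qed
    then show "\<Union>C \<in> ?A" using C(1) CA by blast
  qed
  then obtain M where M: "M \<in> ?A" "\<forall>H\<in>?A. M \<subseteq> H \<longrightarrow> H = M" by (rule bexE)
  have "place emb M"
  proof (rule place.intro)
    show "hom_graph emb M" using M(1) by simp
    show "place_axioms emb M"
    proof
      fix H assume H: "hom_graph emb H" "M \<subseteq> H"
      moreover have "G \<subseteq> M" using M(1) by simp
      ultimately have "H \<in> ?A" by simp
      then show "H = M" using M(2) H(2) by simp
    qed
  qed
  then show ?thesis using M(1) by auto
qed

lemma poly_as_sum_upto:
  fixes x :: "'a::field"
  shows "degree p \<le> d \<Longrightarrow> poly p x = (\<Sum>i\<le>d. coeff p i * x ^ i)"
  unfolding poly_altdef by (rule sum.mono_neutral_left) (auto simp: coeff_eq_0)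

lemma poly_inverse_reverse:
  fixes a :: "'a::field"
  assumes "a \<noteq> 0" "degree p \<le> d"
  shows "a ^ d * poly p (inverse a) = (\<Sum>i\<le>d. coeff p i * a ^ (d - i))"
proof -
  have "a ^ d * (coeff p i * inverse a ^ i) = coeff p i * a ^ (d - i)" if "i \<le> d" for i
  proof -
    have "a ^ d = a ^ (d - i) * a ^ i" using that by (simp flip: power_add)
    then show ?thesis using assms(1) by (simp add: power_inverse)
  qed
  then show ?thesis unfolding poly_as_sum_upto[OF assms(2)] sum_distrib_left
    by (intro sum.cong) simp_all
qed

section \<open>The domain of a maximal homomorphism is a valuation ring\<close>

context place
begin

lemma adjoinable:
  assumes "\<And>q r. matched q r \<Longrightarrow> poly q u = 0 \<Longrightarrow> poly r y = 0"
  shows "(u, y) \<in> G"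
  using maximal[OF hom_graph_adjoin adjoin_superset, of u y] adjoin_new assms by blast

text \<open>A relation of \<open>inverse a\<close> over the domain, multiplied by
  \<open>a ^ d\<close>, is a relation inside the domain and hence preserved. So
  \<open>inverse a\<close> could be adjoined with value \<open>inverse x\<close>, and by maximality
  it already belongs.\<close>

lemma place_inverse:
  assumes ax: "(a, x) \<in> G" and x: "x \<noteq> 0"
  shows "(inverse a, inverse x) \<in> G"
proof (rule adjoinable)
  have a: "a \<noteq> 0" using ax x hg_zero_eq by auto
  fix q r assume m: "matched q r" and q: "poly q (inverse a) = 0"
  define d where "d = max (degree q) (degree r)"
  have d: "degree q \<le> d" "degree r \<le> d" by (auto simp: d_def)
  have "(\<Sum>i\<le>d. coeff q i * a ^ (d - i), \<Sum>i\<le>d. coeff r i * x ^ (d - i)) \<in> G"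
    using m by (intro hg_sum hg_mult hg_power ax) (simp add: matched_def)
  then have "(0, x ^ d * poly r (inverse x)) \<in> G"
    unfolding poly_inverse_reverse[OF a d(1), symmetric] poly_inverse_reverse[OF x d(2), symmetric] q
    by simp
  then have "x ^ d * poly r (inverse x) = 0" by (rule hg_zero_eq)
  then show "poly r (inverse x) = 0" using x by simp
qed

text \<open>An equation \<open>1 + c_0 + c_1 u + ... + c_n u^n = 0\<close> with all
  \<open>c_i\<close> in the maximal ideal. It is the obstruction to giving \<open>u\<close> a finite
  value.\<close>

definition unit_relation :: "'f \<Rightarrow> nat \<Rightarrow> bool" where
  "unit_relation u n \<longleftrightarrow> (\<exists>q. matched q 1 \<and> degree q \<le> n \<and> poly q u = 0)"

text \<open>The images of the polynomials killing \<open>u\<close> have no common root, since that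
  would be an admissible value for \<open>u\<close>. They are all multiples of one of least degree,
  which is therefore constant and can be scaled to 1.\<close>

lemma unit_relation_exists:
  assumes u: "u \<notin> Domain G"
  shows "\<exists>n. unit_relation u n"
proof -
  define J where "J = {r. \<exists>q. matched q r \<and> poly q u = 0}"
  have no_root: "\<exists>r\<in>J. poly r y \<noteq> 0" for y
    using adjoinable[of u y] u unfolding J_def by blast
  then obtain r0 where r0: "r0 \<in> J" "r0 \<noteq> 0" by (metis poly_0)
  define d where "d = arg_min degree (\<lambda>r. r \<in> J \<and> r \<noteq> 0)"
  have d: "d \<in> J" "d \<noteq> 0" and dmin: "\<And>r. r \<in> J \<Longrightarrow> r \<noteq> 0 \<Longrightarrow> degree d \<le> degree r"
    using arg_min_nat_lemma[of "\<lambda>r. r \<in> J \<and> r \<noteq> 0" r0 degree] r0 by (auto simp: d_def)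
  obtain qd where qd: "matched qd d" "poly qd u = 0" using d(1) by (auto simp: J_def)
  let ?l = "lead_coeff d"
  have "(coeff qd (degree d), ?l) \<in> G" using qd(1) by (simp add: matched_def)
  then have inv: "(inverse (coeff qd (degree d)), inverse ?l) \<in> G"
    using d(2) by (intro place_inverse) auto
  have dvd: "d dvd e" if "e \<in> J" for e
  proof (rule dvd_of_min_degree[OF d(2) dmin _ that])
    fix e n assume "e \<in> J"
    then obtain qe where qe: "matched qe e" "poly qe u = 0" by (auto simp: J_def)
    let ?m = "monom (lead_coeff e * inverse ?l) n"
    let ?q = "qe - monom (coeff qe (degree e) * inverse (coeff qd (degree d))) n * qd"
    have "matched (monom (coeff qe (degree e) * inverse (coeff qd (degree d))) n) ?m"
      using qe(1) inv by (intro matched_monom hg_mult) (simp_all add: matched_def)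
    then have "matched ?q (e - ?m * d)"
      using qe(1) qd(1) by (intro matched_diff matched_mult)
    moreover have "poly ?q u = 0" using qe(2) qd(2) by simp
    ultimately show "e - ?m * d \<in> J" unfolding J_def by blast
  qed
  have "degree d = 0"
  proof (rule ccontr)
    assume "degree d \<noteq> 0"
    then obtain y where "poly d y = 0" using alg_closed_imp_poly_has_root by blast
    obtain r where "r \<in> J" "poly r y \<noteq> 0" using no_root[of y] by (rule bexE)
    moreover then obtain e where "r = d * e" using dvd by (blast elim: dvdE)
    ultimately show False using \<open>poly d y = 0\<close> by simp
  qed
  then obtain l where l: "d = [:l:]" by (rule degree_eq_zeroE)
  then have "[:inverse ?l:] * d = 1" using d(2) by (simp add: one_pCons)
  then have "matched ([:inverse (coeff qd (degree d)):] * qd) 1"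
    using matched_mult[OF matched_const[OF inv] qd(1)] by simp
  then show ?thesis unfolding unit_relation_def using qd(2) by (metis mult_zero_right order_refl poly_mult)
qed

text \<open>Chevalley's degree reduction. Multiplied by \<open>u ^ m\<close>, the relation of
  \<open>inverse u\<close> becomes a relation \<open>s\<close> of \<open>u\<close> whose coefficient
  \<open>?b\<close> at \<open>u ^ m\<close> is a unit. The coefficient \<open>?a\<close> of
  \<open>q\<close> there lies in the maximal ideal because \<open>m > 0\<close>, so subtracting
  \<open>?a / ?b\<close> times \<open>s\<close> lowers the degree without changing any
  residue.\<close>

lemma unit_relation_reduce:
  assumes u: "u \<noteq> 0" and q: "unit_relation u m" and r: "unit_relation (inverse u) n"
    and nm: "n \<le> m" "m > 0"
  shows "unit_relation u (m - 1)"
proof -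
  obtain q where q: "matched q 1" "degree q \<le> m" "poly q u = 0" using q unfolding unit_relation_def by blast
  obtain r where r: "matched r 1" "degree r \<le> n" "poly r (inverse u) = 0" using r unfolding unit_relation_def by blast
  let ?a = "coeff q m" and ?b = "coeff r 0"
  have a: "(?a, 0) \<in> G" using q(1)[unfolded matched_def, rule_format, of m] nm(2) by simp
  have b: "(?b, 1) \<in> G" using r(1)[unfolded matched_def, rule_format, of 0] by simp
  have b0: "?b \<noteq> 0" using b hg_zero_eq by force
  have b': "(inverse ?b, 1) \<in> G" using place_inverse[OF b] by simp
  define s where "s = (\<Sum>i\<le>n. monom (coeff r i) (m - i))"
  have cs: "coeff s j = (\<Sum>i\<le>n. if m - i = j then coeff r i else 0)" for j
    by (simp add: s_def coeff_sum coeff_monom)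
  have cs_G: "\<exists>w. (coeff s j, w) \<in> G" for j
  proof -
    have "(coeff s j, \<Sum>i\<le>n. if m - i = j then coeff 1 i else 0) \<in> G"
      unfolding cs
    proof (rule hg_sum)
      fix i
      have "(coeff r i, coeff 1 i) \<in> G" using r(1) by (simp add: matched_def)
      then show "(if m - i = j then coeff r i else 0, if m - i = j then coeff 1 i else 0) \<in> G"
        using hg_zero by (cases "m - i = j") (simp_all only: if_True if_False refl)
    qed
    then show ?thesis ..
  qed
  have csm: "coeff s m = ?b"
  proof -
    have "coeff s m = (\<Sum>i\<le>n. if i = 0 then coeff r i else 0)"
      unfolding cs using nm by (intro sum.cong) auto
    then show ?thesis by simp
  qed
  have ds: "degree s \<le> m"
    unfolding s_def by (intro degree_sum_le) (auto intro: order_trans[OF degree_monom_le])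
  have "poly s u = (\<Sum>i\<le>n. coeff r i * u ^ (m - i))" by (simp add: s_def poly_sum poly_monom)
  also have "\<dots> = (\<Sum>i\<le>m. coeff r i * u ^ (m - i))"
    using nm(1) r(2) by (intro sum.mono_neutral_left) (auto simp: coeff_eq_0)
  also have "\<dots> = 0"
    using poly_inverse_reverse[OF u, of r m] r(2,3) nm(1) by simp
  finally have ps: "poly s u = 0" .
  define q' where "q' = q - smult (?a * inverse ?b) s"
  have "matched q' 1"
    unfolding matched_def
  proof
    fix j
    obtain w where "(coeff s j, w) \<in> G" using cs_G by blast
    then have "(?a * inverse ?b * coeff s j, 0 * 1 * w) \<in> G" using a b' hg_mult by blast
    moreover have "(coeff q j, coeff 1 j) \<in> G" using q(1) by (simp add: matched_def)
    ultimately have "(coeff q j - ?a * inverse ?b * coeff s j, coeff 1 j - 0 * 1 * w) \<in> G"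
      by (intro hg_diff)
    then show "(coeff q' j, coeff 1 j) \<in> G" by (simp add: q'_def)
  qed
  moreover have "poly q' u = 0" using q(3) ps by (simp add: q'_def)
  moreover have "degree q' \<le> m - 1"
  proof -
    have "degree q' \<le> m" unfolding q'_def
      using q(2) ds degree_smult_le[of "?a * inverse ?b" s] by (intro degree_diff_le) auto
    moreover have "coeff q' m = 0" using b0 csm by (simp add: q'_def)
    ultimately show ?thesis using nm(2)
      by (metis One_nat_def Suc_pred degree_0 diff_le_self leading_coeff_0_iff le_neq_implies_less less_Suc_eq_le zero_le)
  qed
  ultimately show ?thesis unfolding unit_relation_def by blast
qed

text \<open>Otherwise both \<open>u\<close> and \<open>inverse u\<close> have unit relations. With
  both degrees least possible, the one of larger or equal degree could be reduced by the
  other.\<close>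

lemma valuation_ring:
  assumes "u \<noteq> 0"
  shows "u \<in> Domain G \<or> inverse u \<in> Domain G"
proof (rule ccontr)
  assume "\<not> ?thesis"
  then have ex: "\<exists>n. unit_relation u n" "\<exists>n. unit_relation (inverse u) n"
    using unit_relation_exists by blast+
  have no0: "\<not> unit_relation w 0" for w
  proof
    assume "unit_relation w 0"
    then obtain q where q: "matched q 1" "degree q = 0" "poly q w = 0" by (auto simp: unit_relation_def)
    then obtain c where c: "q = [:c:]" by (auto elim: degree_eq_zeroE)
    then have "c = 0" using q(3) by simp
    then have "(0, 1) \<in> G" using q(1)[unfolded matched_def, rule_format, of 0] c by simp
    then show False using hg_zero_eq by force
  qed
  define m where "m = (LEAST n. unit_relation u n)"
  define n where "n = (LEAST n. unit_relation (inverse u) n)"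
  have m: "unit_relation u m" "\<And>k. k < m \<Longrightarrow> \<not> unit_relation u k"
    using ex(1) unfolding m_def by (auto intro: LeastI_ex dest: not_less_Least)
  have n: "unit_relation (inverse u) n" "\<And>k. k < n \<Longrightarrow> \<not> unit_relation (inverse u) k"
    using ex(2) unfolding n_def by (auto intro: LeastI_ex dest: not_less_Least)
  have pos: "m > 0" "n > 0" using m(1) n(1) no0 by (metis gr0I)+
  show False
  proof (cases "n \<le> m")
    case True
    then show False using unit_relation_reduce[OF assms m(1) n(1)] pos m(2)[of "m - 1"] by simp
  next
    case False
    then show False using unit_relation_reduce[of "inverse u" n m] assms m(1) n pos by simp
  qed
qed

lemma not_in_domain: "a \<notin> Domain G \<Longrightarrow> (inverse a, 0) \<in> G"
proof -
  assume a: "a \<notin> Domain G"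
  then have "a \<noteq> 0" using hg_zero by auto
  then obtain y where y: "(inverse a, y) \<in> G" using valuation_ring a by blast
  have "y = 0" using place_inverse[OF y] a by auto
  then show ?thesis using y by simp
qed

end


section \<open>The discrete valuation attached to a place\<close>

context place
begin

definition maxid :: "'f set" where "maxid = {a. (a, 0) \<in> G}"

lemma maxid_iff: "a \<in> maxid \<longleftrightarrow> (a, 0) \<in> G"
  by (simp add: maxid_def)

lemma maxid_mult: "a \<in> Domain G \<Longrightarrow> b \<in> maxid \<Longrightarrow> a * b \<in> maxid"
  using hg_mult by (fastforce simp: maxid_def)

lemma maxid_mult': "a \<in> maxid \<Longrightarrow> b \<in> Domain G \<Longrightarrow> a * b \<in> maxid"
  using maxid_mult[of b a] by (simp add: mult.commute)

lemma maxid_domain: "a \<in> maxid \<Longrightarrow> a \<in> Domain G"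
  by (auto simp: maxid_def)

lemma domain_one: "1 \<in> Domain G" using hg_one by blast

lemma domain_mult: "a \<in> Domain G \<Longrightarrow> b \<in> Domain G \<Longrightarrow> a * b \<in> Domain G"
  using hg_mult by blast

lemma domain_add: "a \<in> Domain G \<Longrightarrow> b \<in> Domain G \<Longrightarrow> a + b \<in> Domain G"
  using hg_add by blast

lemma domain_inverse_iff: "a \<noteq> 0 \<Longrightarrow> a \<in> Domain G \<longleftrightarrow> inverse a \<notin> maxid"
proof
  assume a: "a \<noteq> 0" "a \<in> Domain G"
  show "inverse a \<notin> maxid"
  proof
    assume "inverse a \<in> maxid"
    then have "a * inverse a \<in> maxid" using a(2) by (intro maxid_mult)
    then have "(1, 0) \<in> G" using a(1) by (simp add: maxid_iff)
    then show False using hg_unique[OF hg_one, of 0] by simp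
  qed
qed (use not_in_domain maxid_iff in blast)

text \<open>The residue of \<open>q(t)\<close> is the constant coefficient of \<open>q\<close>;
  after dividing out powers of \<open>t\<close> this is nonzero.\<close>

lemma trans_elt_of_maxid:
  assumes "t \<in> maxid" "t \<noteq> 0"
  shows "trans_elt t"
  unfolding trans_elt_def
proof (intro allI impI)
  fix q :: "'k poly" assume "q \<noteq> 0"
  then show "peval q t \<noteq> 0"
  proof (induction q)
    case (pCons c q)
    show ?case
    proof (cases "c = 0")
      case True
      then show ?thesis using pCons assms(2) by auto
    next
      case False
      have "(peval (pCons c q) t, to_ac.peval (pCons c q) 0) \<in> G"
        using assms(1) by (intro hg_peval) (simp add: maxid_iff)
      then have "(peval (pCons c q) t, to_ac c) \<in> G" by simp
      then show ?thesis using False hg_zero_eq[of "to_ac c"] by (metis to_ac_eq_0_iff)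
    qed
  qed simp
qed

text \<open>In a relation between the \<open>x_j\<close> with coefficients \<open>p_j(x_0)\<close>,
  normalised so that some \<open>p_j\<close> has nonzero constant term, take the largest such
  \<open>j\<close> and divide by \<open>x_j\<close>. All other terms lie in the maximal ideal:
  earlier ones by the chain condition, later ones because \<open>p_i\<close> has a factor
  \<open>x_0\<close>. So \<open>p_j(x_0)\<close> lies in it too, which its constant term
  forbids.\<close>

lemma chain_bound:
  fixes x :: "nat \<Rightarrow> 'f"
  assumes S: "finite S" "\<And>u. u \<in> lin_span (ratfuns (x 0)) S"
    and x: "\<And>i. i \<le> n \<Longrightarrow> x i \<in> maxid" "\<And>i. i \<le> n \<Longrightarrow> x i \<noteq> 0"
    and step: "\<And>i. i < n \<Longrightarrow> x i / x (Suc i) \<in> maxid"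
  shows "n < card S"
proof (rule ccontr)
  assume "\<not> n < card S"
  then have "card S < card {..n}" by simp
  interpret R: subfield_set "ratfuns (x 0)" by (rule subfield_ratfuns)
  obtain a where a: "\<And>j. j \<in> {..n} \<Longrightarrow> a j \<in> ratfuns (x 0)" "\<exists>j\<in>{..n}. a j \<noteq> 0"
    "(\<Sum>j\<in>{..n}. a j * x j) = 0"
    using R.lin_dependent[OF S(1) _ \<open>card S < card {..n}\<close>, of x] S(2) by auto
  obtain D p where Dp: "D \<noteq> 0" "\<And>j. j \<in> {..n} \<Longrightarrow> peval (p j) (x 0) = D * a j"
    using ratfuns_clear_denominators[of "{..n}" a "x 0"] a(1) by auto
  have x0: "x 0 \<noteq> 0" using x(2) by simp
  \<comment> \<open>When all constant terms vanish, \<open>x 0\<close> is divided out; the degree of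
    a fixed nonzero member measures the descent.\<close>
  have "\<exists>p. (\<exists>j\<le>n. coeff (p j) 0 \<noteq> 0) \<and> (\<Sum>j\<le>n. peval (p j) (x 0) * x j) = 0"
    if "j0 \<le> n" "p j0 \<noteq> 0" "(\<Sum>j\<le>n. peval (p j) (x 0) * x j) = 0" for p j0
    using that
  proof (induction "degree (p j0)" arbitrary: p rule: less_induct)
    case less
    show ?case
    proof (cases "\<exists>j\<le>n. coeff (p j) 0 \<noteq> 0")
      case True
      then show ?thesis using less.prems by blast
    next
      case False
      have "\<forall>j. \<exists>q. j \<le> n \<longrightarrow> p j = pCons 0 q" using False by (metis coeff_pCons_0 pCons_cases)
      then obtain q where q: "\<And>j. j \<le> n \<Longrightarrow> p j = pCons 0 (q j)" by metis
      have "x 0 * (\<Sum>j\<le>n. peval (q j) (x 0) * x j) = (\<Sum>j\<le>n. peval (p j) (x 0) * x j)"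
        by (simp add: sum_distrib_left q mult.assoc)
      then have "(\<Sum>j\<le>n. peval (q j) (x 0) * x j) = 0" using less.prems(3) x0 by simp
      moreover have "q j0 \<noteq> 0" "degree (q j0) < degree (p j0)" using q[of j0] less.prems by auto
      ultimately show ?thesis using less.hyps[of q] less.prems(1) by blast
    qed
  qed
  moreover have "\<exists>j\<le>n. p j \<noteq> 0"
  proof -
    obtain j where "j \<le> n" "a j \<noteq> 0" using a(2) by auto
    then show ?thesis using Dp(1) Dp(2)[of j] by auto
  qed
  moreover have "(\<Sum>j\<le>n. peval (p j) (x 0) * x j) = 0"
    using a(3) Dp(2) by (simp add: mult.assoc flip: sum_distrib_left)
  ultimately obtain p where p: "\<exists>j\<le>n. coeff (p j) 0 \<noteq> 0" "(\<Sum>j\<le>n. peval (p j) (x 0) * x j) = 0"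
    by blast
  define j where "j = Max {j. j \<le> n \<and> coeff (p j) 0 \<noteq> 0}"
  have fin: "finite {j. j \<le> n \<and> coeff (p j) 0 \<noteq> 0}" by simp
  have j: "j \<le> n" "coeff (p j) 0 \<noteq> 0" using Max_in[OF fin] p(1) by (auto simp: j_def)
  have jmax: "coeff (p i) 0 = 0" if "i \<le> n" "j < i" for i
    using Max_ge[OF fin, of i] that by (fastforce simp: j_def)
  have x0G: "(x 0, 0) \<in> G" using x(1)[of 0] by (simp add: maxid_iff)
  have pG: "(peval q (x 0), to_ac (coeff q 0)) \<in> G" for q
    using hg_peval[OF x0G, of q] by (cases q) simp
  have quot: "x i / x k \<in> maxid" if "i < k" "k \<le> n" for i k
    using that
  proof (induction k)
    case (Suc k)
    show ?case
    proof (cases "i = k")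
      case True
      then show ?thesis using step Suc.prems by simp
    next
      case False
      then have "x i / x k \<in> maxid" using Suc by simp
      moreover have "x k / x (Suc k) \<in> maxid" using step Suc.prems by simp
      ultimately have "(x i / x k) * (x k / x (Suc k)) \<in> maxid"
        using maxid_mult maxid_domain by blast
      then show ?thesis using x(2)[of k] Suc.prems by simp
    qed
  qed simp
  have "peval (p i) (x 0) * x i / x j \<in> maxid" if "i \<le> n" "i \<noteq> j" for i
  proof (cases "i < j")
    case True
    then have "peval (p i) (x 0) * (x i / x j) \<in> maxid" using quot j(1) pG by (intro maxid_mult) auto
    then show ?thesis by simp
  next
    case False
    then have "coeff (p i) 0 = 0" using jmax that by simp
    then obtain q where q: "p i = pCons 0 q" by (metis coeff_pCons_0 pCons_cases)
    have "x 0 / x j \<in> Domain G"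
      using quot[of 0 j] j(1) maxid_domain x0 domain_one by (cases "j = 0") auto
    then have "(peval q (x 0) * (x 0 / x j)) * x i \<in> maxid"
      using pG x(1) that by (intro maxid_mult domain_mult) auto
    then show ?thesis by (simp add: q mult_ac)
  qed
  then have "(\<Sum>i\<in>{..n} - {j}. peval (p i) (x 0) * x i / x j) \<in> maxid"
    unfolding maxid_iff using hg_sum[of "{..n} - {j}" _ "\<lambda>_. 0"] by simp
  moreover have "(\<Sum>i\<in>{..n} - {j}. peval (p i) (x 0) * x i / x j) = - peval (p j) (x 0)"
  proof -
    have "0 = (\<Sum>i\<le>n. peval (p i) (x 0) * x i / x j)"
      using p(2) by (simp flip: sum_divide_distrib)
    also have "\<dots> = peval (p j) (x 0) * x j / x j + (\<Sum>i\<in>{..n} - {j}. peval (p i) (x 0) * x i / x j)"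
      using j(1) by (intro sum.remove) auto
    finally show ?thesis using x(2)[OF j(1)] by (simp add: eq_neg_iff_add_eq_0 add.commute)
  qed
  ultimately have "(- peval (p j) (x 0), 0) \<in> G" by (simp add: maxid_iff)
  then have "(peval (p j) (x 0), 0) \<in> G" using hg_uminus by fastforce
  then have "to_ac (coeff (p j) 0) = 0" using pG hg_unique by blast
  then show False using j(2) by simp
qed

text \<open>
  The members of a chain, each a proper multiple of the next, are independent over \<open>K(t)\<close> with \<open>t\<close>
  the first member. Chains are therefore bounded, and a longest one ends in a uniformizer.
\<close>

lemma valuation_of_place:
  assumes fin: "\<And>t. trans_elt t \<Longrightarrow> \<exists>S. finite S \<and> (\<forall>u. u \<in> lin_span (ratfuns t) S)"
    and t: "t \<in> maxid" "t \<noteq> 0"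
  shows "\<exists>v. is_valuation emb v \<and> (\<forall>a\<in>maxid. 0 < v a)"
proof -
  let ?chain = "\<lambda>x n. (\<forall>i\<le>n. x i \<in> maxid \<and> x i \<noteq> 0) \<and> (\<forall>i<n. x i / x (Suc i) \<in> maxid)"
  have bound: "\<exists>N. \<forall>x n. x 0 = u \<and> ?chain x n \<longrightarrow> n < N" if "u \<in> maxid" "u \<noteq> 0" for u
  proof -
    note u = that
    obtain S where S: "finite S" "\<And>w. w \<in> lin_span (ratfuns u) S"
      using fin[OF trans_elt_of_maxid, of u] u by blast
    have "n < card S" if "x 0 = u" "?chain x n" for x n
      by (rule chain_bound[of S x n]) (use S that in auto)
    then show ?thesis by blast
  qed
  obtain pi where pi: "pi \<in> maxid" "pi \<noteq> 0" "\<And>y. y \<in> maxid \<Longrightarrow> y / pi \<in> Domain G"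
  proof -
    obtain N where N: "\<And>x n. x 0 = t \<and> ?chain x n \<Longrightarrow> n < N" using bound[OF t] by blast
    define A where "A = {n. \<exists>x. x 0 = t \<and> ?chain x n}"
    have "A \<subseteq> {..<N}" using N unfolding A_def by blast
    then have finA: "finite A" by (rule finite_subset) simp
    have "0 \<in> A" unfolding A_def using t by (intro CollectI exI[of _ "\<lambda>_. t"]) simp
    then have "Max A \<in> A" using finA by (intro Max_in) auto
    then obtain x where x: "x 0 = t" "?chain x (Max A)" unfolding A_def by blast
    let ?n = "Max A"
    have "y / x ?n \<in> Domain G" if y: "y \<in> maxid" for y
    proof (rule ccontr)
      assume nd: "y / x ?n \<notin> Domain G"
      then have y0: "y \<noteq> 0" using hg_zero by auto
      have "x ?n / y \<in> maxid" using not_in_domain[OF nd] by (simp add: maxid_iff)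
      then have "?chain (x(Suc ?n := y)) (Suc ?n)"
        using x(2) y y0 by (auto simp: le_Suc_eq less_Suc_eq)
      moreover have "(x(Suc ?n := y)) 0 = t" using x(1) by simp
      ultimately have "Suc ?n \<in> A" unfolding A_def by blast
      then show False using Max_ge[OF finA] by fastforce
    qed
    then show ?thesis using that x(2) by blast
  qed
  define U where "U = {a. a \<in> Domain G \<and> a \<notin> maxid}"
  have U0: "a \<noteq> 0" if "a \<in> U" for a using that hg_zero by (auto simp: U_def maxid_iff)
  have Uinv: "inverse a \<in> U" if "a \<in> U" for a
    using that domain_inverse_iff[of a] domain_inverse_iff[of "inverse a"] U0[OF that] by (simp add: U_def)
  have Umult: "a * b \<in> U" if "a \<in> U" "b \<in> U" for a b
  proof -
    have "a * b \<in> Domain G" using that domain_mult by (simp add: U_def)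
    moreover have "a * b \<notin> maxid"
    proof
      assume "a * b \<in> maxid"
      moreover have "inverse a \<in> Domain G" using Uinv[OF that(1)] by (simp add: U_def)
      ultimately have "inverse a * (a * b) \<in> maxid" by (rule maxid_mult[rotated])
      moreover have "inverse a * (a * b) = b" using U0[OF that(1)] by simp
      ultimately show False using that(2) by (simp add: U_def)
    qed
    ultimately show ?thesis by (simp add: U_def)
  qed
  have Uone: "1 \<in> U" using domain_one domain_inverse_iff[of 1] by (simp add: U_def)
  have rep_dom: "\<exists>k::nat. u / pi ^ k \<in> U" if u: "u \<in> Domain G" "u \<noteq> 0" for u
  proof (cases "u \<in> maxid")
    case False
    then show ?thesis using u by (intro exI[of _ 0]) (simp add: U_def)
  next
    case True
    obtain N where N: "\<And>x n. x 0 = u \<and> ?chain x n \<Longrightarrow> n < N" using bound[OF True u(2)] by blast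
    define A where "A = {k. u / pi ^ k \<in> Domain G}"
    have "pi ^ Suc k \<in> maxid" for k
      using pi(1) maxid_domain by (induction k) (simp_all add: maxid_mult)
    then have pik: "pi ^ k \<in> maxid" if "k > 0" for k using that gr0_implies_Suc by blast
    have "k \<le> N" if "k \<in> A" for k
    proof (cases k)
      case (Suc l)
      \<comment> \<open>The chain \<open>u, pi^(k-1), ..., pi\<close> starts at \<open>u\<close>, so
        its length is bounded in terms of \<open>u\<close>; its first quotient is
        \<open>u / pi^k * pi\<close>.\<close>
      define x where "x = (\<lambda>i. if i = 0 then u else pi ^ (k - i))"
      have "?chain x l"
      proof (intro conjI allI impI)
        fix i assume "i \<le> l"
        then show "x i \<in> maxid" "x i \<noteq> 0" using True u(2) pi(2) pik Suc by (auto simp: x_def)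
      next
        fix i assume i: "i < l"
        show "x i / x (Suc i) \<in> maxid"
        proof (cases "i = 0")
          case True
          have "u / pi ^ k * pi \<in> maxid" using that pi(1) unfolding A_def by (intro maxid_mult) auto
          moreover have "u / pi ^ k * pi = u / pi ^ l" using pi(2) Suc by simp
          ultimately show ?thesis using True Suc by (simp add: x_def)
        next
          case False
          have "k - i = Suc (k - Suc i)" using i Suc by simp
          then have "x i / x (Suc i) = pi" using False pi(2) by (simp add: x_def)
          then show ?thesis using pi(1) by simp
        qed
      qed
      then have "l < N" using N[of x l] by (simp add: x_def)
      then show ?thesis using Suc by simp
    qed simp
    then have finA: "finite A" by (meson finite_nat_set_iff_bounded_le)
    have "0 \<in> A" using u by (simp add: A_def)
    then have mx: "Max A \<in> A" using finA by (intro Max_in) auto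
    have "u / pi ^ Max A \<notin> maxid"
    proof
      assume "u / pi ^ Max A \<in> maxid"
      then have "u / pi ^ Max A / pi \<in> Domain G" by (rule pi(3))
      then have "Suc (Max A) \<in> A" by (simp add: A_def mult.commute)
      then show False using Max_ge[OF finA] by fastforce
    qed
    then show ?thesis using mx by (auto simp: U_def A_def)
  qed
  have rep: "\<exists>k::int. u * pi powi (- k) \<in> U" if "u \<noteq> 0" for u
  proof (cases "u \<in> Domain G")
    case True
    then obtain k :: nat where "u / pi ^ k \<in> U" using rep_dom \<open>u \<noteq> 0\<close> by blast
    then show ?thesis by (intro exI[of _ "int k"]) (simp add: power_int_minus divide_inverse)
  next
    case False
    then have "inverse u \<in> Domain G" using not_in_domain by blast
    then obtain k :: nat where "inverse u / pi ^ k \<in> U" using rep_dom[of "inverse u"] \<open>u \<noteq> 0\<close> by auto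
    then have "inverse (inverse u / pi ^ k) \<in> U" by (rule Uinv)
    then show ?thesis by (intro exI[of _ "- int k"]) (simp add: mult.commute divide_inverse)
  qed
  have pw_maxid: "pi powi k \<in> maxid" if "k > 0" for k
  proof -
    define n where "n = nat k - 1"
    have n: "k = int (Suc n)" using that by (simp add: n_def)
    have "pi ^ n \<in> Domain G" for n using pi(1) maxid_domain domain_one domain_mult by (induction n) auto
    then have "pi ^ Suc n \<in> maxid" using maxid_mult'[OF pi(1)] by simp
    then show ?thesis unfolding n power_int_of_nat .
  qed
  have uniq: "k = l" if "u * pi powi (- k) \<in> U" "u * pi powi (- l) \<in> U" for u k l
  proof -
    have no: "\<not> k < l" if "u * pi powi (- k) \<in> U" "u * pi powi (- l) \<in> U" for k l
    proof
      assume "k < l"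
      have "u \<noteq> 0" using U0[OF that(1)] by auto
      have "u * pi powi (- k) = (u * pi powi (- l)) * pi powi (l - k)"
        using pi(2) by (simp add: mult.assoc flip: power_int_add)
      also have "\<dots> \<in> maxid" using that(2) pw_maxid \<open>k < l\<close> by (intro maxid_mult) (auto simp: U_def)
      finally show False using that(1) by (simp add: U_def)
    qed
    then show ?thesis using that by (meson linorder_neqE)
  qed
  \<comment> \<open>The order at the place: the exponent for which \<open>u\<close> is a unit times
    a power of the uniformizer.\<close>
  define w where "w = (\<lambda>u. THE k::int. u * pi powi (- k) \<in> U)"
  have w: "u * pi powi (- w u) \<in> U" if "u \<noteq> 0" for u
  proof -
    obtain k :: int where k: "u * pi powi (- k) \<in> U" using rep \<open>u \<noteq> 0\<close> by blast
    then have "\<exists>!k::int. u * pi powi (- k) \<in> U" using uniq[OF _ k] by (rule ex1I)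
    then show ?thesis unfolding w_def by (rule theI')
  qed
  have weq: "w u = k" if "u * pi powi (- k) \<in> U" for u k
  proof (rule uniq[OF w that])
    show "u \<noteq> 0" using U0[OF that] by auto
  qed
  have wmult: "w (a * b) = w a + w b" if "a \<noteq> 0" "b \<noteq> 0" for a b
  proof (rule weq)
    have "pi powi (- (w a + w b)) = pi powi (- w a) * pi powi (- w b)"
      using pi(2) power_int_add[of pi "- w a" "- w b"] by simp
    then have "a * b * pi powi (- (w a + w b)) = (a * pi powi (- w a)) * (b * pi powi (- w b))"
      by (simp only: mult_ac)
    then show "a * b * pi powi (- (w a + w b)) \<in> U" using Umult w that by metis
  qed
  have wdom: "a \<in> Domain G \<longleftrightarrow> 0 \<le> w a" if "a \<noteq> 0" for a
  proof -
    have e: "a = (a * pi powi (- w a)) * pi powi (w a)" using pi(2) by (simp add: mult.assoc flip: power_int_add)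
    have ud: "a * pi powi (- w a) \<in> Domain G" using w[OF that] by (simp add: U_def)
    show ?thesis
    proof
      assume "0 \<le> w a"
      then have "pi powi (w a) \<in> Domain G"
        using pw_maxid maxid_domain domain_one by (cases "w a = 0") auto
      then show "a \<in> Domain G" using e domain_mult[OF ud] by metis
    next
      assume a: "a \<in> Domain G"
      show "0 \<le> w a"
      proof (rule ccontr)
        assume "\<not> 0 \<le> w a"
        then have "a * pi powi (- w a) \<in> maxid" using a pw_maxid by (intro maxid_mult) auto
        then show False using w[OF that] by (simp add: U_def)
      qed
    qed
  qed
  define v where "v = (\<lambda>u. if u = 0 then \<infinity> else ereal (real_of_int (w u)))"
  have w1: "w pi = 1" using pi(2) Uone by (intro weq) (simp add: power_int_minus)
  have "is_valuation emb v"
    unfolding is_valuation_def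
  proof (intro conjI allI impI)
    show "v 0 = \<infinity>" by (simp add: v_def)
    show "\<exists>k::int. v a = ereal (real_of_int k)" if "a \<noteq> 0" for a using that by (auto simp: v_def)
    show "\<exists>a. v a = 1" using w1 pi(2) by (intro exI[of _ pi]) (simp add: v_def)
    show "v (a * b) = v a + v b" for a b using wmult by (simp add: v_def)
    show "v (emb c) = 0" if "c \<noteq> 0" for c
    proof -
      have "emb c \<in> U" using hg_emb[of c] hg_unique[OF hg_emb[of c], of 0] that
        by (auto simp: U_def maxid_iff)
      then have "w (emb c) = 0" by (intro weq) simp
      then show ?thesis using that by (simp add: v_def zero_ereal_def)
    qed
    fix a b
    \<comment> \<open>The ultrametric inequality says that \<open>1 + d / c\<close> is in the
      valuation ring when \<open>d / c\<close> is.\<close>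
    have le: "w c \<le> w (c + d)" if "c \<noteq> 0" "d \<noteq> 0" "c + d \<noteq> 0" "w c \<le> w d" for c d
    proof -
      have "w d = w c + w (d / c)" using wmult[of c "d / c"] that by simp
      then have "d / c \<in> Domain G" using wdom[of "d / c"] that by simp
      then have "1 + d / c \<in> Domain G" using domain_one domain_add by blast
      moreover have e: "c + d = c * (1 + d / c)" using that by (simp add: field_simps)
      moreover have "1 + d / c \<noteq> 0" using e that(3) by auto
      ultimately show ?thesis using wdom[of "1 + d / c"] wmult[of c "1 + d / c"] that by simp
    qed
    show "min (v a) (v b) \<le> v (a + b)"
    proof (cases "a = 0 \<or> b = 0 \<or> a + b = 0")
      case True
      then show ?thesis by (auto simp: v_def)
    next
      case False
      then have "w a \<le> w (a + b) \<or> w b \<le> w (a + b)"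
        using le[of a b] le[of b a] by (metis add.commute linear)
      then show ?thesis using False by (auto simp: v_def min_def)
    qed
  qed
  moreover have "0 < v a" if a: "a \<in> maxid" for a
  proof (cases "a = 0")
    case False
    have "inverse a \<notin> Domain G" using domain_inverse_iff[of "inverse a"] a False by simp
    then have "\<not> 0 \<le> w (inverse a)" using wdom[of "inverse a"] False by simp
    moreover have "w a + w (inverse a) = 0"
      using wmult[of a "inverse a"] weq[of 1 0] Uone False by simp
    ultimately show ?thesis using False by (simp add: v_def zero_ereal_def)
  qed (simp add: v_def)
  ultimately show ?thesis by blast
qed

end

text \<open>Evaluation at 0 is well defined on \<open>K[t]\<close> as \<open>t\<close> is
  transcendental. A place extending it has \<open>t\<close> in its maximal ideal, where the attached
  valuation is positive.\<close>

lemma (in smooth_projective_geom_irreducible_curve) valuation_exists: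
  assumes t: "trans_elt t"
  shows "\<exists>v. is_valuation emb v \<and> 0 < v t"
proof -
  let ?G = "{(peval p t, to_ac.peval p 0) | p. True}"
  have "hom_graph emb ?G"
  proof
    show "(emb c, to_ac c) \<in> ?G" for c by (intro CollectI exI[of _ "[:c:]"]) simp
    fix a x b y assume "(a, x) \<in> ?G" "(b, y) \<in> ?G"
    then obtain p q where "a = peval p t" "x = to_ac.peval p 0" "b = peval q t" "y = to_ac.peval q 0" by blast
    then have "(a + b, x + y) = (peval (p + q) t, to_ac.peval (p + q) 0)"
      "(a * b, x * y) = (peval (p * q) t, to_ac.peval (p * q) 0)" by simp_all
    then show "(a + b, x + y) \<in> ?G" "(a * b, x * y) \<in> ?G" by blast+
  next
    fix x assume "(0, x) \<in> ?G"
    then obtain p where p: "peval p t = 0" "x = to_ac.peval p 0" by auto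
    then have "p = 0" using t by (auto simp: trans_elt_def)
    then show "x = 0" using p by simp
  qed
  then obtain H where H: "place emb H" "?G \<subseteq> H" using hom_graph.place_exists by blast
  have "(peval [:0, 1:] t, to_ac.peval [:0, 1:] 0) \<in> H" using H(2) by blast
  then have tH: "(t, 0) \<in> H" by (simp add: emb_one)
  have "t \<noteq> 0" using t unfolding trans_elt_def by (metis peval_pCons peval_0 emb_zero mult_zero_left add_0 one_neq_zero pCons_eq_0_iff)
  then have "\<exists>v. is_valuation emb v \<and> (\<forall>a\<in>place.maxid H. 0 < v a)"
    using place.valuation_of_place[OF H(1), of t] finite_over_ratfuns tH
    by (metis place.maxid_iff[OF H(1)])
  then show ?thesis using tH place.maxid_iff[OF H(1)] by blast
qed

subsection \<open>Constants and geometric irreducibility\<close>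

lemma total_degree_add:
  "(\<Sum>i\<in>keys (m + n). lookup (m + n) i) = (\<Sum>i\<in>keys m. lookup m i) + (\<Sum>i\<in>keys n. lookup n i :: nat)"
proof -
  let ?A = "keys m \<union> keys n"
  have s: "(\<Sum>i\<in>keys k. lookup k i) = (\<Sum>i\<in>?A. lookup k i)" if "keys k \<subseteq> ?A" for k :: "'a \<Rightarrow>\<^sub>0 nat"
    using that by (intro sum.mono_neutral_left) (auto simp: in_keys_iff)
  have "(\<Sum>i\<in>keys (m + n). lookup (m + n) i) = (\<Sum>i\<in>?A. lookup (m + n) i)" by (rule s[OF keys_add])
  also have "\<dots> = (\<Sum>i\<in>?A. lookup m i) + (\<Sum>i\<in>?A. lookup n i)" by (simp add: lookup_add sum.distrib)
  finally show ?thesis by (simp add: s)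
qed

lemma homogeneous_mult:
  assumes "homogeneous_of_degree a f" "homogeneous_of_degree b g"
  shows "homogeneous_of_degree (a + b) (f * g)"
  unfolding homogeneous_of_degree_def
proof
  fix m assume "m \<in> keys (f * g)"
  then obtain k l where "m = k + l" "k \<in> keys f" "l \<in> keys g" using keys_mult[of f g] by blast
  then show "(\<Sum>i\<in>keys m. lookup m i) = a + b"
    using assms by (simp add: total_degree_add homogeneous_of_degree_def)
qed

lemma homogeneous_one: "homogeneous_of_degree 0 (1 :: ('i, 'k::semiring_1) mpolynomial)"
  by (auto simp: homogeneous_of_degree_def in_keys_iff lookup_one when_def split: if_splits)

lemma homogeneous_power: "homogeneous_of_degree a f \<Longrightarrow> homogeneous_of_degree (n * a) (f ^ n)"
  by (induction n) (simp_all add: homogeneous_one homogeneous_mult)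

lemma homogeneous_single:
  "(\<Sum>i\<in>keys m. lookup m i) = d \<Longrightarrow> homogeneous_of_degree d (Poly_Mapping.single m c)"
  by (simp add: homogeneous_of_degree_def)

lemma homogeneous_sum:
  assumes "\<And>i. i \<in> I \<Longrightarrow> homogeneous_of_degree d (f i)"
  shows "homogeneous_of_degree d (sum f I)"
  unfolding homogeneous_of_degree_def
proof
  fix m assume "m \<in> keys (sum f I)"
  then obtain i where "i \<in> I" "m \<in> keys (f i)" using keys_sum[of f I] by blast
  then show "(\<Sum>i\<in>keys m. lookup m i) = d" using assms by (auto simp: homogeneous_of_degree_def)
qed

lemma homogeneous_prod:
  assumes "finite I" "\<And>i. i \<in> I \<Longrightarrow> homogeneous (f i)"
  shows "homogeneous (\<Prod>i\<in>I. f i :: ('i, 'k::comm_ring_1) mpolynomial)"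
  using assms
proof (induction I rule: finite_induct)
  case empty
  then show ?case using homogeneous_one by (auto simp: homogeneous_def)
next
  case (insert i I)
  then show ?case using homogeneous_mult by (fastforce simp: homogeneous_def)
qed

lemma field_embedding_ident: "field_embedding (\<lambda>c :: 'a::field. c)"
  by standard simp_all

context smooth_projective_geom_irreducible_curve
begin

lemma ideal_vanishes:
  assumes "h \<in> homogeneous_ideal emb \<xi>" "xi i0 \<noteq> 0"
  shows "mpoly_eval emb h (\<lambda>i. xi i / xi i0) = 0"
proof -
  obtain d where d: "homogeneous_of_degree d h" "mpoly_eval emb h xi = 0"
    using assms(1) by (auto simp: homogeneous_ideal_def homogeneous_def)
  then show ?thesis
    using mpoly_eval_homogeneous[OF d(1), of "inverse (xi i0)" xi] by (simp add: divide_inverse mult.commute)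
qed

text \<open>The ratios \<open>xi i / xi i0\<close> satisfy the homogeneous ideal, and a homomorphism
  over \<open>K\<close> carries this to their values. The value with index \<open>i0\<close> is 1,
  so the vector is nonzero.\<close>

lemma place_point:
  assumes H: "place emb H" and i0: "xi i0 \<noteq> 0" and z: "\<And>i. (xi i / xi i0, z $ i) \<in> H"
  shows "z \<in> geometric_points emb \<xi>"
proof -
  interpret H: place emb H by (rule H)
  have "(1, z $ i0) \<in> H" using z[of i0] i0 by simp
  then have "z $ i0 = 1" using H.hg_unique[OF H.hg_one, of "z $ i0"] by simp
  then have "z \<noteq> 0" by auto
  moreover have "mpoly_eval to_ac f (\<lambda>i. z $ i) = 0" if "f \<in> homogeneous_ideal emb \<xi>" for f
    using H.hg_mpoly_eval[of "\<lambda>i. xi i / xi i0" "\<lambda>i. z $ i" f] z ideal_vanishes[OF that i0] H.hg_zero_eq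
    by simp
  ultimately show ?thesis by (simp add: geometric_points_def)
qed

text \<open>
  For all but finitely many \<open>\<tau>\<close>, a place above \<open>t \<mapsto> \<tau>\<close> is finite at \<open>e\<close>: reduce an equation of
  \<open>e\<close> over \<open>K(t)\<close>, the leading coefficient does not vanish at \<open>\<tau>\<close>.
\<close>

lemma finite_at_almost_all:
  assumes t: "trans_elt t"
  obtains p where "p \<noteq> 0"
    "\<And>H y. place emb H \<Longrightarrow> (t, y) \<in> H \<Longrightarrow> to_ac.peval p y \<noteq> 0 \<Longrightarrow> e \<in> Domain H"
proof -
  obtain w where w: "w \<noteq> 0" "\<forall>i. coeff w i \<in> ratfuns t" "poly w e = 0"
    using algebraic_over_ratfuns[OF t, of e] unfolding subfield_set.algebraic_over_def[OF subfield_ratfuns] by blast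
  obtain D p where D: "D \<noteq> 0" "\<And>j. j \<in> {..degree w} \<Longrightarrow> peval (p j) t = D * coeff w j"
    using ratfuns_clear_denominators[of "{..degree w}" "coeff w" t] w(2) by auto
  let ?n = "degree w"
  have lc: "p ?n \<noteq> 0" using D(2)[of ?n] D(1) w(1) by auto
  show ?thesis
  proof (rule that[OF lc])
    fix H y assume H: "place emb H" and ty: "(t, y) \<in> H" and nz: "to_ac.peval (p ?n) y \<noteq> 0"
    interpret H: place emb H by (rule H)
    show "e \<in> Domain H"
    proof (rule ccontr)
      assume nd: "e \<notin> Domain H"
      then have e0: "e \<noteq> 0" using H.hg_zero by auto
      have ie: "(inverse e, 0) \<in> H" by (rule H.not_in_domain[OF nd])
      have "inverse e ^ ?n * poly w (inverse (inverse e)) = (\<Sum>i\<le>?n. coeff w i * inverse e ^ (?n - i))"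
        using poly_inverse_reverse[of "inverse e" w ?n] e0 by simp
      then have "(\<Sum>i\<le>?n. coeff w i * inverse e ^ (?n - i)) = 0" using w(3) by simp
      then have "D * (\<Sum>i\<le>?n. coeff w i * inverse e ^ (?n - i)) = 0" by simp
      then have "(\<Sum>i\<le>?n. peval (p i) t * inverse e ^ (?n - i)) = 0"
        using D(2) by (simp add: sum_distrib_left mult.assoc)
      moreover have "(\<Sum>i\<le>?n. peval (p i) t * inverse e ^ (?n - i),
          \<Sum>i\<le>?n. to_ac.peval (p i) y * 0 ^ (?n - i)) \<in> H"
        by (intro H.hg_sum H.hg_mult H.hg_power H.hg_peval ty ie)
      moreover have "(\<Sum>i\<le>?n. to_ac.peval (p i) y * 0 ^ (?n - i)) = (\<Sum>i\<le>?n. if i = ?n then to_ac.peval (p ?n) y else 0)"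
        by (intro sum.cong) auto
      ultimately show False using nz H.hg_zero_eq by simp
    qed
  qed
qed

lemma base_hom_graph: "hom_graph emb {(emb c, to_ac c) | c. True}"
proof
  fix a x b y assume "(a, x) \<in> {(emb c, to_ac c) | c. True}" "(b, y) \<in> {(emb c, to_ac c) | c. True}"
  then obtain c d where "a = emb c" "x = to_ac c" "b = emb d" "y = to_ac d" by blast
  then have "(a + b, x + y) = (emb (c + d), to_ac (c + d))" "(a * b, x * y) = (emb (c * d), to_ac (c * d))"
    by (simp_all add: emb_simps)
  then show "(a + b, x + y) \<in> {(emb c, to_ac c) | c. True}" "(a * b, x * y) \<in> {(emb c, to_ac c) | c. True}"
    by blast+
next
  fix x assume "(0, x) \<in> {(emb c, to_ac c) | c. True}"
  then obtain c where "emb c = 0" "x = to_ac c" by force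
  then show "x = 0" by simp
qed blast

text \<open>Two extensions precede Zorn's lemma: \<open>al\<close> goes to the root
  \<open>y\<close>, which respects all relations since they are multiples of \<open>h\<close>; then
  a transcendental \<open>t\<close> goes to a value \<open>tau\<close> avoiding finitely many, so
  that the members of \<open>Z\<close> stay finite.\<close>

lemma place_over_root:
  assumes h: "h \<noteq> 0" "peval h al = 0" "\<And>q. peval q al = 0 \<Longrightarrow> h dvd q"
    and y: "to_ac.peval h y = 0" and fin: "finite Z"
  obtains H where "place emb H" "(al, y) \<in> H" "Z \<subseteq> Domain H"
proof -
  obtain t where t: "trans_elt t" using trans_elt_exists by blast
  let ?G0 = "{(emb c, to_ac c) | c. True}"
  interpret G0: hom_graph emb ?G0 by (rule base_hom_graph)
  define G1 where "G1 = G0.adjoin al y"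
  have "hom_graph emb G1"
    unfolding G1_def
  proof (rule G0.hom_graph_adjoin)
    fix q r assume m: "G0.matched q r" and q: "poly q al = 0"
    have "\<forall>i. \<exists>c. coeff q i = emb c \<and> coeff r i = to_ac c" using m unfolding G0.matched_def by blast
    then obtain c where c: "\<And>i. coeff q i = emb (c i)" "\<And>i. coeff r i = to_ac (c i)" by metis
    define p where "p = map_poly (inv_into UNIV emb) q"
    have "coeff p i = c i" for i
      by (simp add: p_def coeff_map_poly c inv_into_f_f[OF inj_emb] inv_into_f_eq[OF inj_emb])
    then have qr: "map_poly emb p = q" "map_poly to_ac p = r"
      by (auto intro!: poly_eqI simp: coeff_map_poly c)
    then have "h dvd p" using q by (intro h(3)) (simp add: peval_def)
    then obtain s where "p = h * s" by (blast elim: dvdE)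
    then have "to_ac.peval p y = 0" using y by simp
    then show "poly r y = 0" by (simp add: to_ac.peval_def qr)
  qed
  then interpret G1: hom_graph emb G1 .
  have aly: "(al, y) \<in> G1" unfolding G1_def by (rule G0.adjoin_new)
  have "base.algebraic_over al" using h(1,2) by (auto simp: algebraic_base_iff trans_elt_def)
  then obtain R S where R: "subfield_set R" "{al} \<union> range emb \<subseteq> R" "finite S" "R \<subseteq> lin_span (range emb) S"
    using base.finite_extension[of "{al}"] by auto
  \<comment> \<open>\<open>t\<close> stays transcendental over the finite extension \<open>R\<close>
    of \<open>K\<close> that contains \<open>al\<close>, so its value may be prescribed
    freely.\<close>
  have tR: "\<not> subfield_set.algebraic_over R t"
    using base.algebraic_over_trans[OF R(1,3,4)] t algebraic_base_iff by blast
  have domR: "a \<in> R" if ax: "(a, x) \<in> G1" for a x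
  proof -
    obtain q r where q: "a = poly q al" "G0.matched q r" using ax unfolding G1_def G0.adjoin_def by blast
    have "coeff q i \<in> R" for i
    proof -
      have "(coeff q i, coeff r i) \<in> ?G0" using q(2) unfolding G0.matched_def by blast
      then show ?thesis using R(2) by blast
    qed
    then show ?thesis unfolding q(1) poly_altdef using R(2)
      by (intro subfield_set.sf_sum[OF R(1)] subfield_set.sf_mult[OF R(1)] subfield_set.sf_power[OF R(1)]) auto
  qed
  have "\<exists>p. p \<noteq> 0 \<and> (\<forall>H y. place emb H \<longrightarrow> (t, y) \<in> H \<longrightarrow> to_ac.peval p y \<noteq> 0 \<longrightarrow> e \<in> Domain H)" for e
    using finite_at_almost_all[OF t] by metis
  then obtain p where p: "\<And>e. p e \<noteq> 0"
    "\<And>e H y. place emb H \<Longrightarrow> (t, y) \<in> H \<Longrightarrow> to_ac.peval (p e) y \<noteq> 0 \<Longrightarrow> e \<in> Domain H" by metis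
  have "finite (\<Union>e\<in>Z. {y. to_ac.peval (p e) y = 0})"
    using fin to_ac.finite_peval_roots p(1) by blast
  then obtain tau where tau: "tau \<notin> (\<Union>e\<in>Z. {y. to_ac.peval (p e) y = 0})"
    using infinite_UNIV_alg_closed ex_new_if_finite by metis
  have "hom_graph emb (G1.adjoin t tau)"
  proof (rule G1.hom_graph_adjoin)
    fix q r assume m: "G1.matched q r" and q: "poly q t = 0"
    have "\<forall>i. coeff q i \<in> R" using m domR by (auto simp: G1.matched_def)
    then have "q = 0" using tR q unfolding subfield_set.algebraic_over_def[OF R(1)] by blast
    then have "\<And>i. coeff r i = 0" using m G1.hg_zero_eq by (simp add: G1.matched_def)
    then have "r = 0" by (simp add: poly_eq_iff)
    then show "poly r tau = 0" by simp
  qed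
  then obtain H where H: "place emb H" "G1.adjoin t tau \<subseteq> H" using hom_graph.place_exists by blast
  have "(al, y) \<in> H" "(t, tau) \<in> H" using H(2) aly G1.adjoin_superset G1.adjoin_new by blast+
  moreover have "Z \<subseteq> Domain H" using p(2)[OF H(1) \<open>(t, tau) \<in> H\<close>] tau by blast
  ultimately show ?thesis using that H(1) by blast
qed

text \<open>The product of the forms \<open>f - y g\<close> over \<open>y \<in> A\<close> cuts out
  the locus. Stating it without division includes the common zeros of \<open>f\<close> and
  \<open>g\<close> when \<open>A\<close> is nonempty.\<close>

lemma zariski_closed_ratio:
  assumes f: "homogeneous_of_degree d f" and g: "homogeneous_of_degree d g" and A: "finite A"
  shows "zariski_closed {z :: 'k alg_closure ^ 'i. z \<noteq> 0 \<and>
    (\<exists>y\<in>A. mpoly_eval to_ac f (\<lambda>i. z $ i) = y * mpoly_eval to_ac g (\<lambda>i. z $ i))}"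
proof -
  let ?K = "keys f \<union> keys g"
  define F where "F = (\<lambda>y. \<Sum>m\<in>?K. Poly_Mapping.single m (to_ac (lookup f m) - y * to_ac (lookup g m)))"
  have F: "mpoly_eval (\<lambda>c. c) (F y) x = mpoly_eval to_ac f x - y * mpoly_eval to_ac g x" for y x
    unfolding F_def field_embedding.mpoly_eval_sum[OF field_embedding_ident] field_embedding.mpoly_eval_single[OF field_embedding_ident]
    by (subst (1 2) to_ac.mpoly_eval_superset[of ?K]) (auto simp: sum_subtractf sum_distrib_left algebra_simps)
  have hF: "homogeneous (F y)" for y
    unfolding homogeneous_def F_def
    by (intro exI[of _ d] homogeneous_sum homogeneous_single) (use f g in \<open>auto simp: homogeneous_of_degree_def\<close>)
  let ?P = "\<Prod>y\<in>A. F y"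
  have P: "mpoly_eval (\<lambda>c. c) ?P x = (\<Prod>y\<in>A. mpoly_eval to_ac f x - y * mpoly_eval to_ac g x)" for x
    using A by (induction A rule: finite_induct) (simp_all add: field_embedding.mpoly_eval_mult[OF field_embedding_ident]
        field_embedding.mpoly_eval_1[OF field_embedding_ident] F)
  show ?thesis
    unfolding zariski_closed_def
  proof (intro exI conjI)
    show "\<forall>f\<in>{?P}. homogeneous f" using homogeneous_prod[OF A hF] by simp
    show "{z. z \<noteq> 0 \<and> (\<exists>y\<in>A. mpoly_eval to_ac f (\<lambda>i. z $ i) = y * mpoly_eval to_ac g (\<lambda>i. z $ i))} =
      {z. z \<noteq> 0 \<and> (\<forall>f\<in>{?P}. mpoly_eval (\<lambda>c. c) f (\<lambda>i. z $ i) = 0)}"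
      using A by (auto simp: P)
  qed
qed

text \<open>Write \<open>al = f / g\<close>. On geometric points the ratio of \<open>f\<close> and
  \<open>g\<close> takes only roots of \<open>h\<close> as values, so the loci for \<open>y1\<close>
  and for the remaining roots cover the curve; \<open>y1\<close> and \<open>y2\<close> are each
  attained at a point where \<open>g\<close> does not vanish. Two different roots would contradict
  irreducibility.\<close>

lemma roots_of_constant_equal:
  assumes h: "h \<noteq> 0" "peval h al = 0" "\<And>q. peval q al = 0 \<Longrightarrow> h dvd q"
    and y: "to_ac.peval h y1 = 0" "to_ac.peval h y2 = 0"
  shows "y1 = y2"
proof (rule ccontr)
  assume ne: "y1 \<noteq> y2"
  obtain d f g where fg: "homogeneous_of_degree d f" "homogeneous_of_degree d g"
    "mpoly_eval emb g xi \<noteq> 0" "al = mpoly_eval emb f xi / mpoly_eval emb g xi"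
    using function_field by blast
  let ?f = "\<lambda>z :: 'k alg_closure ^ 'i. mpoly_eval to_ac f (\<lambda>i. z $ i)"
  let ?g = "\<lambda>z :: 'k alg_closure ^ 'i. mpoly_eval to_ac g (\<lambda>i. z $ i)"
  let ?V = "geometric_points emb \<xi>"
  obtain i0 where i0: "xi i0 \<noteq> 0" using nonzero_coordinate by blast
  let ?z = "\<lambda>i. xi i / xi i0"
  have e: "mpoly_eval emb k ?z = inverse (xi i0) ^ d * mpoly_eval emb k xi"
    if "homogeneous_of_degree d k" for k
    using mpoly_eval_homogeneous[OF that, of "inverse (xi i0)" xi] by (simp add: divide_inverse mult.commute)
  have gz: "mpoly_eval emb g ?z \<noteq> 0" and fz: "mpoly_eval emb f ?z = al * mpoly_eval emb g ?z"
    using fg i0 by (simp_all add: e)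
  have point: "\<exists>z\<in>?V. ?f z = y * ?g z \<and> ?g z \<noteq> 0" if y: "to_ac.peval h y = 0" for y
  proof -
    obtain H where H: "place emb H" "(al, y) \<in> H"
      "insert (inverse (mpoly_eval emb g ?z)) (range ?z) \<subseteq> Domain H"
      using place_over_root[OF h y, of "insert (inverse (mpoly_eval emb g ?z)) (range ?z)"] by auto
    interpret H: place emb H by (rule H(1))
    have "\<forall>i. \<exists>w. (?z i, w) \<in> H" using H(3) by blast
    then obtain w where w: "\<And>i. (?z i, w i) \<in> H" by metis
    define z :: "'k alg_closure ^ 'i" where "z = (\<chi> i. w i)"
    have z: "(?z i, z $ i) \<in> H" for i using w by (simp add: z_def)
    have V: "z \<in> ?V" by (rule place_point[OF H(1) i0 z])
    have hf: "(mpoly_eval emb f ?z, ?f z) \<in> H" and hg: "(mpoly_eval emb g ?z, ?g z) \<in> H"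
      by (intro H.hg_mpoly_eval z)+
    have "?f z = y * ?g z" using H.hg_mult[OF H(2) hg] hf H.hg_unique fz by metis
    \<comment> \<open>The place was chosen finite at the inverse of \<open>g\<close>, so
      \<open>g\<close> cannot reduce to 0.\<close>
    moreover have "?g z \<noteq> 0"
    proof
      assume g0: "?g z = 0"
      obtain x where "(inverse (mpoly_eval emb g ?z), x) \<in> H" using H(3) by blast
      from H.hg_mult[OF hg this] have "(1, 0) \<in> H" using gz g0 by simp
      then show False using H.hg_unique[OF H.hg_one, of 0] by simp
    qed
    ultimately show ?thesis using V by blast
  qed
  let ?Rt = "{y. to_ac.peval h y = 0}"
  have fin: "finite ?Rt" by (rule to_ac.finite_peval_roots[OF h(1)])
  let ?Z = "\<lambda>A. {z :: 'k alg_closure ^ 'i. z \<noteq> 0 \<and> (\<exists>y\<in>A. ?f z = y * ?g z)}"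
  have closed: "zariski_closed (?Z A)" if "finite A" for A
    using zariski_closed_ratio[OF fg(1,2) that] .
  have cover: "?V \<subseteq> ?Z {y1} \<union> ?Z (?Rt - {y1})"
  proof
    fix z assume z: "z \<in> ?V"
    then have z0: "z \<noteq> 0" by (simp add: geometric_points_def)
    let ?n = "degree h"
    \<comment> \<open>\<open>h\<close> homogenised and evaluated at \<open>(f, g)\<close>: a form
      over \<open>K\<close> that vanishes at the generic point, hence on the whole curve.\<close>
    define Hm where "Hm = (\<Sum>j\<le>?n. Poly_Mapping.single 0 (coeff h j) * (f ^ j * g ^ (?n - j)))"
    have ev: "mpoly_eval emb Hm x = (\<Sum>j\<le>?n. emb (coeff h j) * (mpoly_eval emb f x ^ j * mpoly_eval emb g x ^ (?n - j)))" for x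
      by (simp add: Hm_def mpoly_eval_sum mpoly_eval_mult mpoly_eval_power)
    have ev': "mpoly_eval to_ac Hm x = (\<Sum>j\<le>?n. to_ac (coeff h j) * (mpoly_eval to_ac f x ^ j * mpoly_eval to_ac g x ^ (?n - j)))" for x
      by (simp add: Hm_def to_ac.mpoly_eval_sum to_ac.mpoly_eval_mult to_ac.mpoly_eval_power)
    have "homogeneous_of_degree (?n * d) Hm"
      unfolding Hm_def
    proof (intro homogeneous_sum)
      fix j assume "j \<in> {..?n}"
      then have "?n * d = 0 + (j * d + (?n - j) * d)" by (simp flip: add_mult_distrib)
      then show "homogeneous_of_degree (?n * d) (Poly_Mapping.single 0 (coeff h j) * (f ^ j * g ^ (?n - j)))"
        using homogeneous_mult[OF homogeneous_single[of 0 0 "coeff h j"]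
            homogeneous_mult[OF homogeneous_power[OF fg(1), of j] homogeneous_power[OF fg(2), of "?n - j"]]]
        by simp
    qed
    moreover have "mpoly_eval emb Hm xi = 0"
    proof -
      have fx: "mpoly_eval emb f xi = al * mpoly_eval emb g xi" using fg(3,4) by simp
      have "mpoly_eval emb Hm xi = (\<Sum>j\<le>?n. mpoly_eval emb g xi ^ ?n * (emb (coeff h j) * al ^ j))"
        unfolding ev fx
      proof (intro sum.cong refl)
        fix j assume "j \<in> {..?n}"
        then have "mpoly_eval emb g xi ^ ?n = mpoly_eval emb g xi ^ j * mpoly_eval emb g xi ^ (?n - j)"
          by (simp flip: power_add)
        then show "emb (coeff h j) * ((al * mpoly_eval emb g xi) ^ j * mpoly_eval emb g xi ^ (?n - j)) =
            mpoly_eval emb g xi ^ ?n * (emb (coeff h j) * al ^ j)"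
          by (simp add: power_mult_distrib mult_ac)
      qed
      also have "\<dots> = mpoly_eval emb g xi ^ ?n * peval h al"
        by (simp add: peval_altdef sum_distrib_left)
      finally show ?thesis using h(2) by simp
    qed
    ultimately have "Hm \<in> homogeneous_ideal emb \<xi>" by (auto simp: homogeneous_ideal_def homogeneous_def)
    then have 0: "(\<Sum>j\<le>?n. to_ac (coeff h j) * (?f z ^ j * ?g z ^ (?n - j))) = 0"
      using z unfolding geometric_points_def ev'[symmetric] by blast
    have "\<exists>y\<in>?Rt. ?f z = y * ?g z"
    proof (cases "?g z = 0")
      \<comment> \<open>Where \<open>g\<close> vanishes, the leading coefficient of \<open>h\<close>
        forces \<open>f\<close> to vanish, and such a point lies on the locus of every root.\<close>
      case True
      have "(\<Sum>j\<le>?n. to_ac (coeff h j) * (?f z ^ j * ?g z ^ (?n - j))) =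
          (\<Sum>j\<le>?n. if j = ?n then to_ac (lead_coeff h) * ?f z ^ ?n else 0)"
        unfolding True by (intro sum.cong) auto
      then have "?f z ^ ?n = 0" using h(1) 0 by simp
      then have "?f z = 0" by simp
      then show ?thesis using True y(1) by auto
    next
      case False
      have "?g z ^ ?n * to_ac.peval h (?f z / ?g z) = (\<Sum>j\<le>?n. to_ac (coeff h j) * (?f z ^ j * ?g z ^ (?n - j)))"
        unfolding to_ac.peval_altdef sum_distrib_left
      proof (intro sum.cong refl)
        fix j assume "j \<in> {..?n}"
        then have "?g z ^ ?n = ?g z ^ j * ?g z ^ (?n - j)" by (simp flip: power_add)
        then show "?g z ^ ?n * (to_ac (coeff h j) * (?f z / ?g z) ^ j) =
            to_ac (coeff h j) * (?f z ^ j * ?g z ^ (?n - j))"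
          using False by (simp add: power_divide)
      qed
      then have "to_ac.peval h (?f z / ?g z) = 0" using 0 False by simp
      then show ?thesis using False by (intro bexI[of _ "?f z / ?g z"]) auto
    qed
    then show "z \<in> ?Z {y1} \<union> ?Z (?Rt - {y1})" using z0 by blast
  qed
  have "?V \<subseteq> ?Z {y1} \<or> ?V \<subseteq> ?Z (?Rt - {y1})"
    using geom_irreducible cover closed[of "{y1}"] closed[of "?Rt - {y1}"] fin
    unfolding zariski_irreducible_def by (meson finite.emptyI finite_Diff finite_insert)
  then show False
  proof
    assume sub: "?V \<subseteq> ?Z {y1}"
    obtain z where "z \<in> ?V" "?f z = y2 * ?g z" "?g z \<noteq> 0" using point[OF y(2)] by blast
    moreover from this have "?f z = y1 * ?g z" using sub by blast
    ultimately show False using ne by simp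
  next
    assume sub: "?V \<subseteq> ?Z (?Rt - {y1})"
    obtain z where "z \<in> ?V" "?f z = y1 * ?g z" "?g z \<noteq> 0" using point[OF y(1)] by blast
    moreover from this obtain y where "y \<noteq> y1" "?f z = y * ?g z" using sub by blast
    ultimately show False by simp
  qed
qed

end

subsection \<open>Derivations and smoothness\<close>

definition subfield_gen :: "'f::field set \<Rightarrow> 'f set" where
  "subfield_gen A = \<Inter>{R. subfield_set R \<and> A \<subseteq> R}"

lemma subfield_set_gen: "subfield_set (subfield_gen A)"
  by standard (auto simp: subfield_gen_def subfield_set.sf_one subfield_set.sf_diff
      subfield_set.sf_mult subfield_set.sf_inverse)

lemma subfield_gen_superset: "A \<subseteq> subfield_gen A"
  by (auto simp: subfield_gen_def)

lemma subfield_gen_least: "subfield_set R \<Longrightarrow> A \<subseteq> R \<Longrightarrow> subfield_gen A \<subseteq> R"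
  by (auto simp: subfield_gen_def)

text \<open>With all p-th powers in \<open>N\<close>, each \<open>u\<close> has degree 1 or
  \<open>p\<close> over \<open>N\<close> and is purely inseparable, and \<open>N[u]\<close> is a
  field. These are extensions on which a derivation can be prescribed.\<close>

locale power_subfield = subfield_set N for N :: "'f::field set" +
  fixes p :: nat
  assumes p: "p = CHAR('f)" "prime p" and power_mem: "\<And>x. x ^ p \<in> N"
begin

lemma p_pos: "p > 0"
  using p(2) by (rule prime_gt_0_nat)

abbreviation over_N :: "'f poly \<Rightarrow> bool" where
  "over_N q \<equiv> \<forall>i. coeff q i \<in> N"

lemma over_N_arith:
  "over_N q \<Longrightarrow> over_N r \<Longrightarrow> over_N (q - r)"
  "over_N q \<Longrightarrow> over_N r \<Longrightarrow> over_N (q + r)"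
  "over_N q \<Longrightarrow> over_N r \<Longrightarrow> over_N (q * r)"
  "c \<in> N \<Longrightarrow> over_N (monom c n)"
  "over_N q \<Longrightarrow> over_N (pderiv q)"
proof -
  have of_nat: "of_nat n \<in> N" for n by (induction n) (simp_all add: sf_zero sf_one sf_add)
  show "over_N q \<Longrightarrow> over_N (pderiv q)" unfolding coeff_pderiv by (intro allI sf_mult of_nat) blast
qed (auto simp: sf_diff sf_add coeff_mult coeff_monom sf_zero intro!: sf_sum sf_mult)

lemma over_N_const: "c \<in> N \<Longrightarrow> over_N [:c:]"
  using over_N_arith(4)[of c 0] by (simp add: monom_0)

lemma over_N_power: "over_N q \<Longrightarrow> over_N (q ^ n)"
  by (induction n) (use over_N_const[OF sf_one] over_N_arith(3) in \<open>auto simp: one_pCons\<close>)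

lemma subfield_poly_values: "subfield_set {poly q u | q. over_N q}"
proof
  show "1 \<in> {poly q u | q. over_N q}" using over_N_const[OF sf_one] by (intro CollectI exI[of _ "[:1:]"]) simp
  fix a b assume "a \<in> {poly q u | q. over_N q}" "b \<in> {poly q u | q. over_N q}"
  then obtain q r where "a = poly q u" "over_N q" "b = poly r u" "over_N r" by blast
  then have "a - b = poly (q - r) u" "over_N (q - r)" "a * b = poly (q * r) u" "over_N (q * r)"
    using over_N_arith by simp_all
  then show "a - b \<in> {poly q u | q. over_N q}" "a * b \<in> {poly q u | q. over_N q}" by blast+
next
  fix a assume "a \<in> {poly q u | q. over_N q}"
  then obtain q where q: "a = poly q u" "over_N q" by blast
  \<comment> \<open>Inverses are polynomial expressions because \<open>inverse a ^ p\<close> is in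
    \<open>N\<close>; at \<open>a = 0\<close> the identity rests on
    \<open>inverse 0 = 0\<close>.\<close>
  have "inverse a = inverse a ^ p * a ^ (p - 1)"
  proof (cases "a = 0")
    case False
    have "inverse a ^ p = inverse a * inverse a ^ (p - 1)" using p_pos by (cases p) auto
    then show ?thesis using False by (simp add: power_inverse)
  qed (use p_pos in simp)
  also have "\<dots> = poly ([:inverse a ^ p:] * q ^ (p - 1)) u" by (simp add: q(1))
  finally show "inverse a \<in> {poly q u | q. over_N q}"
    using over_N_arith(3)[OF over_N_const[OF power_mem] over_N_power[OF q(2)]] by blast
qed

lemma generated_poly_value:
  assumes "x \<in> subfield_gen (insert u N)"
  shows "\<exists>q. over_N q \<and> x = poly q u"
proof -
  have "N \<subseteq> {poly q u | q. over_N q}"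
  proof
    fix c assume "c \<in> N"
    then show "c \<in> {poly q u | q. over_N q}" using over_N_const by (intro CollectI exI[of _ "[:c:]"]) simp
  qed
  moreover have "u \<in> {poly q u | q. over_N q}"
    using over_N_arith(4)[OF sf_one, of 1] by (intro CollectI exI[of _ "monom 1 1"]) (simp add: poly_monom)
  ultimately have "subfield_gen (insert u N) \<subseteq> {poly q u | q. over_N q}"
    by (intro subfield_gen_least subfield_poly_values) blast
  then show ?thesis using assms by blast
qed

text \<open>The minimal polynomial of \<open>u\<close> over \<open>N\<close> divides \<open>(T - u)\<^sup>p\<close>; having a simple root, it would be linear.\<close>

lemma inseparable_relation:
  assumes u: "u \<notin> N" and q: "over_N q" "poly q u = 0"
  shows "poly (pderiv q) u = 0"
proof -
  define J where "J = {r. over_N r \<and> poly r u = 0}"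
  have "[:- u, 1:] ^ p = ([:0, 1:] + [:- u:]) ^ p" by simp
  also have "\<dots> = monom 1 p + [:- u:] ^ p"
    using p by (subst freshmans_dream) (simp_all add: monom_altdef)
  also have "[:- u:] ^ p = [:(- u) ^ p:]" by (simp add: poly_const_pow)
  finally have xp: "[:- u, 1:] ^ p = monom 1 p + [:(- u) ^ p:]" .
  have "over_N ([:- u, 1:] ^ p)"
    unfolding xp by (rule over_N_arith(2)[OF over_N_arith(4)[OF sf_one] over_N_const[OF power_mem]])
  then have xpJ: "[:- u, 1:] ^ p \<in> J" using p_pos by (simp add: J_def)
  have xp0: "[:- u, 1:] ^ p \<noteq> 0" by simp
  define d where "d = arg_min degree (\<lambda>r. r \<in> J \<and> r \<noteq> 0)"
  have d: "d \<in> J" "d \<noteq> 0" and dmin: "\<And>r. r \<in> J \<Longrightarrow> r \<noteq> 0 \<Longrightarrow> degree d \<le> degree r"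
    using arg_min_nat_lemma[of "\<lambda>r. r \<in> J \<and> r \<noteq> 0" "[:- u, 1:] ^ p" degree] xpJ xp0 by (auto simp: d_def)
  have dvd: "d dvd e" if "e \<in> J" for e
  proof (rule dvd_of_min_degree[OF d(2) dmin _ that])
    fix e n assume e: "e \<in> J"
    then have "lead_coeff e * inverse (lead_coeff d) \<in> N" using d(1) by (simp add: J_def sf_mult sf_inverse)
    then have "over_N (e - monom (lead_coeff e * inverse (lead_coeff d)) n * d)"
      using e d(1) unfolding J_def by (intro over_N_arith) blast+
    then show "e - monom (lead_coeff e * inverse (lead_coeff d)) n * d \<in> J"
      using e d(1) by (simp add: J_def)
  qed
  have du: "poly d u = 0" using d(1) by (simp add: J_def)
  have "poly (pderiv d) u = 0"
  proof (rule ccontr)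
    assume nz: "poly (pderiv d) u \<noteq> 0"
    obtain k where k: "d = [:- u, 1:] * k" using du by (metis dvdE poly_eq_0_iff_dvd)
    have "pderiv d = [:- u, 1:] * pderiv k + k" unfolding k pderiv_mult by (simp add: pderiv_pCons)
    then have ku: "poly k u \<noteq> 0" using nz by simp
    then have k0: "k \<noteq> 0" by auto
    obtain e where e: "[:- u, 1:] ^ p = d * e" using dvd[OF xpJ] by (blast elim: dvdE)
    have e0: "e \<noteq> 0" using e xp0 by auto
    \<comment> \<open>In \<open>d * e = (T - u)^p\<close> both orders and degrees add up to
      \<open>p\<close>, and the order of \<open>e\<close> is at most its degree. A simple root of
      \<open>d\<close> thus forces degree 1.\<close>
    have "order u ([:- u, 1:] ^ p) = p" by (rule order_power_n_n)
    then have "p = order u d + order u e" using e d(2) e0 by (simp add: order_mult)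
    moreover have "order u d = 1"
      unfolding k order_mult[OF d(2)[unfolded k]] using order_power_n_n[of u 1] order_0I[OF ku] by simp
    moreover have "order u e \<le> degree e" by (rule order_degree[OF e0])
    moreover have "degree d + degree e = p"
      using degree_mult_eq[OF d(2) e0] by (simp flip: e add: degree_linear_power)
    moreover have "degree d = 1 + degree k" unfolding k using degree_mult_eq[OF _ k0, of "[:- u, 1:]"] by simp
    ultimately have "degree d = 1" by simp
    then have du1: "coeff d 0 + coeff d 1 * u = 0" using du by (simp add: poly_altdef)
    moreover have "coeff d 1 \<noteq> 0" using \<open>degree d = 1\<close> d(2) by (metis leading_coeff_0_iff)
    ultimately have "u = - (coeff d 0 * inverse (coeff d 1))"
      by (simp add: field_simps eq_neg_iff_add_eq_0 add.commute)
    moreover have "- (coeff d 0 * inverse (coeff d 1)) \<in> N"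
      using d(1) by (simp add: J_def sf_mult sf_inverse sf_uminus)
    ultimately show False using u by simp
  qed
  moreover obtain s where "q = d * s" using dvd[of q] q by (auto simp: J_def elim: dvdE)
  ultimately show ?thesis using du by (simp add: pderiv_mult)
qed

text \<open>Put \<open>D (q(u)) = q'(u)\<close> for \<open>q\<close> over \<open>N\<close>. Two
  representations of an element give the same value because a polynomial over \<open>N\<close> that
  vanishes at \<open>u\<close> has a derivative vanishing at \<open>u\<close>.\<close>

lemma derivation_exists:
  assumes u: "u \<notin> N" and gen: "subfield_gen (insert u N) = UNIV"
  obtains D where "\<And>a b. D (a + b) = D a + D b" "\<And>a b. D (a * b) = a * D b + b * D a"
    "\<And>c. c \<in> N \<Longrightarrow> D c = 0" "D u = 1"
proof -
  define r where "r = (\<lambda>x. SOME q. over_N q \<and> x = poly q u)"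
  have r: "over_N (r x)" "x = poly (r x) u" for x
  proof -
    have "\<exists>q. over_N q \<and> x = poly q u" using generated_poly_value gen by blast
    then have "over_N (r x) \<and> x = poly (r x) u" unfolding r_def by (rule someI_ex)
    then show "over_N (r x)" "x = poly (r x) u" by blast+
  qed
  define D where "D = (\<lambda>x. poly (pderiv (r x)) u)"
  have D: "D (poly q u) = poly (pderiv q) u" if "over_N q" for q
  proof -
    have "poly (pderiv (r (poly q u) - q)) u = 0"
      by (rule inseparable_relation[OF u over_N_arith(1)[OF r(1) that]]) (simp flip: r(2))
    then show ?thesis by (simp add: D_def pderiv_diff)
  qed
  show ?thesis
  proof (rule that[of D])
    fix a b
    have "a + b = poly (r a + r b) u" "a * b = poly (r a * r b) u" using r(2)[of a] r(2)[of b] by simp_all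
    then have "D (a + b) = poly (pderiv (r a + r b)) u" "D (a * b) = poly (pderiv (r a * r b)) u"
      using D over_N_arith(2,3) r(1) by metis+
    then show "D (a + b) = D a + D b" "D (a * b) = a * D b + b * D a"
      using r(2)[of a] r(2)[of b] by (simp_all add: D_def pderiv_add pderiv_mult)
  next
    fix c assume "c \<in> N"
    then show "D c = 0" using D[OF over_N_const, of c] by (simp add: pderiv_pCons)
  next
    show "D u = 1" using D[OF over_N_arith(4)[OF sf_one], of 1] by (simp add: poly_monom pderiv_monom)
  qed
qed

end

section \<open>Partial derivatives: chain rule and Euler's relation\<close>

lemma mpoly_eval_pderiv:
  fixes h :: "('i::finite, 'k::field) mpolynomial"
  assumes "field_embedding emb"
  shows "mpoly_eval emb (mpoly_pderiv i h) x =
    (\<Sum>m\<in>keys h. of_nat (lookup m i) * emb (lookup h m) * mon x (m - Poly_Mapping.single i 1))"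
proof -
  interpret field_embedding emb by (rule assms)
  show ?thesis by (simp add: mpoly_pderiv_def mpoly_eval_sum emb_mult emb_of_nat)
qed

lemma mon_minus_single:
  fixes m :: "'i::finite \<Rightarrow>\<^sub>0 nat"
  shows "mon x (m - Poly_Mapping.single i 1) = x i ^ (lookup m i - 1) * (\<Prod>j\<in>UNIV - {i}. x j ^ lookup m j)"
proof -
  have l: "lookup (m - Poly_Mapping.single i 1) j = (if j = i then lookup m i - 1 else lookup m j)" for j
    by (simp add: minus_poly_mapping.rep_eq lookup_single when_def)
  have "mon x (m - Poly_Mapping.single i 1) = (\<Prod>j\<in>UNIV. x j ^ lookup (m - Poly_Mapping.single i 1) j)"
    by (rule mon_superset) auto
  also have "\<dots> = x i ^ (lookup m i - 1) * (\<Prod>j\<in>UNIV - {i}. x j ^ lookup m j)"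
    unfolding l by (subst prod.remove[of UNIV i]) (auto intro!: prod.cong)
  finally show ?thesis .
qed

lemma (in field_embedding) derivation_mpoly_eval:
  fixes h :: "('i::finite, 'k) mpolynomial"
  assumes add: "\<And>a b. D (a + b) = D a + D b" and mult: "\<And>a b. D (a * b) = a * D b + b * D a"
    and const: "\<And>c. D (emb c) = (0 :: 'f)"
  shows "D (mpoly_eval emb h x) = (\<Sum>i\<in>UNIV. mpoly_eval emb (mpoly_pderiv i h) x * D (x i))"
proof -
  have D0: "D 0 = 0" using add[of 0 0] by (metis add_0_right add_left_cancel)
  have D1: "D 1 = 0" using const[of 1] by (simp add: emb_one)
  have sum: "D (sum f I) = (\<Sum>i\<in>I. D (f i))" for f and I :: "('i \<Rightarrow>\<^sub>0 nat) set"
    by (induction I rule: infinite_finite_induct) (simp_all add: D0 add)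
  have prod: "D (prod f I) = (\<Sum>i\<in>I. D (f i) * prod f (I - {i}))" if "finite I" for f and I :: "'i set"
    using that
  proof (induction I rule: finite_induct)
    case (insert a I)
    have "(\<Sum>i\<in>I. D (f i) * prod f (insert a I - {i})) = f a * (\<Sum>i\<in>I. D (f i) * prod f (I - {i}))"
      unfolding sum_distrib_left
    proof (intro sum.cong refl)
      fix i assume "i \<in> I"
      then have "insert a I - {i} = insert a (I - {i})" using insert by auto
      then show "D (f i) * prod f (insert a I - {i}) = f a * (D (f i) * prod f (I - {i}))"
        using insert by (simp add: mult_ac)
    qed
    then show ?case using insert by (simp add: mult algebra_simps)
  qed (simp add: D1)
  have pow: "D (a ^ n) = of_nat n * a ^ (n - 1) * D a" for a n
  proof (induction n)
    case (Suc n)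
    then show ?case by (cases n) (simp_all add: mult algebra_simps D1)
  qed (simp add: D1)
  have mon: "D (mon x m) = (\<Sum>i\<in>UNIV. of_nat (lookup m i) * mon x (m - Poly_Mapping.single i 1) * D (x i))" for m
  proof -
    have "D (mon x m) = (\<Sum>i\<in>UNIV. D (x i ^ lookup m i) * (\<Prod>j\<in>UNIV - {i}. x j ^ lookup m j))"
      by (subst mon_superset[of UNIV]) (simp_all add: prod)
    then show ?thesis by (simp only: pow mon_minus_single mult_ac)
  qed
  have "D (mpoly_eval emb h x) = (\<Sum>m\<in>keys h. emb (lookup h m) * D (mon x m))"
    by (simp add: mpoly_eval_mon sum mult const)
  also have "\<dots> = (\<Sum>m\<in>keys h. \<Sum>i\<in>UNIV. of_nat (lookup m i) * emb (lookup h m) *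
      mon x (m - Poly_Mapping.single i 1) * D (x i))"
    by (simp only: mon sum_distrib_left mult_ac)
  also have "\<dots> = (\<Sum>i\<in>UNIV. mpoly_eval emb (mpoly_pderiv i h) x * D (x i))"
    by (subst sum.swap) (simp only: mpoly_eval_pderiv[OF field_embedding_axioms] sum_distrib_right)
  finally show ?thesis .
qed

lemma (in field_embedding) euler_relation:
  fixes h :: "('i::finite, 'k) mpolynomial"
  assumes "homogeneous_of_degree d h"
  shows "(\<Sum>i\<in>UNIV. mpoly_eval emb (mpoly_pderiv i h) x * x i) = of_nat d * mpoly_eval emb h x"
proof -
  have e: "of_nat (lookup m i) * mon x (m - Poly_Mapping.single i 1) * x i = of_nat (lookup m i) * mon x m"
    for m :: "'i \<Rightarrow>\<^sub>0 nat" and i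
  proof (cases "lookup m i")
    case (Suc n)
    have "mon x m = x i ^ lookup m i * (\<Prod>j\<in>UNIV - {i}. x j ^ lookup m j)"
      by (subst mon_superset[of UNIV]) (simp_all add: prod.remove)
    then show ?thesis unfolding mon_minus_single by (simp add: Suc mult_ac)
  qed simp
  have "(\<Sum>i\<in>UNIV. mpoly_eval emb (mpoly_pderiv i h) x * x i) =
      (\<Sum>i\<in>UNIV. \<Sum>m\<in>keys h. emb (lookup h m) * (of_nat (lookup m i) * mon x (m - Poly_Mapping.single i 1) * x i))"
    unfolding mpoly_eval_pderiv[OF field_embedding_axioms] sum_distrib_right by (simp only: mult_ac)
  also have "\<dots> = (\<Sum>m\<in>keys h. \<Sum>i\<in>UNIV. emb (lookup h m) * mon x m * of_nat (lookup m i))"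
    unfolding e by (subst sum.swap) (simp only: mult_ac)
  also have "\<dots> = (\<Sum>m\<in>keys h. emb (lookup h m) * mon x m * of_nat d)"
  proof (intro sum.cong refl)
    fix m assume m: "m \<in> keys h"
    have "(\<Sum>i\<in>UNIV. lookup m i) = (\<Sum>i\<in>keys m. lookup m i)"
      by (rule sum.mono_neutral_right) (auto simp: in_keys_iff)
    then have "(\<Sum>i\<in>UNIV. lookup m i) = d" using assms m by (simp add: homogeneous_of_degree_def)
    then have "(\<Sum>i\<in>UNIV. of_nat (lookup m i)) = (of_nat d :: 'f)" by (metis of_nat_sum)
    then show "(\<Sum>i\<in>UNIV. emb (lookup h m) * mon x m * of_nat (lookup m i)) = emb (lookup h m) * mon x m * of_nat d"
      by (simp only: sum_distrib_left[symmetric])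
  qed
  finally show ?thesis by (simp add: mpoly_eval_mon sum_distrib_left mult_ac)
qed

text \<open>A coordinate of least value. Divisibility in a valuation ring is a total preorder, so
  the current minimum is replaced whenever the next coordinate is no multiple of it.\<close>

lemma (in place) pivot:
  fixes x :: "'i::finite \<Rightarrow> 'f"
  assumes "x i \<noteq> 0"
  obtains a where "x a \<noteq> 0" "\<And>j. x j / x a \<in> Domain G"
proof -
  have piv: "\<exists>a\<in>A. \<forall>j\<in>A. x j / x a \<in> Domain G" if "finite A" "A \<noteq> {}" "\<And>j. j \<in> A \<Longrightarrow> x j \<noteq> 0" for A
    using that
  proof (induction A rule: finite_ne_induct)
    case (singleton i)
    then show ?case using domain_one by simp
  next
    case (insert i A)
    then obtain a where a: "a \<in> A" "\<forall>j\<in>A. x j / x a \<in> Domain G" by auto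
    have nz: "x i \<noteq> 0" "x a \<noteq> 0" using insert.prems a(1) by auto
    show ?case
    proof (cases "x i / x a \<in> Domain G")
      case True
      then show ?thesis using a by auto
    next
      case False
      then have "inverse (x i / x a) \<in> Domain G" using not_in_domain by blast
      then have ai: "x a / x i \<in> Domain G" by (simp add: field_simps)
      have "x j / x i \<in> Domain G" if "j \<in> A" for j
      proof -
        have "(x j / x a) * (x a / x i) \<in> Domain G" using a(2) that ai domain_mult by blast
        then show ?thesis using nz by simp
      qed
      then show ?thesis using domain_one nz by (intro bexI[of _ i]) auto
    qed
  qed
  have "\<exists>a\<in>{j. x j \<noteq> 0}. \<forall>j\<in>{j. x j \<noteq> 0}. x j / x a \<in> Domain G"
    by (rule piv[of "{j. x j \<noteq> 0}"]) (use assms in auto)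
  then obtain a where a: "x a \<noteq> 0" "\<forall>j. x j \<noteq> 0 \<longrightarrow> x j / x a \<in> Domain G"
    by auto
  have "x j / x a \<in> Domain G" for j
    using a(2) hg_zero by (cases "x j = 0") auto
  then show ?thesis using that a(1) by blast
qed


context smooth_projective_geom_irreducible_curve
begin

lemma char_eq: "CHAR('f) = CHAR('k)"
proof -
  have "CHAR('f) dvd n \<longleftrightarrow> CHAR('k) dvd n" for n
    by (simp flip: of_nat_eq_0_iff_char_dvd emb_of_nat)
  then show ?thesis by (meson dvd_antisym dvd_refl)
qed

text \<open>
  Two independent derivations give, together with the point itself, three independent vectors in
  the kernel of the Jacobian matrix at the generic point. After normalising the pivots they
  specialise to independent tangent vectors of the cone at a geometric point.
\<close>

lemma no_two_derivations:
  assumes H: "place emb H" and i0: "xi i0 \<noteq> 0" and dom: "\<And>i. xi i / xi i0 \<in> Domain H"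
    and D1: "\<And>a b. D1 (a + b) = D1 a + D1 b" "\<And>a b. D1 (a * b) = a * D1 b + b * D1 a" "\<And>c. D1 (emb c) = 0"
    and D2: "\<And>a b. D2 (a + b) = D2 a + D2 b" "\<And>a b. D2 (a * b) = a * D2 b + b * D2 a" "\<And>c. D2 (emb c) = 0"
    and j: "D1 (xi j1 / xi i0) = 1" "D1 (xi j2 / xi i0) = 0" "D2 (xi j1 / xi i0) = 0" "D2 (xi j2 / xi i0) = 1"
  shows False
proof -
  interpret H: place emb H by (rule H)
  let ?z = "\<lambda>i. xi i / xi i0"
  have "\<forall>i. \<exists>w. (?z i, w) \<in> H" using dom by blast
  then obtain w0 where w0: "\<And>i. (?z i, w0 i) \<in> H" by metis
  \<comment> \<open>The kernel of the Jacobian matrix at the generic point: it contains the point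
    itself by Euler's relation and the image of the point under a derivation by the chain
    rule.\<close>
  define kern where "kern = (\<lambda>x :: 'i \<Rightarrow> 'f. \<forall>h\<in>homogeneous_ideal emb \<xi>.
    (\<Sum>i\<in>UNIV. mpoly_eval emb (mpoly_pderiv i h) ?z * x i) = 0)"
  have k0: "kern ?z"
    unfolding kern_def
  proof
    fix h assume h: "h \<in> homogeneous_ideal emb \<xi>"
    then obtain d where "homogeneous_of_degree d h" by (auto simp: homogeneous_ideal_def homogeneous_def)
    then show "(\<Sum>i\<in>UNIV. mpoly_eval emb (mpoly_pderiv i h) ?z * ?z i) = 0"
      using euler_relation[of d h ?z] ideal_vanishes[OF h i0] by simp
  qed
  have kD: "kern (\<lambda>i. D (?z i))"
    if "\<And>a b. D (a + b) = D a + D b" "\<And>a b. D (a * b) = a * D b + b * D a" "\<And>c. D (emb c) = 0" for D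
    unfolding kern_def
  proof
    fix h assume h: "h \<in> homogeneous_ideal emb \<xi>"
    have "D 0 = 0" using that(3)[of 0] by simp
    then show "(\<Sum>i\<in>UNIV. mpoly_eval emb (mpoly_pderiv i h) ?z * D (?z i)) = 0"
      using derivation_mpoly_eval[of D h ?z] that ideal_vanishes[OF h i0] by simp
  qed
  have kscale: "kern (\<lambda>i. x i / c)" if "kern x" for x c
    using that by (simp add: kern_def flip: sum_divide_distrib)
  have kdiff: "kern (\<lambda>i. x i - c * y i)" if "kern x" "kern y" for x y c
  proof -
    have "(\<Sum>i\<in>UNIV. a i * (x i - c * y i)) = (\<Sum>i\<in>UNIV. a i * x i) - c * (\<Sum>i\<in>UNIV. a i * y i)" for a :: "'i \<Rightarrow> 'f"
      by (simp add: algebra_simps sum_subtractf sum_distrib_left)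
    then show ?thesis using that by (simp add: kern_def)
  qed
  let ?u = "\<lambda>i. D1 (?z i)" and ?v = "\<lambda>i. D2 (?z i)"
  \<comment> \<open>In this chart the coordinate \<open>i0\<close> is the constant 1, so derivations
    kill it.\<close>
  have one: "D1 (?z i0) = 0" "D2 (?z i0) = 0"
    using D1(3)[of 1] D2(3)[of 1] i0 by (simp_all add: emb_one)
  have "?u j1 \<noteq> 0" using j(1) by simp
  then obtain b where b: "?u b \<noteq> 0" "\<And>i. ?u i / ?u b \<in> Domain H" by (rule H.pivot[of ?u]) blast
  define u where "u = (\<lambda>i. ?u i / ?u b)"
  have ku: "kern u" unfolding u_def using kscale[OF kD[OF D1]] .
  have u: "u b = 1" "u i0 = 0" "u j1 \<noteq> 0" "u j2 = 0" using b(1) one j by (simp_all add: u_def)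
  \<comment> \<open>Clearing the coordinate \<open>b\<close> keeps the two vectors independent after
    specialisation. The result is nonzero since \<open>u\<close> vanishes at \<open>j2\<close>,
    where \<open>?v\<close> is 1.\<close>
  define v' where "v' = (\<lambda>i. ?v i - ?v b * u i)"
  have kv': "kern v'" unfolding v'_def by (rule kdiff[OF kD[OF D2] ku])
  have "v' j2 \<noteq> 0" using u(4) j(4) by (simp add: v'_def)
  then obtain c where c: "v' c \<noteq> 0" "\<And>i. v' i / v' c \<in> Domain H" by (rule H.pivot[of v']) blast
  define v where "v = (\<lambda>i. v' i / v' c)"
  have kv: "kern v" unfolding v_def by (rule kscale[OF kv'])
  have v: "v c = 1" "v i0 = 0" "v b = 0" using c(1) one u by (simp_all add: v_def v'_def)
  have "\<forall>i. \<exists>w. (u i, w) \<in> H" "\<forall>i. \<exists>w. (v i, w) \<in> H"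
    using b(2) c(2) unfolding u_def v_def by blast+
  then obtain wu wv where wu: "\<And>i. (u i, wu i) \<in> H" and wv: "\<And>i. (v i, wv i) \<in> H" by metis
  define Z U V :: "'k alg_closure ^ 'i" where ZUV: "Z = (\<chi> i. w0 i)" "U = (\<chi> i. wu i)" "V = (\<chi> i. wv i)"
  have val: "y = 0" if "(0, y) \<in> H" for y using H.hg_zero_eq that .
  have val1: "y = 1" if "(1, y) \<in> H" for y using H.hg_unique[OF that H.hg_one] .
  have coords: "Z $ i0 = 1" "U $ i0 = 0" "V $ i0 = 0" "U $ b = 1" "V $ b = 0" "V $ c = 1"
    using w0[of i0] wu[of i0] wv[of i0] wu[of b] wv[of b] wv[of c] u v i0 val val1 by (simp_all add: ZUV)
  have ZV: "Z \<in> geometric_points emb \<xi>"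
    by (rule place_point[OF H i0]) (simp add: ZUV w0)
  have tang: "W \<in> cone_tangent_space emb \<xi> Z" if x: "kern x" "\<And>i. (x i, W $ i) \<in> H" for x and W :: "'k alg_closure ^ 'i"
    unfolding cone_tangent_space_def
  proof (intro CollectI ballI)
    fix h assume h: "h \<in> homogeneous_ideal emb \<xi>"
    have "(\<Sum>i\<in>UNIV. mpoly_eval emb (mpoly_pderiv i h) ?z * x i,
        \<Sum>i\<in>UNIV. mpoly_eval to_ac (mpoly_pderiv i h) (\<lambda>j. Z $ j) * W $ i) \<in> H"
      by (intro H.hg_sum H.hg_mult H.hg_mpoly_eval x(2)) (simp add: ZUV w0)
    moreover have "(\<Sum>i\<in>UNIV. mpoly_eval emb (mpoly_pderiv i h) ?z * x i) = 0"
      using x(1) h by (simp add: kern_def)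
    ultimately show "(\<Sum>i\<in>UNIV. mpoly_eval to_ac (mpoly_pderiv i h) (\<lambda>j. Z $ j) * W $ i) = 0"
      using val by simp
  qed
  have "Z \<in> cone_tangent_space emb \<xi> Z" "U \<in> cone_tangent_space emb \<xi> Z" "V \<in> cone_tangent_space emb \<xi> Z"
    using tang[OF k0, of Z] tang[OF ku, of U] tang[OF kv, of V] by (simp_all add: ZUV w0 wu wv)
  then have sub: "{Z, U, V} \<subseteq> cone_tangent_space emb \<xi> Z" by simp
  \<comment> \<open>Independence is triangular: \<open>Z\<close>, \<open>U\<close>, \<open>V\<close>
    have the coordinates \<open>i0\<close>, \<open>b\<close>, \<open>c\<close> equal to 1,
    \<open>U\<close> and \<open>V\<close> vanish at \<open>i0\<close>, and \<open>V\<close> vanishes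
    at \<open>b\<close>.\<close>
  have coord_space: "vec.subspace {x :: 'k alg_closure ^ 'i. x $ i = 0}" for i
    by (auto simp: vec.subspace_def)
  have "V \<noteq> 0" using coords by auto
  then have "vec.independent {V}" by simp
  moreover have "U \<notin> vec.span {V}"
    using vec.span_minimal[OF _ coord_space[of b], of "{V}"] coords by auto
  moreover have "Z \<notin> vec.span {U, V}"
    using vec.span_minimal[OF _ coord_space[of i0], of "{U, V}"] coords by auto
  ultimately have "vec.independent {Z, U, V}" by (simp add: vec.independent_insertI)
  moreover have "card {Z, U, V} = 3"
  proof -
    have "Z \<noteq> U" "Z \<noteq> V" "U \<noteq> V" using coords by auto
    then show ?thesis by simp
  qed
  ultimately have "3 \<le> vec.dim (cone_tangent_space emb \<xi> Z)"
    using vec.independent_card_le_dim[OF sub] by simp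
  then show False using smooth[OF ZV] by simp
qed

text \<open>The compositum \<open>K F^p\<close>. Products of p-th powers are p-th powers, so the
  span over \<open>K\<close> is already a ring.\<close>

definition frob_field :: "'f set" where
  "frob_field = lin_span (range emb) (range (\<lambda>x. x ^ CHAR('k)))"

lemma frob_field_subfield:
  assumes p: "CHAR('k) > 0"
  shows "subfield_set frob_field" "x ^ CHAR('k) \<in> frob_field" "range emb \<subseteq> frob_field"
proof -
  let ?p = "CHAR('k)"
  let ?S = "range (\<lambda>x :: 'f. x ^ ?p)"
  show pw: "x ^ ?p \<in> frob_field" for x unfolding frob_field_def by (rule base.lin_span_base) simp
  have one: "(1 :: 'f) \<in> ?S" using power_one by (metis rangeI)
  show "range emb \<subseteq> frob_field"
  proof
    fix a assume "a \<in> range emb"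
    then show "a \<in> frob_field" unfolding frob_field_def using lin_span_single[OF _ one] by force
  qed
  have mult: "a * b \<in> frob_field" if "a \<in> frob_field" "b \<in> frob_field" for a b
  proof -
    have "a * b \<in> lin_span (range emb) ((\<lambda>(s, t). s * t) ` (?S \<times> ?S))"
    proof -
      have sb: "s * b \<in> lin_span (range emb) ((\<lambda>(s, t). s * t) ` (?S \<times> ?S))" if "s \<in> ?S" for s
        using \<open>b \<in> frob_field\<close> unfolding frob_field_def
      proof (induction rule: lin_span.induct)
        case (step c t x)
        have "c * (s * t) \<in> lin_span (range emb) ((\<lambda>(s, t). s * t) ` (?S \<times> ?S))"
          using step that by (intro lin_span_single) auto
        then show ?case using lin_span_add step.IH by (simp add: algebra_simps)
      qed (simp add: lin_span.zero)
      show ?thesis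
        using \<open>a \<in> frob_field\<close> unfolding frob_field_def
      proof (induction rule: lin_span.induct)
        case (step c s x)
        then have "c * (s * b) + x * b \<in> lin_span (range emb) ((\<lambda>(s, t). s * t) ` (?S \<times> ?S))"
          by (intro lin_span_add base.lin_span_scale[OF sb])
        then show ?case by (simp add: algebra_simps)
      qed (simp add: lin_span.zero)
    qed
    moreover have "(\<lambda>(s, t). s * t) ` (?S \<times> ?S) \<subseteq> ?S" by (auto simp flip: power_mult_distrib)
    ultimately show ?thesis unfolding frob_field_def using lin_span_mono by blast
  qed
  have one': "1 \<in> frob_field" using pw[of 1] by simp
  have powr: "a ^ n \<in> frob_field" if "a \<in> frob_field" for a n
    using that by (induction n) (simp_all add: one' mult)
  show "subfield_set frob_field"
  proof
    show "1 \<in> frob_field" by (rule one')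
    fix a b assume ab: "a \<in> frob_field" "b \<in> frob_field"
    show "a - b \<in> frob_field"
      using ab lin_span_add base.lin_span_uminus unfolding frob_field_def by (metis add_uminus_conv_diff)
    show "a * b \<in> frob_field" using mult ab .
  next
    fix a assume a: "a \<in> frob_field"
    have "inverse a = inverse a ^ ?p * a ^ (?p - 1)"
    proof (cases "a = 0")
      case False
      have "inverse a ^ ?p = inverse a * inverse a ^ (?p - 1)" using p by (cases ?p) auto
      then show ?thesis using False by (simp add: power_inverse)
    qed (use p in simp)
    then show "inverse a \<in> frob_field" using mult[OF pw powr[OF a]] by metis
  qed
qed

text \<open>By smoothness, \<open>F\<close> has \<open>p\<close>-degree at most 1 over \<open>K\<close>.\<close>

lemma generated_over_frob_field:
  assumes p: "CHAR('k) > 0"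
  shows "\<exists>u. \<forall>x. \<exists>q. (\<forall>i. coeff q i \<in> frob_field) \<and> x = poly q u"
proof -
  let ?p = "CHAR('k)"
  have pr: "prime ?p" by (rule prime_CHAR_semidom[OF p])
  note F = frob_field_subfield[OF p]
  obtain H where H: "place emb H" using hom_graph.place_exists[OF base_hom_graph] by blast
  obtain i where "xi i \<noteq> 0" using nonzero_coordinate by blast
  then obtain i0 where i0: "xi i0 \<noteq> 0" and dom: "\<And>i. xi i / xi i0 \<in> Domain H"
    by (rule place.pivot[OF H, of xi]) blast
  let ?z = "\<lambda>i. xi i / xi i0"
  let ?gen = "\<lambda>T. subfield_gen (frob_field \<union> ?z ` T)"
  have ps: "power_subfield N ?p" if "subfield_set N" "frob_field \<subseteq> N" for N
    unfolding power_subfield_def power_subfield_axioms_def using that F(2) pr char_eq by auto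
  have genF: "subfield_set (?gen T)" "frob_field \<subseteq> ?gen T" "?z ` T \<subseteq> ?gen T" for T
    using subfield_set_gen subfield_gen_superset[of "frob_field \<union> ?z ` T"] by blast+
  \<comment> \<open>A smallest set of coordinate ratios generating \<open>F\<close> over
    \<open>K F^p\<close>. Each is then outside the field generated by the others, so some derivation
    is 1 on it and kills the others.\<close>
  define T where "T = arg_min card (\<lambda>T. ?gen T = UNIV)"
  have "?gen UNIV = UNIV"
    using field_generated[OF i0 genF(1)[of UNIV]] genF(2,3)[of UNIV] F(3) by blast
  then have T: "?gen T = UNIV" and Tmin: "\<And>T'. ?gen T' = UNIV \<Longrightarrow> card T \<le> card T'"
    using arg_min_nat_lemma[of "\<lambda>T. ?gen T = UNIV" UNIV card] by (auto simp: T_def)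
  show ?thesis
  proof (cases "card T \<le> 1")
    case True
    then obtain j where "T \<subseteq> {j}" using finite[of T] by (metis card_le_Suc0_iff_eq One_nat_def insertI1 singletonI subsetI ex_in_conv empty_subsetI)
    then have "frob_field \<union> ?z ` T \<subseteq> insert (?z j) frob_field" by auto
    then have "subfield_gen (insert (?z j) frob_field) = UNIV"
      using T subfield_gen_least[OF subfield_set_gen] subfield_gen_superset by (metis subset_trans top.extremum_uniqueI)
    then show ?thesis
      using power_subfield.generated_poly_value[OF ps[OF F(1) order_refl], of _ "?z j"] by blast
  next
    case False
    then obtain j1 j2 where j: "j1 \<in> T" "j2 \<in> T" "j1 \<noteq> j2"
      by (metis card_le_Suc0_iff_eq One_nat_def finite)
    have deriv: "\<exists>D. (\<forall>a b. D (a + b) = D a + D b) \<and> (\<forall>a b. D (a * b) = a * D b + b * D a) \<and>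
        (\<forall>c. D (emb c) = 0) \<and> D (?z j) = 1 \<and> D (?z j') = 0" if jj: "j \<in> T" "j' \<in> T" "j \<noteq> j'" for j j'
    proof -
      let ?N = "?gen (T - {j})"
      interpret N: power_subfield ?N ?p by (rule ps[OF genF(1,2)])
      have "card (T - {j}) < card T" using jj(1) by (intro card_Diff1_less) simp_all
      then have "?N \<noteq> UNIV" using Tmin[of "T - {j}"] by auto
      have sup: "frob_field \<union> ?z ` T \<subseteq> insert (?z j) ?N" using genF(2,3)[of "T - {j}"] by blast
      have notin: "?z j \<notin> ?N"
      proof
        assume "?z j \<in> ?N"
        then have "frob_field \<union> ?z ` T \<subseteq> ?N" using sup by (simp only: insert_absorb)
        then have "?gen T \<subseteq> ?N" by (rule subfield_gen_least[OF genF(1)])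
        then show False using T \<open>?N \<noteq> UNIV\<close> by auto
      qed
      have "frob_field \<union> ?z ` T \<subseteq> subfield_gen (insert (?z j) ?N)"
        using sup subfield_gen_superset by blast
      then have "?gen T \<subseteq> subfield_gen (insert (?z j) ?N)"
        by (rule subfield_gen_least[OF subfield_set_gen])
      then have "subfield_gen (insert (?z j) ?N) = UNIV" using T by auto
      from N.derivation_exists[OF notin this] obtain D where
        D: "\<And>a b. D (a + b) = D a + D b" "\<And>a b. D (a * b) = a * D b + b * D a"
          "\<And>c. c \<in> ?N \<Longrightarrow> D c = 0" "D (?z j) = 1" by blast
      have "emb c \<in> ?N" for c using F(3) genF(2)[of "T - {j}"] by blast
      moreover have "?z j' \<in> ?N" using genF(3)[of "T - {j}"] jj by blast
      ultimately show ?thesis using D by blast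
    qed
    obtain D1 where D1: "\<And>a b. D1 (a + b) = D1 a + D1 b" "\<And>a b. D1 (a * b) = a * D1 b + b * D1 a"
      "\<And>c. D1 (emb c) = 0" "D1 (?z j1) = 1" "D1 (?z j2) = 0" using deriv[OF j] by blast
    obtain D2 where D2: "\<And>a b. D2 (a + b) = D2 a + D2 b" "\<And>a b. D2 (a * b) = a * D2 b + b * D2 a"
      "\<And>c. D2 (emb c) = 0" "D2 (?z j2) = 1" "D2 (?z j1) = 0" using deriv[OF j(2,1)] j(3) by blast
    have False
      by (rule no_two_derivations[OF H i0 dom D1(1-3) D2(1-3) D1(4,5) D2(5,4)])
    then show ?thesis ..
  qed
qed

end

subsection \<open>The constant field and the main theorem\<close>

context field_embedding
begin

text \<open>The exponents \<open>p * i + j\<close> with \<open>j < p\<close> are pairwise distinct,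
  so nothing cancels: \<open>1, t, ..., t^(p-1)\<close> are independent over
  \<open>K[t^p]\<close>.\<close>

lemma peval_power_char_sum_zero:
  assumes t: "trans_elt t" and p: "p > 0"
    and z: "(\<Sum>j<p. peval (P j) (t ^ p) * t ^ j) = 0" and j0: "j0 < p"
  shows "P j0 = 0"
proof -
  define Q where "Q = (\<Sum>j<p. \<Sum>i\<le>degree (P j). monom (coeff (P j) i) (p * i + j))"
  have "peval Q t = (\<Sum>j<p. \<Sum>i\<le>degree (P j). emb (coeff (P j) i) * t ^ (p * i + j))"
    by (simp add: Q_def peval_sum peval_monom)
  also have "\<dots> = (\<Sum>j<p. peval (P j) (t ^ p) * t ^ j)"
    by (simp add: peval_altdef sum_distrib_right power_add power_mult mult.assoc)
  finally have "peval Q t = (\<Sum>j<p. peval (P j) (t ^ p) * t ^ j)" .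
  then have Q0: "Q = 0" using t z by (auto simp: trans_elt_def)
  show ?thesis
  proof (rule poly_eqI)
    fix i0
    have inj: "p * i + j = p * i0 + j0 \<longleftrightarrow> i = i0 \<and> j = j0" if "j < p" for i j
    proof
      assume e: "p * i + j = p * i0 + j0"
      have "(p * i + j) div p = i" "(p * i + j) mod p = j" "(p * i0 + j0) div p = i0" "(p * i0 + j0) mod p = j0"
        using that j0 by simp_all
      then show "i = i0 \<and> j = j0" using e by metis
    qed simp
    have "coeff Q (p * i0 + j0) = (\<Sum>j<p. \<Sum>i\<le>degree (P j). if i = i0 \<and> j = j0 then coeff (P j) i else 0)"
      unfolding Q_def coeff_sum coeff_monom by (intro sum.cong refl) (simp add: inj)
    also have "\<dots> = (\<Sum>j<p. if j = j0 then coeff (P j0) i0 else 0)"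
    proof (intro sum.cong refl)
      fix j
      have "(\<Sum>i\<le>degree (P j0). if i = i0 then coeff (P j0) i else 0) = coeff (P j0) i0"
        by (simp add: coeff_eq_0)
      then show "(\<Sum>i\<le>degree (P j). if i = i0 \<and> j = j0 then coeff (P j) i else 0) = (if j = j0 then coeff (P j0) i0 else 0)"
        by (cases "j = j0") (simp_all add: coeff_eq_0)
    qed
    also have "\<dots> = coeff (P j0) i0" using j0 by simp
    finally show "coeff (P j0) i0 = coeff 0 i0" using Q0 by simp
  qed
qed

end

context smooth_projective_geom_irreducible_curve
begin

text \<open>
  Let \<open>1, \<alpha>, \<dots>\<close> be a basis with \<open>r\<close> elements of \<open>F\<close> over \<open>K(t)\<close>. If \<open>\<alpha>\<^sup>p\<close> lies in \<open>K\<close>,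
  then \<open>F\<close> is spanned over \<open>K(t\<^sup>p)\<close> by \<open>p (r - 1)\<close> elements, since the \<open>p\<close>-th powers of the basis
  are dependent; but its dimension is \<open>p r\<close>.
\<close>

lemma inseparable_constant:
  assumes p0: "CHAR('k) > 0" and c: "al ^ CHAR('k) = emb c"
  shows "al \<in> range emb"
proof (rule ccontr)
  assume al: "al \<notin> range emb"
  define p where "p = CHAR('k)"
  have pr: "prime p" and pf: "CHAR('f) = p" using prime_CHAR_semidom[OF p0] char_eq by (auto simp: p_def)
  have pp: "p > 0" using p0 by (simp add: p_def)
  have fro: "(a + b) ^ p = a ^ p + b ^ p" for a b :: 'f
    using pr pf by (intro freshmans_dream) simp_all
  note c = c[folded p_def]
  obtain t where t: "trans_elt t" using trans_elt_exists by blast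
  define L where "L = ratfuns t"
  interpret L: subfield_set L unfolding L_def by (rule subfield_ratfuns)
  obtain S where S: "finite S" "\<And>u. u \<in> lin_span L S" using finite_over_ratfuns[OF t] unfolding L_def by blast
  \<comment> \<open>If \<open>al = a / b\<close> in \<open>K(t)\<close>, then
    \<open>a ^ p = c b ^ p\<close>; comparing leading coefficients makes \<open>c\<close> a p-th
    power in \<open>K\<close>, and p-th roots are unique in characteristic \<open>p\<close>.\<close>
  have alL: "al \<notin> L"
  proof
    assume "al \<in> L"
    then obtain a b where ab: "al = peval a t / peval b t" "peval b t \<noteq> 0" by (auto simp: L_def ratfuns_def)
    have "peval (a ^ p - smult c (b ^ p)) t = 0"
      using c ab by (simp add: power_divide field_simps)
    then have e: "a ^ p = smult c (b ^ p)" using t unfolding trans_elt_def by (metis right_minus_eq)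
    have "lead_coeff a ^ p = c * lead_coeff b ^ p"
      using arg_cong[OF e, of lead_coeff] by (simp add: lead_coeff_power)
    moreover have "lead_coeff b \<noteq> 0" using ab(2) by auto
    ultimately have "c = (lead_coeff a / lead_coeff b) ^ p" by (simp add: power_divide)
    then have "al ^ p = emb (lead_coeff a / lead_coeff b) ^ p" using c by (simp add: emb_power)
    moreover have "al ^ p = (al - emb (lead_coeff a / lead_coeff b)) ^ p + emb (lead_coeff a / lead_coeff b) ^ p"
      using fro[of "al - emb (lead_coeff a / lead_coeff b)" "emb (lead_coeff a / lead_coeff b)"] by simp
    ultimately have "(al - emb (lead_coeff a / lead_coeff b)) ^ p = 0" by simp
    then have "al = emb (lead_coeff a / lead_coeff b)" by simp
    then show False using al by blast
  qed
  have al1: "al \<noteq> 1" using al base.sf_one by metis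
  define indep where "indep = (\<lambda>B. finite B \<and>
    (\<forall>a. (\<forall>b\<in>B. a b \<in> L) \<and> (\<Sum>b\<in>B. a b * b) = 0 \<longrightarrow> (\<forall>b\<in>B. a b = 0)))"
  have bound: "card B \<le> card S" if "indep B" for B
  proof (rule ccontr)
    assume "\<not> card B \<le> card S"
    then have "\<exists>a. (\<forall>b\<in>B. a b \<in> L) \<and> (\<exists>b\<in>B. a b \<noteq> 0) \<and> (\<Sum>b\<in>B. a b * b) = 0"
      using that S by (intro L.lin_dependent[of S B "\<lambda>b. b"]) (auto simp: indep_def)
    then show False using that unfolding indep_def by blast
  qed
  \<comment> \<open>A largest \<open>K(t)\<close>-independent set containing 1 and \<open>al\<close>
    is a basis; having both in it is what later saves one spanning element.\<close>
  define Bs where "Bs = {B. indep B \<and> {1, al} \<subseteq> B}"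
  have "{1, al} \<in> Bs"
    unfolding Bs_def indep_def
  proof (intro CollectI conjI allI impI)
    fix a assume a: "(\<forall>b\<in>{1, al}. a b \<in> L) \<and> (\<Sum>b\<in>{1, al}. a b * b) = 0"
    then have s: "a 1 + a al * al = 0" using al1 by simp
    have "a al = 0"
    proof (rule ccontr)
      assume nz: "a al \<noteq> 0"
      have "a al * al = - a 1" using s by (simp only: add_eq_0_iff)
      then have "al = - a 1 / a al" using nz by (simp add: field_simps)
      moreover have "- a 1 / a al \<in> L" using a by (intro L.sf_divide L.sf_uminus) auto
      ultimately show False using alL by simp
    qed
    then show "\<forall>b\<in>{1, al}. a b = 0" using s by simp
  qed auto
  moreover have "card ` Bs \<subseteq> {..card S}" using bound by (auto simp: Bs_def)
  then have finB: "finite (card ` Bs)" by (rule finite_subset) simp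
  ultimately obtain B where B: "B \<in> Bs" "card B = Max (card ` Bs)"
    using Max_in[OF finB] by (metis (no_types, lifting) empty_iff imageE image_is_empty)
  have Bmax: "card B' \<le> card B" if "B' \<in> Bs" for B' using Max_ge[OF finB] B(2) that by simp
  have Bi: "indep B" "finite B" and Bm: "1 \<in> B" "al \<in> B" using B(1) by (auto simp: Bs_def indep_def)
  have spanB: "x \<in> lin_span L B" for x
  proof (rule ccontr)
    assume x: "x \<notin> lin_span L B"
    then have xB: "x \<notin> B" using L.lin_span_base by blast
    have "indep (insert x B)"
      unfolding indep_def
    proof (intro conjI allI impI)
      fix a assume a: "(\<forall>b\<in>insert x B. a b \<in> L) \<and> (\<Sum>b\<in>insert x B. a b * b) = 0"
      then have s: "a x * x + (\<Sum>b\<in>B. a b * b) = 0" using Bi(2) xB by simp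
      have ax: "a x = 0"
      proof (rule ccontr)
        assume nz: "a x \<noteq> 0"
        have "a x * x = - (\<Sum>b\<in>B. a b * b)" using s by (simp only: add_eq_0_iff2)
        then have "x = inverse (a x) * - (\<Sum>b\<in>B. a b * b)" using nz by (simp add: field_simps)
        moreover have "inverse (a x) * - (\<Sum>b\<in>B. a b * b) \<in> lin_span L B"
          using a by (intro L.lin_span_scale L.lin_span_uminus lin_span_sum lin_span_single L.sf_inverse) auto
        ultimately show False using x by simp
      qed
      then have "(\<Sum>b\<in>B. a b * b) = 0" using s by simp
      then have "\<forall>b\<in>B. a b = 0" using Bi(1) a unfolding indep_def by blast
      then show "\<forall>b\<in>insert x B. a b = 0" using ax by simp
    qed (use Bi in simp)
    then have "card (insert x B) \<le> card B" using Bm by (intro Bmax) (auto simp: Bs_def)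
    then show False using Bi(2) xB by simp
  qed
  define L' where "L' = ratfuns (t ^ p)"
  interpret L': subfield_set L' unfolding L'_def by (rule subfield_ratfuns)
  have embL': "range emb \<subseteq> L'" unfolding L'_def by (rule range_emb_subset_ratfuns)
  have "t \<in> L" using peval_in_ratfuns[of "[:0, 1:]" t] by (simp add: L_def emb_one)
  then have L'L: "L' \<subseteq> L"
    unfolding L'_def using range_emb_subset_ratfuns L.sf_power
    by (intro ratfuns_subset L.subfield_set_axioms) (auto simp: L_def)
  \<comment> \<open>Frobenius: the p-th power of a polynomial in \<open>t\<close> over
    \<open>K\<close> is a polynomial in \<open>t ^ p\<close>.\<close>
  have pevp: "peval q t ^ p = peval (map_poly (\<lambda>a. a ^ p) q) (t ^ p)" for q
  proof (induction q)
    case (pCons a q)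
    have "map_poly (\<lambda>a. a ^ p) (pCons a q) = pCons (a ^ p) (map_poly (\<lambda>a. a ^ p) q)"
      using pp by (simp add: map_poly_pCons)
    then show ?case using pCons by (simp add: fro power_mult_distrib emb_power)
  qed (use pp in simp)
  have powL: "x ^ p \<in> L'" if "x \<in> L" for x
  proof -
    obtain a b where "x = peval a t / peval b t" using \<open>x \<in> L\<close> unfolding L_def ratfuns_def by blast
    then have "x ^ p = peval (map_poly (\<lambda>a. a ^ p) a) (t ^ p) / peval (map_poly (\<lambda>a. a ^ p) b) (t ^ p)"
      by (simp add: power_divide pevp)
    then show ?thesis using L'.sf_divide peval_in_ratfuns by (simp add: L'_def)
  qed
  \<comment> \<open>\<open>al ^ p\<close> is a constant, hence a multiple of \<open>1 ^ p\<close>,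
    and is dropped from the p-th powers of the basis.\<close>
  let ?B = "(\<lambda>b. b ^ p) ` (B - {al})"
  have one: "1 \<in> ?B" using Bm(1) al1 by (intro image_eqI[of _ _ 1]) auto
  have powB: "b ^ p \<in> lin_span L' ?B" if "b \<in> B" for b
  proof (cases "b = al")
    case True
    then show ?thesis using lin_span_single[OF _ one, of "emb c" L'] embL' c by auto
  next
    case False
    then show ?thesis using that by (intro L'.lin_span_base) blast
  qed
  have powF: "x ^ p \<in> lin_span L' ?B" for x
    using spanB[of x]
  proof (induction rule: lin_span.induct)
    case (step d b x)
    have "d ^ p * b ^ p + x ^ p \<in> lin_span L' ?B"
      using step powL powB by (intro lin_span_add L'.lin_span_scale) auto
    then show ?case by (simp add: fro power_mult_distrib)
  qed (simp only: zero_power[OF pp] lin_span.zero)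
  have frobL': "frob_field \<subseteq> lin_span L' ?B"
  proof
    fix x assume "x \<in> frob_field"
    then have "x \<in> lin_span L' (range (\<lambda>x. x ^ p))"
      unfolding frob_field_def p_def[symmetric] by (rule lin_span_mono[OF _ embL' order_refl])
    then show "x \<in> lin_span L' ?B" by (rule L'.lin_span_trans) (use powF in blast)
  qed
  obtain u where u: "\<And>x. \<exists>q. (\<forall>i. coeff q i \<in> frob_field) \<and> x = poly q u"
    using generated_over_frob_field[OF p0] by blast
  let ?U = "(\<lambda>i. u ^ i) ` {..<p}"
  note FF = frob_field_subfield[OF p0, folded p_def]
  have spanU: "x \<in> lin_span frob_field ?U" for x
  proof -
    obtain q where q: "\<forall>i. coeff q i \<in> frob_field" "x = poly q u" using u by blast
    have "coeff q i * u ^ i \<in> lin_span frob_field ?U" for i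
    proof -
      \<comment> \<open>Powers of \<open>u\<close> beyond \<open>p - 1\<close> are absorbed by p-th
        powers, which are scalars here.\<close>
      have "u ^ i = (u ^ (i div p)) ^ p * u ^ (i mod p)"
        by (metis div_mult_mod_eq power_add power_mult)
      then have e: "coeff q i * u ^ i = (coeff q i * (u ^ (i div p)) ^ p) * u ^ (i mod p)" by simp
      show ?thesis unfolding e using q(1) FF(2) pp
        by (intro lin_span_single subfield_set.sf_mult[OF FF(1)]) auto
    qed
    then show ?thesis unfolding q(2) poly_altdef by (intro lin_span_sum)
  qed
  let ?W = "(\<lambda>(s, t). s * t) ` (?B \<times> ?U)"
  have spanW: "x \<in> lin_span L' ?W" for x
    by (rule L'.lin_span_tower[OF spanU frobL'])
  let ?J = "{..<p} \<times> B"
  have finW: "finite ?W" using Bi(2) by simp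
  have "card ?W \<le> card (?B \<times> ?U)" using Bi(2) by (intro card_image_le) simp
  also have "\<dots> \<le> card (B - {al}) * card {..<p}"
    unfolding card_cartesian_product using Bi(2) by (intro mult_le_mono card_image_le) simp_all
  also have "\<dots> < card ?J"
    using card_Diff1_less[OF Bi(2) Bm(2)] pp by (simp add: card_cartesian_product mult.commute)
  finally have "card ?W < card ?J" .
  then obtain a where a: "\<forall>j\<in>?J. a j \<in> L'" "\<exists>j\<in>?J. a j \<noteq> 0" "(\<Sum>j\<in>?J. a j * (t ^ fst j * snd j)) = 0"
    using L'.lin_dependent[OF finW _ _ spanW, of ?J "\<lambda>j. t ^ fst j * snd j"] Bi(2) by auto
  \<comment> \<open>Regrouped by basis elements: \<open>A b\<close> lies in \<open>K(t)\<close>, so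
    independence of \<open>B\<close> kills it; independence of the powers of \<open>t\<close> over
    \<open>K(t ^ p)\<close> then contradicts the nonzero \<open>a (j, b)\<close>.\<close>
  define A where "A = (\<lambda>b. \<Sum>j<p. a (j, b) * t ^ j)"
  have "(\<Sum>j\<in>?J. a j * (t ^ fst j * snd j)) = (\<Sum>b\<in>B. A b * b)"
    unfolding A_def sum_distrib_right by (subst sum.swap) (simp add: sum.cartesian_product case_prod_beta mult.assoc)
  then have "(\<Sum>b\<in>B. A b * b) = 0" using a(3) by simp
  moreover have "A b \<in> L" if "b \<in> B" for b
    unfolding A_def using a(1) L'L that \<open>t \<in> L\<close> by (intro L.sf_sum L.sf_mult L.sf_power) auto
  ultimately have A0: "\<forall>b\<in>B. A b = 0" using Bi(1) unfolding indep_def by blast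
  obtain j b where jb: "j < p" "b \<in> B" "a (j, b) \<noteq> 0" using a(2) by auto
  obtain D P where D: "D \<noteq> 0" "\<And>j. j \<in> {..<p} \<Longrightarrow> peval (P j) (t ^ p) = D * a (j, b)"
    using ratfuns_clear_denominators[of "{..<p}" "\<lambda>j. a (j, b)" "t ^ p"] a(1) jb(2) by (auto simp: L'_def)
  have "(\<Sum>j<p. peval (P j) (t ^ p) * t ^ j) = D * A b"
    unfolding A_def sum_distrib_left by (intro sum.cong refl) (simp add: D(2) mult.assoc)
  then have "(\<Sum>j<p. peval (P j) (t ^ p) * t ^ j) = 0" using A0 jb(2) by simp
  then have "P j = 0" by (rule peval_power_char_sum_zero[OF t pp _ jb(1)])
  then show False using D(1) D(2)[of j] jb by simp
qed

text \<open>Let \<open>q\<close> have least degree at \<open>al\<close>. If it is not linear, its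
  only root in the closure is multiple, so \<open>q\<close> and its derivative share a root.
  Minimality forces the derivative to vanish, so \<open>q\<close> is a polynomial \<open>r\<close>
  in the p-th power of the variable. Then \<open>al ^ p\<close> is a root of \<open>r\<close>, a
  constant by induction, and \<open>inseparable_constant\<close> applies.\<close>

theorem constants_algebraically_closed:
  assumes "q \<noteq> 0" "peval q al = 0"
  shows "al \<in> range emb"
  using assms
proof (induction "degree q" arbitrary: q al rule: less_induct)
  case less
  show ?case
  proof (cases "\<exists>r. r \<noteq> 0 \<and> peval r al = 0 \<and> degree r < degree q")
    case True
    then show ?thesis using less.hyps by blast
  next
    case False
    then have min: "degree q \<le> degree r" if "r \<noteq> 0" "peval r al = 0" for r using that by (meson not_less)
    have dvd: "q dvd r" if "peval r al = 0" for r
      by (rule dvd_of_min_degree[of q "{r. peval r al = 0}"]) (use less.prems min that in auto)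
    have d0: "degree q > 0"
    proof (rule ccontr)
      assume "\<not> degree q > 0"
      then obtain a where "q = [:a:]" by (auto elim: degree_eq_zeroE)
      then show False using less.prems by simp
    qed
    show ?thesis
    proof (cases "degree q = 1")
      case True
      have e: "emb (coeff q 0) + emb (coeff q 1) * al = 0"
        using less.prems(2) True by (simp add: peval_altdef)
      have nz: "emb (coeff q 1) \<noteq> 0" using True less.prems(1) by (metis emb_eq_0_iff leading_coeff_0_iff)
      have "emb (coeff q 1) * al = - emb (coeff q 0)" using e by (simp only: add_eq_0_iff)
      then have "al = - emb (coeff q 0) / emb (coeff q 1)" using nz by (simp add: field_simps)
      then have "al = emb (- coeff q 0 / coeff q 1)" by (simp add: emb_simps)
      then show ?thesis by blast
    next
      case False
      let ?h = "map_poly to_ac q"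
      obtain y where y: "to_ac.peval q y = 0" using nonconstant_poly_root_closure[OF d0] by blast
      have uniq: "y' = y" if "to_ac.peval q y' = 0" for y'
        by (rule roots_of_constant_equal[OF less.prems dvd that y])
      obtain k where k: "?h = [:- y, 1:] * k" using y by (metis dvdE poly_eq_0_iff_dvd to_ac.peval_def)
      have k0: "k \<noteq> 0" using k less.prems(1) by auto
      have "degree ?h = 1 + degree k" unfolding k using degree_mult_eq[OF _ k0, of "[:- y, 1:]"] by simp
      then have "degree k > 0" using False d0 by simp
      then obtain y' where y': "poly k y' = 0" using alg_closed_imp_poly_has_root by blast
      then have "to_ac.peval q y' = 0" by (simp add: to_ac.peval_def k)
      then have ky: "poly k y = 0" using uniq y' by simp
      have "pderiv ?h = [:- y, 1:] * pderiv k + k" unfolding k pderiv_mult by (simp add: pderiv_pCons)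
      moreover have "pderiv ?h = map_poly to_ac (pderiv q)"
        by (rule poly_eqI) (simp add: coeff_pderiv coeff_map_poly)
      ultimately have dy: "to_ac.peval (pderiv q) y = 0" using ky by (simp add: to_ac.peval_def)
      have pd: "pderiv q = 0"
      proof (rule ccontr)
        assume nz: "pderiv q \<noteq> 0"
        obtain d u v where d: "d dvd q" "d dvd pderiv q" "d = u * q + v * pderiv q" using bezout_poly by blast
        obtain e where e: "q = d * e" using d(1) by (blast elim: dvdE)
        have de: "d \<noteq> 0" "e \<noteq> 0" using e less.prems(1) by auto
        have "to_ac.peval d y = 0" using y dy d(3) by simp
        then have "degree d > 0" using de(1) by (auto intro!: gr0I elim: degree_eq_zeroE)
        moreover have "degree (pderiv q) \<le> degree q - 1"
          by (rule degree_le) (auto simp: coeff_pderiv coeff_eq_0)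
        then have "degree d < degree q"
          using dvd_imp_degree_le[OF d(2) nz] d0 by linarith
        moreover have "degree q = degree d + degree e" using e degree_mult_eq[OF de] by simp
        moreover have "peval d al = 0 \<or> peval e al = 0" using less.prems(2) e by simp
        ultimately show False using min[of d] min[of e] de by auto
      qed
      have z: "of_nat i * coeff q i = 0" for i
      proof (cases i)
        case (Suc n)
        then show ?thesis using arg_cong[OF pd, of "\<lambda>r. coeff r n"] by (simp add: coeff_pderiv)
      qed simp
      have "of_nat (degree q) = (0 :: 'k)" using z[of "degree q"] less.prems(1) by simp
      then have pdvd: "CHAR('k) dvd degree q" by (simp add: of_nat_eq_0_iff_char_dvd)
      then have p0: "CHAR('k) > 0" using d0 by (metis dvd_0_left_iff gr0I less_numeral_extra(3))
      let ?p = "CHAR('k)"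
      have p1: "?p > 1" using prime_gt_1_nat[OF prime_CHAR_semidom[OF p0]] .
      define m where "m = degree q div ?p"
      have m: "degree q = ?p * m" using pdvd by (simp add: m_def)
      define r where "r = (\<Sum>i\<le>m. monom (coeff q (?p * i)) i)"
      have cr: "coeff r i = (if i \<le> m then coeff q (?p * i) else 0)" for i
        by (simp add: r_def coeff_sum coeff_monom if_distrib sum.delta cong: if_cong)
      have "degree r \<le> m" by (rule degree_le) (simp add: cr)
      moreover have "m < degree q" using m p1 d0 by (cases "m = 0") auto
      ultimately have "degree r < degree q" by simp
      moreover have "r \<noteq> 0"
      proof
        assume "r = 0"
        then have "coeff q (?p * m) = 0" using cr[of m] by simp
        then show False using m less.prems(1) by (metis leading_coeff_0_iff)
      qed
      moreover have "peval r (al ^ ?p) = 0"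
      proof -
        have "peval r (al ^ ?p) = (\<Sum>i\<le>m. emb (coeff q (?p * i)) * al ^ (?p * i))"
          by (simp add: r_def peval_sum peval_monom power_mult)
        also have "\<dots> = (\<Sum>j\<in>(\<lambda>i. ?p * i) ` {..m}. emb (coeff q j) * al ^ j)"
          using p0 by (subst sum.reindex) (auto simp: inj_on_def)
        also have "\<dots> = (\<Sum>j\<le>degree q. emb (coeff q j) * al ^ j)"
        proof (rule sum.mono_neutral_left)
          show "(\<lambda>i. ?p * i) ` {..m} \<subseteq> {..degree q}" using m by auto
          show "\<forall>j\<in>{..degree q} - (\<lambda>i. ?p * i) ` {..m}. emb (coeff q j) * al ^ j = 0"
          proof
            fix j assume j: "j \<in> {..degree q} - (\<lambda>i. ?p * i) ` {..m}"
            have "coeff q j = 0"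
            proof (rule ccontr)
              assume "coeff q j \<noteq> 0"
              then have "of_nat j = (0 :: 'k)" using z[of j] by simp
              then obtain i where i: "j = ?p * i" by (auto simp: of_nat_eq_0_iff_char_dvd elim: dvdE)
              then have "i \<le> m" using j m p0 by auto
              then show False using j i by blast
            qed
            then show "emb (coeff q j) * al ^ j = 0" by simp
          qed
        qed simp
        also have "\<dots> = 0" using less.prems(2) by (simp add: peval_altdef)
        finally show ?thesis .
      qed
      ultimately have "al ^ ?p \<in> range emb" by (intro less.hyps)
      then show ?thesis using inseparable_constant[OF p0] by blast
    qed
  qed
qed

text \<open>If \<open>x\<close> were algebraic it would be a constant, and then \<open>y\<close>, a
  root of a monic quadratic with constant coefficients, would be one too.\<close>

lemma nonconstant_point_transcendental:
  assumes P: "Affine x y \<in> ec_points (map_weierstrass emb E)"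
    and nc: "Affine x y \<notin> map_ec_point emb ` ec_points E"
  shows "trans_elt x"
proof (rule ccontr)
  assume "\<not> trans_elt x"
  then obtain q where "q \<noteq> 0" "peval q x = 0" by (auto simp: trans_elt_def)
  then obtain x0 where x0: "x = emb x0" using constants_algebraically_closed by blast
  let ?q = "[: - (x0 ^ 3 + wa2 E * x0 ^ 2 + wa4 E * x0 + wa6 E), wa1 E * x0 + wa3 E, 1:]"
  have "peval ?q y = 0"
    using P unfolding mem_ec_points_iff map_weierstrass_sel x0
    by (simp add: emb_simps algebra_simps power2_eq_square)
  moreover have "?q \<noteq> 0" by simp
  ultimately obtain y0 where y0: "y = emb y0" using constants_algebraically_closed by blast
  have "Affine x y = map_ec_point emb (Affine x0 y0)" by (simp add: x0 y0)
  moreover from this have "Affine x0 y0 \<in> ec_points E" using P map_ec_point_mem_iff by metis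
  ultimately show False using nc by blast
qed

end

theorem theoremC:
  fixes emb :: "'k::field \<Rightarrow> 'f::field"
    and \<xi> :: "'f ^ 'i::finite"
    and E :: "'k weierstrass"
    and P :: "'f ec_point"
    and n :: nat
  assumes "smooth_projective_geom_irreducible_curve emb \<xi>"
    and "elliptic_curve E"
    and "P \<in> ec_points (map_weierstrass emb E)"
    and "P \<notin> map_ec_point emb ` ec_points E"
    and "infinite_order (map_weierstrass emb E) P"
    and "n > 0"
  shows "(\<not> CHAR('k) dvd n \<or> ordinary E \<longrightarrow>
            (\<exists>v. primitive_valuation emb (map_weierstrass emb E) P n v)) \<and>
         (CHAR('k) dvd n \<and> supersingular E \<longrightarrow>
            (\<forall>v. is_valuation emb v \<longrightarrow>
               eds (map_weierstrass emb E) P n v =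
                 ereal (real (CHAR('k) ^ 2)) * eds (map_weierstrass emb E) P (n div CHAR('k)) v) \<and>
            \<not> (\<exists>v. primitive_valuation emb (map_weierstrass emb E) P n v))"
proof -
  interpret smooth_projective_geom_irreducible_curve emb \<xi> by (rule assms(1))
  have "P \<noteq> Infty"
  proof
    assume "P = Infty"
    then have "P = map_ec_point emb Infty" by simp
    then show False using assms(4) Infty_in_ec_points by blast
  qed
  then obtain x y where P: "P = Affine x y" by (cases P) auto
  have x: "trans_elt x" using nonconstant_point_transcendental assms(3,4) unfolding P by blast
  show ?thesis
  proof (intro conjI impI)
    assume "\<not> CHAR('k) dvd n \<or> ordinary E"
    then show "\<exists>v. primitive_valuation emb (map_weierstrass emb E) P n v"
      using primitive_valuation_exists[OF assms(2), of x y n] assms(3,5,6) x valuation_exists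
      unfolding P trans_elt_def by blast
  next
    assume a: "CHAR('k) dvd n \<and> supersingular E"
    let ?p = "CHAR('k)"
    have p0: "?p > 0" using a by (simp add: supersingular_def)
    have eq: "eds (map_weierstrass emb E) P n v =
        ereal (real (?p ^ 2)) * eds (map_weierstrass emb E) P (n div ?p) v" if "is_valuation emb v" for v
    proof -
      interpret valuation emb v by standard (rule that)
      show ?thesis using eds_supersingular[OF assms(2,3,5,6)] a by blast
    qed
    show "\<forall>v. is_valuation emb v \<longrightarrow> eds (map_weierstrass emb E) P n v =
        ereal (real (?p ^ 2)) * eds (map_weierstrass emb E) P (n div ?p) v" using eq by blast
    show "\<not> (\<exists>v. primitive_valuation emb (map_weierstrass emb E) P n v)"
    proof
      assume "\<exists>v. primitive_valuation emb (map_weierstrass emb E) P n v"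
      then obtain v where v: "is_valuation emb v" "eds (map_weierstrass emb E) P n v > 0"
        "\<And>m. 1 \<le> m \<Longrightarrow> m < n \<Longrightarrow> eds (map_weierstrass emb E) P m v = 0"
        by (auto simp: primitive_valuation_def)
      have p1: "?p > 1" using prime_gt_1_nat[OF prime_CHAR_semidom[OF p0]] .
      \<comment> \<open>\<open>n / p\<close> is a smaller positive index, so primitivity would make
        its term vanish, and with it the term at \<open>n\<close>.\<close>
      have "1 \<le> n div ?p" using a assms(6) p0 dvd_imp_le[of ?p n] by (simp add: div_greater_zero_iff Suc_le_eq)
      moreover have "n div ?p < n" using p1 assms(6) by (intro div_less_dividend)
      ultimately have "eds (map_weierstrass emb E) P (n div ?p) v = 0" by (rule v(3))
      then show False using eq[OF v(1)] v(2) by simp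
    qed
  qed
qed

end
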